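(* Let $k$ be a commutative ring with unit and let $b>a>0$ be integers. Then $H^*(\mathbb{C}(\mathbf{b},\mathbf{a}))$ is the free graded $k$-module $$H^*(\mathbb{C}(\mathbf{b},\mathbf{a}))\cong\begin{cases}k & *=b-a\\ 0 & 0<*<b-a\ \text{ or }\ *>b-a\\ k^{\oplus\mathrm{Rk}(b,a)} & *=0,\end{cases}$$ where $\mathrm{Rk}(b,a)=\chi(\mathbb{C}(\mathbf{b},\mathbf{a}))-(-1)^{b-a}$, for $\chi$ the Euler–Poincaré characteristic of the complex $\mathbb{C}(\mathbf{b},\mathbf{a})$: $$\chi(\mathbb{C}(\mathbf{b},\mathbf{a}))=\sum_{t=0}^{b-a}(-1)^t\binom{b}{t}\,|\mathrm{Hom}_{\mathbf{\Omega}}(\mathbf{b-t},\mathbf{a})|.$$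
   Context: $\mathbf{n}=\{1,\dots,n\}$ and $\mathbf{b-t}=\{1,\dots,b-t\}$. $\mathbf{\Omega}$ is the category of finite sets and surjections. For a finite set $S$, $\mathrm{Or}(S)=\Lambda^{|S|}(kS)$ is the top exterior power of the free $k$-module $kS$ on $S$. $\mathbb{C}(\mathbf{b},\mathbf{a})$ is the cochain complex with, for $t\in\mathbb{N}$, $$\mathbb{C}(\mathbf{b},\mathbf{a})^t=\bigoplus_{\mathbf{b}^{(t)}\subset\mathbf{b},\,|\mathbf{b}^{(t)}|=b-t}k\,\mathrm{Hom}_{\mathbf{\Omega}}(\mathbf{b}^{(t)},\mathbf{a})\otimes\mathrm{Or}(\mathbf{b}\setminus\mathbf{b}^{(t)}),$$ where $k\,\mathrm{Hom}_{\mathbf{\Omega}}(S,\mathbf{a})$ is the free $k$-module on the set of surjections $S\to\mathbf{a}$, and differential, for $f\in\mathrm{Hom}_{\mathbf{\Omega}}(\mathbf{b}^{(t)},\mathbf{a})$ and $\alpha\in\mathrm{Or}(\mathbf{b}\setminus\mathbf{b}^{(t)})$, $$d([f]\otimes\alpha)=\sum_{y}[f\circ\iota_y]\otimes(y\wedge\alpha),$$ the sum being over those $y\in\mathbf{b}^{(t)}$ such that $f\circ\iota_y$ is surjective, where $\iota_y:\mathbf{b}^{(t)}\setminus\{y\}\hookrightarrow\mathbf{b}^{(t)}$ is the inclusion. *)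

theory Defs
  imports "HOL-Algebra.Module" "HOL-Algebra.AbelCoset"
begin

section \<open>Modules over a commutative ring\<close>

text \<open>
  A module is a record of type \<^typ>\<open>('r, 'm) module\<close>; the fields \<open>mult\<close> and \<open>one\<close>
  play no role for modules and are left unspecified.
\<close>

definition mod_hom ::
    "('r, 'x) ring_scheme \<Rightarrow> ('r, 'm) module \<Rightarrow> ('r, 'n) module \<Rightarrow> ('m \<Rightarrow> 'n) set" where
  "mod_hom R M N = {h \<in> carrier M \<rightarrow> carrier N.
     (\<forall>u\<in>carrier M. \<forall>v\<in>carrier M. h (u \<oplus>\<^bsub>M\<^esub> v) = h u \<oplus>\<^bsub>N\<^esub> h v) \<and>
     (\<forall>r\<in>carrier R. \<forall>u\<in>carrier M. h (r \<odot>\<^bsub>M\<^esub> u) = r \<odot>\<^bsub>N\<^esub> h u)}"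

definition mod_isomorphic ::
    "('r, 'x) ring_scheme \<Rightarrow> ('r, 'm) module \<Rightarrow> ('r, 'n) module \<Rightarrow> bool" where
  "mod_isomorphic R M N \<longleftrightarrow> module R M \<and> module R N \<and>
     (\<exists>h\<in>mod_hom R M N. bij_betw h (carrier M) (carrier N))"

definition submodule_generated ::
    "('r, 'x) ring_scheme \<Rightarrow> ('r, 'm) module \<Rightarrow> 'm set \<Rightarrow> 'm set" where
  "submodule_generated R M A = \<Inter>{H. submodule H R M \<and> A \<subseteq> H}"

definition quot_module :: "('r, 'm) module \<Rightarrow> 'm set \<Rightarrow> ('r, 'm set) module" where
  "quot_module M N = \<lparr>carrier = a_rcosets\<^bsub>M\<^esub> N, mult = undefined, one = undefined,
     zero = N, add = set_add M, smult = (\<lambda>r A. \<Union>u\<in>A. N +>\<^bsub>M\<^esub> (r \<odot>\<^bsub>M\<^esub> u))\<rparr>"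

definition direct_sum :: "'i set \<Rightarrow> ('i \<Rightarrow> ('r, 'm) module) \<Rightarrow> ('r, 'i \<Rightarrow> 'm) module" where
  "direct_sum I M =
    \<lparr>carrier = {c \<in> (\<Pi>\<^sub>E i\<in>I. carrier (M i)). finite {i \<in> I. c i \<noteq> \<zero>\<^bsub>M i\<^esub>}},
     mult = undefined, one = undefined,
     zero = (\<lambda>i\<in>I. \<zero>\<^bsub>M i\<^esub>),
     add = (\<lambda>c c'. \<lambda>i\<in>I. c i \<oplus>\<^bsub>M i\<^esub> c' i),
     smult = (\<lambda>r c. \<lambda>i\<in>I. r \<odot>\<^bsub>M i\<^esub> c i)\<rparr>"

definition summand_inj :: "'i set \<Rightarrow> ('i \<Rightarrow> ('r, 'm) module) \<Rightarrow> 'i \<Rightarrow> 'm \<Rightarrow> 'i \<Rightarrow> 'm" where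
  "summand_inj I M i m = (\<lambda>j\<in>I. if j = i then m else \<zero>\<^bsub>M j\<^esub>)"

text \<open>
  The free module on a set \<open>X\<close>. Its elements are total functions vanishing outside \<open>X\<close>
  (rather than extensional ones), so that \<open>free_module R X\<close> is literally a submodule of
  \<open>free_module R Y\<close> when \<open>X \<subseteq> Y\<close>, and the basis vector of \<open>x\<close> does not depend on \<open>X\<close>.
\<close>

definition free_module :: "('r, 'x) ring_scheme \<Rightarrow> 'i set \<Rightarrow> ('r, 'i \<Rightarrow> 'r) module" where
  "free_module R X =
    \<lparr>carrier = {u. (\<forall>x. u x \<in> carrier R) \<and> (\<forall>x. x \<notin> X \<longrightarrow> u x = \<zero>\<^bsub>R\<^esub>) \<and>
                   finite {x. u x \<noteq> \<zero>\<^bsub>R\<^esub>}},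
     mult = undefined, one = undefined,
     zero = (\<lambda>x. \<zero>\<^bsub>R\<^esub>),
     add = (\<lambda>u v x. u x \<oplus>\<^bsub>R\<^esub> v x),
     smult = (\<lambda>r u x. r \<otimes>\<^bsub>R\<^esub> u x)\<rparr>"

definition basis_vec :: "('r, 'x) ring_scheme \<Rightarrow> 'i \<Rightarrow> 'i \<Rightarrow> 'r" where
  "basis_vec R x = (\<lambda>y. if y = x then \<one>\<^bsub>R\<^esub> else \<zero>\<^bsub>R\<^esub>)"

abbreviation free_power :: "('r, 'x) ring_scheme \<Rightarrow> nat \<Rightarrow> ('r, nat \<Rightarrow> 'r) module" where
  "free_power R n \<equiv> free_module R {..<n}"


section \<open>Tensor products and exterior powers\<close>

definition tensor_rels ::
    "('r, 'x) ring_scheme \<Rightarrow> ('r, 'm) module \<Rightarrow> ('r, 'n) module \<Rightarrow> ('m \<times> 'n \<Rightarrow> 'r) set" where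
  "tensor_rels R M N =
    (let F = free_module R (carrier M \<times> carrier N); e = basis_vec R in
     submodule_generated R F
      ({e (u \<oplus>\<^bsub>M\<^esub> u', v) \<ominus>\<^bsub>F\<^esub> (e (u, v) \<oplus>\<^bsub>F\<^esub> e (u', v)) | u u' v.
          u \<in> carrier M \<and> u' \<in> carrier M \<and> v \<in> carrier N} \<union>
       {e (u, v \<oplus>\<^bsub>N\<^esub> v') \<ominus>\<^bsub>F\<^esub> (e (u, v) \<oplus>\<^bsub>F\<^esub> e (u, v')) | u v v'.
          u \<in> carrier M \<and> v \<in> carrier N \<and> v' \<in> carrier N} \<union>
       {e (r \<odot>\<^bsub>M\<^esub> u, v) \<ominus>\<^bsub>F\<^esub> r \<odot>\<^bsub>F\<^esub> e (u, v) | r u v.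
          r \<in> carrier R \<and> u \<in> carrier M \<and> v \<in> carrier N} \<union>
       {e (u, r \<odot>\<^bsub>N\<^esub> v) \<ominus>\<^bsub>F\<^esub> r \<odot>\<^bsub>F\<^esub> e (u, v) | r u v.
          r \<in> carrier R \<and> u \<in> carrier M \<and> v \<in> carrier N}))"

definition tensor_module ::
    "('r, 'x) ring_scheme \<Rightarrow> ('r, 'm) module \<Rightarrow> ('r, 'n) module \<Rightarrow>
     ('r, ('m \<times> 'n \<Rightarrow> 'r) set) module" where
  "tensor_module R M N =
     quot_module (free_module R (carrier M \<times> carrier N)) (tensor_rels R M N)"

definition pure_tensor ::
    "('r, 'x) ring_scheme \<Rightarrow> ('r, 'm) module \<Rightarrow> ('r, 'n) module \<Rightarrow> 'm \<Rightarrow> 'n \<Rightarrow>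
     ('m \<times> 'n \<Rightarrow> 'r) set" where
  "pure_tensor R M N u v =
     tensor_rels R M N +>\<^bsub>free_module R (carrier M \<times> carrier N)\<^esub> basis_vec R (u, v)"

text \<open>
  \<open>\<Lambda>\<^sup>n M\<close> is the free module on the \<open>n\<close>-tuples of elements of \<open>M\<close> modulo multilinearity and
  the vanishing of tuples with a repeated entry; the class of the tuple \<open>[m\<^sub>1, \<dots>, m\<^sub>n]\<close> is
  \<open>m\<^sub>1 \<and> \<dots> \<and> m\<^sub>n\<close>.
\<close>

definition tuples :: "nat \<Rightarrow> 'm set \<Rightarrow> 'm list set" where
  "tuples n A = {ms. length ms = n \<and> set ms \<subseteq> A}"

definition ext_rels ::
    "('r, 'x) ring_scheme \<Rightarrow> nat \<Rightarrow> ('r, 'm) module \<Rightarrow> ('m list \<Rightarrow> 'r) set" where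
  "ext_rels R n M =
    (let F = free_module R (tuples n (carrier M)); e = basis_vec R in
     submodule_generated R F
      ({e (ms @ (u \<oplus>\<^bsub>M\<^esub> v) # ms') \<ominus>\<^bsub>F\<^esub> (e (ms @ u # ms') \<oplus>\<^bsub>F\<^esub> e (ms @ v # ms'))
          | ms u v ms'. ms @ u # ms' \<in> tuples n (carrier M) \<and> v \<in> carrier M} \<union>
       {e (ms @ (r \<odot>\<^bsub>M\<^esub> u) # ms') \<ominus>\<^bsub>F\<^esub> r \<odot>\<^bsub>F\<^esub> e (ms @ u # ms')
          | ms r u ms'. ms @ u # ms' \<in> tuples n (carrier M) \<and> r \<in> carrier R} \<union>
       {e ms | ms. ms \<in> tuples n (carrier M) \<and> \<not> distinct ms}))"

definition ext_power ::
    "('r, 'x) ring_scheme \<Rightarrow> nat \<Rightarrow> ('r, 'm) module \<Rightarrow> ('r, ('m list \<Rightarrow> 'r) set) module" where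
  "ext_power R n M = quot_module (free_module R (tuples n (carrier M))) (ext_rels R n M)"

text \<open>
  Left exterior multiplication \<open>m\<^sub>1 \<and> \<dots> \<and> m\<^sub>n \<mapsto> m \<and> m\<^sub>1 \<and> \<dots> \<and> m\<^sub>n\<close> by an element \<open>m\<close> of \<open>M\<close>,
  as a map from \<open>\<Lambda>\<^sup>n M'\<close> to \<open>\<Lambda>\<^sup>n\<^sup>+\<^sup>1 M\<close> for any submodule \<open>M'\<close> of \<open>M\<close>.
  On representatives it is the linear extension \<open>prepend\<close> of \<open>ms \<mapsto> m # ms\<close>.
\<close>

definition prepend :: "('r, 'x) ring_scheme \<Rightarrow> 'm \<Rightarrow> ('m list \<Rightarrow> 'r) \<Rightarrow> 'm list \<Rightarrow> 'r" where
  "prepend R m \<phi> = (\<lambda>ms. if ms \<noteq> [] \<and> hd ms = m then \<phi> (tl ms) else \<zero>\<^bsub>R\<^esub>)"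

definition wedge_left ::
    "('r, 'x) ring_scheme \<Rightarrow> nat \<Rightarrow> ('r, 'm) module \<Rightarrow> 'm \<Rightarrow>
     ('m list \<Rightarrow> 'r) set \<Rightarrow> ('m list \<Rightarrow> 'r) set" where
  "wedge_left R n M m A =
     (\<Union>\<phi>\<in>A. ext_rels R (Suc n) M +>\<^bsub>free_module R (tuples (Suc n) (carrier M))\<^esub> prepend R m \<phi>)"

definition Or ::
    "('r, 'x) ring_scheme \<Rightarrow> 'i set \<Rightarrow> ('r, (('i \<Rightarrow> 'r) list \<Rightarrow> 'r) set) module" where
  "Or R S = ext_power R (card S) (free_module R S)"

text \<open>For \<open>y \<notin> S\<close>, the map \<open>\<alpha> \<mapsto> y \<and> \<alpha>\<close> from \<open>Or(S)\<close> to \<open>Or(S \<union> {y})\<close>.\<close>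

definition Or_wedge ::
    "('r, 'x) ring_scheme \<Rightarrow> 'i set \<Rightarrow> 'i \<Rightarrow>
     (('i \<Rightarrow> 'r) list \<Rightarrow> 'r) set \<Rightarrow> (('i \<Rightarrow> 'r) list \<Rightarrow> 'r) set" where
  "Or_wedge R S y \<alpha> = wedge_left R (card S) (free_module R (insert y S)) (basis_vec R y) \<alpha>"


section \<open>Cohomology and Euler characteristic\<close>

definition coboundaries ::
    "(nat \<Rightarrow> ('r, 'm) module) \<Rightarrow> (nat \<Rightarrow> 'm \<Rightarrow> 'm) \<Rightarrow> nat \<Rightarrow> 'm set" where
  "coboundaries C d t = (case t of 0 \<Rightarrow> {\<zero>\<^bsub>C 0\<^esub>} | Suc s \<Rightarrow> d s ` carrier (C s))"

definition cohomology ::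
    "(nat \<Rightarrow> ('r, 'm) module) \<Rightarrow> (nat \<Rightarrow> 'm \<Rightarrow> 'm) \<Rightarrow> nat \<Rightarrow> ('r, 'm set) module" where
  "cohomology C d t =
     quot_module (C t\<lparr>carrier := {c \<in> carrier (C t). d t c = \<zero>\<^bsub>C (Suc t)\<^esub>}\<rparr>) (coboundaries C d t)"

text \<open>
  \<open>\<chi>\<close> is the alternating sum of the ranks of the finitely many nonzero free modules \<open>C t\<close>.
  This is a relation because ranks are not unique over the zero ring.
\<close>

definition has_euler_char ::
    "('r, 'x) ring_scheme \<Rightarrow> (nat \<Rightarrow> ('r, 'm) module) \<Rightarrow> int \<Rightarrow> bool" where
  "has_euler_char R C \<chi> \<longleftrightarrow>
     (\<exists>r. (\<forall>t. mod_isomorphic R (C t) (free_power R (r t))) \<and> finite {t. r t \<noteq> 0} \<and>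
          \<chi> = (\<Sum>t | r t \<noteq> 0. (-1) ^ t * int (r t)))"


section \<open>The complex of surjections\<close>

definition surjs :: "'i set \<Rightarrow> 'j set \<Rightarrow> ('i \<Rightarrow> 'j) set" where
  "surjs S A = {f \<in> S \<rightarrow>\<^sub>E A. f ` S = A}"

definition layer :: "nat \<Rightarrow> nat \<Rightarrow> nat set set" where
  "layer b t = {T. T \<subseteq> {1..b} \<and> card T + t = b}"

type_synonym 'r summand =
  "(((nat \<Rightarrow> nat) \<Rightarrow> 'r) \<times> ((nat \<Rightarrow> 'r) list \<Rightarrow> 'r) set \<Rightarrow> 'r) set"

definition surj_summand ::
    "('r, 'x) ring_scheme \<Rightarrow> nat \<Rightarrow> nat \<Rightarrow> nat set \<Rightarrow> ('r, 'r summand) module" where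
  "surj_summand R b a T = tensor_module R (free_module R (surjs T {1..a})) (Or R ({1..b} - T))"

definition surj_cochains ::
    "('r, 'x) ring_scheme \<Rightarrow> nat \<Rightarrow> nat \<Rightarrow> nat \<Rightarrow> ('r, nat set \<Rightarrow> 'r summand) module" where
  "surj_cochains R b a t = direct_sum (layer b t) (surj_summand R b a)"

text \<open>The element \<open>[f] \<otimes> \<alpha>\<close> of the summand of \<open>\<complex>(b,a)\<^sup>t\<close> indexed by \<open>T\<close>.\<close>

definition surj_elem ::
    "('r, 'x) ring_scheme \<Rightarrow> nat \<Rightarrow> nat \<Rightarrow> nat \<Rightarrow> nat set \<Rightarrow> (nat \<Rightarrow> nat) \<Rightarrow>
     ((nat \<Rightarrow> 'r) list \<Rightarrow> 'r) set \<Rightarrow> nat set \<Rightarrow> 'r summand" where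
  "surj_elem R b a t T f \<alpha> = summand_inj (layer b t) (surj_summand R b a) T
     (pure_tensor R (free_module R (surjs T {1..a})) (Or R ({1..b} - T)) (basis_vec R f) \<alpha>)"

text \<open>
  The differential is the unique linear map with the prescribed values on the generators
  \<open>[f] \<otimes> \<alpha>\<close>; it is made extensional so as to be unique as a HOL function.
\<close>

definition surj_diff ::
    "('r, 'x) ring_scheme \<Rightarrow> nat \<Rightarrow> nat \<Rightarrow> nat \<Rightarrow>
     (nat set \<Rightarrow> 'r summand) \<Rightarrow> (nat set \<Rightarrow> 'r summand)" where
  "surj_diff R b a t =
    (THE d. d \<in> mod_hom R (surj_cochains R b a t) (surj_cochains R b a (Suc t)) \<and>
       d \<in> extensional (carrier (surj_cochains R b a t)) \<and>
       (\<forall>T\<in>layer b t. \<forall>f\<in>surjs T {1..a}. \<forall>\<alpha>\<in>carrier (Or R ({1..b} - T)).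
          d (surj_elem R b a t T f \<alpha>) =
            (\<Oplus>\<^bsub>surj_cochains R b a (Suc t)\<^esub>
              y\<in>{y \<in> T. restrict f (T - {y}) \<in> surjs (T - {y}) {1..a}}.
                surj_elem R b a (Suc t) (T - {y}) (restrict f (T - {y}))
                  (Or_wedge R ({1..b} - T) y \<alpha>))))"

definition surj_cohomology ::
    "('r, 'x) ring_scheme \<Rightarrow> nat \<Rightarrow> nat \<Rightarrow> nat \<Rightarrow> ('r, (nat set \<Rightarrow> 'r summand) set) module" where
  "surj_cohomology R b a t = cohomology (surj_cochains R b a) (surj_diff R b a) t"

definition surj_euler_char :: "nat \<Rightarrow> nat \<Rightarrow> int" where
  "surj_euler_char b a =
     (\<Sum>t=0..b - a. (-1) ^ t * int (b choose t) * int (card (surjs {1..b - t} {1..a})))"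

definition Rk :: "nat \<Rightarrow> nat \<Rightarrow> int" where
  "Rk b a = surj_euler_char b a - (-1) ^ (b - a)"

end

theory Submission
  imports Defs "HOL-Combinatorics.Permutations"
begin

text \<open>
  A surjection from a subset of \<open>{1..b}\<close> onto \<open>{1..a}\<close> is a word of length \<open>b\<close> in the letters
  \<open>0, \<dots>, a\<close> in which each of \<open>1, \<dots>, a\<close> occurs; the letter \<open>0\<close> marks the places where the map is
  undefined, and the number of zeros is the cochain degree. Once the factors \<open>Or\<close> are trivialised by
  the order of the natural numbers, the differential on coefficient functions reads
  \<open>(d c) w = (\<Sum>y. \<plusminus> (\<Sum>x\<le>a. c (w(y := x))))\<close>, where \<open>y\<close> runs over the zeros of \<open>w\<close>. Thus \<open>d\<close> is the
  sum of operators \<open>D\<^sub>1, \<dots>, D\<^sub>a\<close>, one for each letter, and these anticommute.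

  The cohomology is computed by induction on the number \<open>a\<close> of letters, starting from the empty
  alphabet, where the complex is \<open>k\<close> in degree \<open>b\<close>. By anticommutation, the operator \<open>D\<close> of the
  letter \<open>a + 1\<close> is, up to sign, a cochain map from the complex with \<open>a + 1\<close> letters to the complex
  with \<open>a\<close> letters, raising the degree by one (\<open>peel_bd\<close>). It is onto (\<open>peel_lift\<close>), and its kernel is
  acyclic (\<open>closed_unpeeled_exact\<close>): if the places of the letters \<open>1, \<dots>, a\<close> are fixed, a word with
  \<open>a + 1\<close> letters is a nonempty set of the remaining places, and peeling is the map to the term of
  the empty set in the augmented complex of the simplex on these places. Up to terms that delete old
  letters, the kernel is therefore made of augmented complexes of nonempty simplices, which are
  contracted by toggling the first vertex. Hence in positive degrees the complex with \<open>a + 1\<close> letters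
  has the cohomology of the complex with \<open>a\<close> letters one degree higher. This gives exactness in
  positive degrees below \<open>b - a\<close> and one copy of \<open>k\<close> in degree \<open>b - a\<close>, detected by the iterated
  map \<open>top_functional\<close>.

  In degree \<open>0\<close> the cohomology is the kernel of \<open>d\<close>, and a basis is needed, as a finitely generated
  projective module over \<open>k\<close> need not be free. The same induction selects a set of words, the
  \<open>pivots\<close>, such that \<open>d\<close> is injective on cochains supported on pivots and every coboundary is the
  coboundary of such a cochain (\<open>closed_pivot_zero\<close>, \<open>bd_pivots\<close>). So restricting to the words of
  degree \<open>0\<close> that are not pivots identifies the kernel with a free module, whose rank is found by
  counting (\<open>card_words_pivots\<close>).

  All of this happens over the integers, where it amounts to a contraction given by integer matrices
  (\<open>integral_splitting\<close>). Matrix identities survive the passage to any commutative ring, which gives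
  the same statements over \<open>k\<close>.

  It remains to identify the complex of surjections with the complex of words. The module \<open>Or S\<close>
  is generated by the wedge of the basis vectors in increasing order (\<open>Or_generated\<close>), and the
  determinant shows that this generator is a basis (\<open>Or_functional\<close>). Each cochain module is then
  generated by elements indexed by words and has a dual family of functionals (\<open>coords_iso\<close>), and a
  linear map with the prescribed values on generators corresponds to the differential on words
  (\<open>surj_diff_eq_bd_R\<close>).
\<close>

section \<open>Words and the differential\<close>

definition zeros :: "nat \<Rightarrow> (nat \<Rightarrow> nat) \<Rightarrow> nat set" where
  "zeros b w = {i\<in>{1..b}. w i = 0}"

definition words :: "nat \<Rightarrow> nat \<Rightarrow> nat \<Rightarrow> (nat \<Rightarrow> nat) set" where
  "words b a t = {w. (\<forall>i. w i \<le> a) \<and> (\<forall>i. i \<notin> {1..b} \<longrightarrow> w i = 0) \<and>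
     (\<forall>x\<in>{1..a}. \<exists>i. w i = x) \<and> card (zeros b w) = t}"

text \<open>
  If \<open>y\<close> is a zero of \<open>w\<close>, this is the sign by which \<open>y \<and> \<alpha>\<close> differs from the increasing wedge of
  the zeros of \<open>w\<close>, where \<open>\<alpha>\<close> is the increasing wedge of the other zeros.
\<close>

definition pos_sign :: "nat \<Rightarrow> (nat \<Rightarrow> nat) \<Rightarrow> nat \<Rightarrow> int" where
  "pos_sign b w y = (-1) ^ card {z\<in>zeros b w. z < y}"

text \<open>
  The operator \<open>D\<^sub>x\<close>. On coefficient functions, deleting letters turns into filling zeros: the
  coefficient at \<open>w\<close> collects those at the words from which \<open>w\<close> arises by deleting one letter \<open>x\<close>.
\<close>

definition insert_letter :: "nat \<Rightarrow> nat \<Rightarrow> ((nat \<Rightarrow> nat) \<Rightarrow> int) \<Rightarrow> (nat \<Rightarrow> nat) \<Rightarrow> int" where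
  "insert_letter b x c w = (\<Sum>y\<in>zeros b w. pos_sign b w y * c (w(y := x)))"

text \<open>
  The condition that a deleted letter must occur elsewhere is built into the domain: a word \<open>w\<close> of
  degree \<open>t + 1\<close> uses all letters, so every word obtained by filling a zero of \<open>w\<close> does too.
\<close>

definition bd :: "nat \<Rightarrow> nat \<Rightarrow> nat \<Rightarrow> ((nat \<Rightarrow> nat) \<Rightarrow> int) \<Rightarrow> (nat \<Rightarrow> nat) \<Rightarrow> int" where
  "bd b a t c w = (if w \<in> words b a (Suc t) then \<Sum>x=1..a. insert_letter b x c w else 0)"

text \<open>
  Over the alphabet \<open>{1..a + 1}\<close> the differential leaves out the terms in which a letter is deleted at
  its only occurrence. These are the terms left out for the letter \<open>a + 1\<close>; they live on words that
  use exactly the letters \<open>1, \<dots>, a\<close>.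
\<close>

definition peel :: "nat \<Rightarrow> nat \<Rightarrow> nat \<Rightarrow> ((nat \<Rightarrow> nat) \<Rightarrow> int) \<Rightarrow> (nat \<Rightarrow> nat) \<Rightarrow> int" where
  "peel b a t c w = (if w \<in> words b a (Suc t) then insert_letter b (Suc a) c w else 0)"

lemma finite_zeros [simp]: "finite (zeros b w)"
  by (simp add: zeros_def)

lemma zeros_upd: "x > 0 \<Longrightarrow> zeros b (w(y := x)) = zeros b w - {y}"
  by (auto simp: zeros_def)

lemma finite_words [simp]: "finite (words b a t)"
proof (rule finite_subset)
  show "words b a t \<subseteq> {f. \<forall>i. (i \<in> {1..b} \<longrightarrow> f i \<in> {0..a}) \<and> (i \<notin> {1..b} \<longrightarrow> f i = 0)}"
    by (auto simp: words_def)
  show "finite {f. \<forall>i. (i \<in> {1..b} \<longrightarrow> f i \<in> {0..a}) \<and> (i \<notin> {1..b} \<longrightarrow> f i = (0::nat))}"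
    by (rule finite_set_of_finite_funs) auto
qed

lemma words_upd:
  assumes "w \<in> words b a (Suc t)" "y \<in> zeros b w" "x \<in> {1..a}"
  shows "w(y := x) \<in> words b a t"
proof -
  have "\<exists>i. (w(y := x)) i = x'" if x': "x' \<in> {1..a}" for x'
  proof -
    obtain i where "w i = x'" using assms(1) x' by (fastforce simp: words_def)
    then show ?thesis using assms(2) x' by (intro exI[of _ i]) (auto simp: zeros_def)
  qed
  then show ?thesis using assms
    by (simp add: words_def zeros_upd) (auto simp: zeros_def)
qed

lemma words_upd_new:
  assumes "w \<in> words b a (Suc t)" "y \<in> zeros b w"
  shows "w(y := Suc a) \<in> words b (Suc a) t"
proof -
  have "\<exists>i. (w(y := Suc a)) i = x" if "x \<in> {1..Suc a}" for x
  proof (cases "x = Suc a")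
    case False
    then obtain i where "w i = x" using assms(1) \<open>x \<in> _\<close> by (fastforce simp: words_def)
    then show ?thesis using assms(2) that by (intro exI[of _ i]) (auto simp: zeros_def)
  qed auto
  then show ?thesis using assms
    by (simp add: words_def zeros_upd le_SucI) (auto simp: zeros_def)
qed

text \<open>
  Filling the smaller of two zeros first removes one element below the larger one; filling the
  larger one first does not change what lies below the smaller one.
\<close>

lemma pos_sign_swap:
  assumes "y \<in> zeros b w" "y' \<in> zeros b w" "y < y'" "x > 0" "x' > 0"
  shows "pos_sign b w y' * pos_sign b (w(y' := x')) y = - (pos_sign b w y * pos_sign b (w(y := x)) y')"
proof -
  have 1: "{z \<in> zeros b (w(y' := x')). z < y} = {z \<in> zeros b w. z < y}"
    using assms by (auto simp: zeros_upd)
  have "{z \<in> zeros b w. z < y'} = insert y {z \<in> zeros b (w(y := x)). z < y'}"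
    using assms by (auto simp: zeros_upd)
  moreover have "y \<notin> {z \<in> zeros b (w(y := x)). z < y'}" using assms by (auto simp: zeros_upd)
  ultimately have 2: "card {z \<in> zeros b w. z < y'} = Suc (card {z \<in> zeros b (w(y := x)). z < y'})"
    by simp
  show ?thesis unfolding pos_sign_def 1 2 by simp
qed

text \<open>
  Both sides expand into a sum over ordered pairs of distinct zeros, and exchanging the two places
  produces the same word with the opposite sign.
\<close>

lemma insert_letter_anticommute:
  assumes "x > 0" "x' > 0"
  shows "insert_letter b x (insert_letter b x' c) w = - insert_letter b x' (insert_letter b x c) w"
proof -
  let ?Z = "zeros b w"
  let ?S = "{(y, y'). y \<in> ?Z \<and> y' \<in> ?Z \<and> y \<noteq> y'}"
  have exp: "insert_letter b x (insert_letter b x' c) w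
    = (\<Sum>(y,y')\<in>?S. pos_sign b w y * pos_sign b (w(y := x)) y' * c (w(y := x, y' := x')))"
    if "x > 0" for x x'
  proof -
    have "insert_letter b x (insert_letter b x' c) w
      = (\<Sum>y\<in>?Z. \<Sum>y'\<in>?Z - {y}. pos_sign b w y * pos_sign b (w(y := x)) y' * c (w(y := x, y' := x')))"
      using that by (simp add: insert_letter_def zeros_upd sum_distrib_left mult.assoc)
    also have "\<dots> = (\<Sum>(y,y')\<in>(SIGMA y:?Z. ?Z - {y}). pos_sign b w y * pos_sign b (w(y := x)) y' * c (w(y := x, y' := x')))"
      by (subst sum.Sigma) auto
    also have "(SIGMA y:?Z. ?Z - {y}) = ?S" by auto
    finally show ?thesis .
  qed
  have "insert_letter b x' (insert_letter b x c) w
    = (\<Sum>(y',y)\<in>?S. pos_sign b w y' * pos_sign b (w(y' := x')) y * c (w(y' := x', y := x)))"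
    using exp assms by simp
  also have "\<dots> = (\<Sum>(y,y')\<in>?S. - (pos_sign b w y * pos_sign b (w(y := x)) y' * c (w(y := x, y' := x'))))"
  proof (rule sum.reindex_bij_witness[of _ prod.swap prod.swap], goal_cases)
    case (5 p)
    obtain y y' where p: "p = (y', y)" by (cases p) 
    have y: "y \<in> ?Z" "y' \<in> ?Z" "y \<noteq> y'" using 5 p by auto
    have sgn: "pos_sign b w y' * pos_sign b (w(y' := x')) y = - (pos_sign b w y * pos_sign b (w(y := x)) y')"
    proof (cases "y < y'")
      case True then show ?thesis using pos_sign_swap[of y b w y' x x'] y assms by simp
    next
      case False then show ?thesis using pos_sign_swap[of y' b w y x' x] y assms by simp
    qed
    show ?case using sgn y(3) p by (simp add: fun_upd_twist)
  qed auto
  also have "\<dots> = - insert_letter b x (insert_letter b x' c) w"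
    using exp assms by (simp add: sum_negf case_prod_unfold)
  finally show ?thesis by simp
qed

lemma insert_letter_sum:
  "insert_letter b x (\<lambda>w. \<Sum>j\<in>J. f j w) w = (\<Sum>j\<in>J. insert_letter b x (f j) w)"
  unfolding insert_letter_def sum_distrib_left by (rule sum.swap)

lemma insert_letter_cong:
  "(\<And>y. y \<in> zeros b w \<Longrightarrow> c (w(y := x)) = c' (w(y := x))) \<Longrightarrow> insert_letter b x c w = insert_letter b x c' w"
  by (simp add: insert_letter_def)

lemma sum_anticommuting_zero:
  fixes f :: "nat \<Rightarrow> nat \<Rightarrow> int"
  assumes "\<And>x x'. x \<in> X \<Longrightarrow> x' \<in> X \<Longrightarrow> f x x' = - f x' x"
  shows "(\<Sum>x\<in>X. \<Sum>x'\<in>X. f x x') = 0"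
proof -
  have "(\<Sum>x\<in>X. \<Sum>x'\<in>X. f x x') = (\<Sum>x\<in>X. \<Sum>x'\<in>X. - f x' x)"
    by (intro sum.cong refl assms)
  also have "\<dots> = - (\<Sum>x\<in>X. \<Sum>x'\<in>X. f x x')"
    unfolding sum_negf by (subst sum.swap) simp
  finally show ?thesis by simp
qed


lemma bd_in: "w \<in> words b a (Suc t) \<Longrightarrow> bd b a t c w = (\<Sum>x=1..a. insert_letter b x c w)"
  by (simp only: bd_def if_True)

lemma peel_in: "w \<in> words b a (Suc t) \<Longrightarrow> peel b a t c w = insert_letter b (Suc a) c w"
  by (simp only: peel_def if_True)

lemma bd_out: "w \<notin> words b a (Suc t) \<Longrightarrow> bd b a t c w = 0"
  by (simp only: bd_def if_False)

lemma peel_out: "w \<notin> words b a (Suc t) \<Longrightarrow> peel b a t c w = 0"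
  by (simp only: peel_def if_False)

lemma bd_bd: "bd b a (Suc t) (bd b a t c) = (\<lambda>w. 0)"
proof
  fix w
  show "bd b a (Suc t) (bd b a t c) w = 0"
  proof (cases "w \<in> words b a (Suc (Suc t))")
    case True
    have "insert_letter b x (bd b a t c) w = (\<Sum>x'=1..a. insert_letter b x (insert_letter b x' c) w)"
      if "x \<in> {1..a}" for x
      unfolding insert_letter_sum[symmetric]
      by (intro insert_letter_cong bd_in words_upd[OF True] that)
    then have "bd b a (Suc t) (bd b a t c) w = (\<Sum>x=1..a. \<Sum>x'=1..a. insert_letter b x (insert_letter b x' c) w)"
      using True by (simp add: bd_in)
    also have "\<dots> = 0"
      by (rule sum_anticommuting_zero, rule insert_letter_anticommute) auto
    finally show ?thesis .
  qed (simp add: bd_out)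
qed

text \<open>
  On a word that misses the letter \<open>a + 1\<close> both composites are parts of the square of \<open>D\<^sub>1 + \<dots> + D\<^sub>a\<^sub>+\<^sub>1\<close>:
  the cross terms anticommute, and the square of \<open>D\<^sub>a\<^sub>+\<^sub>1\<close> vanishes.
\<close>

lemma peel_bd: "peel b a (Suc t) (bd b (Suc a) t c) w = - bd b a (Suc t) (peel b a t c) w"
proof (cases "w \<in> words b a (Suc (Suc t))")
  case True
  have "peel b a (Suc t) (bd b (Suc a) t c) w = insert_letter b (Suc a) (\<lambda>w. \<Sum>x=1..Suc a. insert_letter b x c w) w"
    unfolding peel_in[OF True]
    apply (rule insert_letter_cong) apply (rule bd_in) apply (rule words_upd_new[OF True]) apply assumption done
  then have 1: "peel b a (Suc t) (bd b (Suc a) t c) w = (\<Sum>x=1..Suc a. insert_letter b (Suc a) (insert_letter b x c) w)"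
    unfolding insert_letter_sum .
  have "insert_letter b x (peel b a t c) w = - insert_letter b (Suc a) (insert_letter b x c) w"
    if "x \<in> {1..a}" for x
  proof -
    have "insert_letter b x (peel b a t c) w = insert_letter b x (insert_letter b (Suc a) c) w"
      by (intro insert_letter_cong peel_in words_upd[OF True] that)
    also have "\<dots> = - insert_letter b (Suc a) (insert_letter b x c) w"
      using that by (intro insert_letter_anticommute) auto
    finally show ?thesis .
  qed
  then have 2: "bd b a (Suc t) (peel b a t c) w = (\<Sum>x=1..a. - insert_letter b (Suc a) (insert_letter b x c) w)"
    using True by (simp add: bd_in)
  have "insert_letter b (Suc a) (insert_letter b (Suc a) c) w = 0"
    using insert_letter_anticommute[of "Suc a" "Suc a" b c w] by simp
  then show ?thesis unfolding 1 2 by (simp add: sum_negf)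
qed (simp add: bd_out peel_out)


section \<open>Matching words along the last letter\<close>

definition supported :: "'w set \<Rightarrow> ('w \<Rightarrow> int) \<Rightarrow> bool" where
  "supported S c \<longleftrightarrow> (\<forall>w. w \<notin> S \<longrightarrow> c w = 0)"

text \<open>
  For \<open>n = a + 1\<close>, these are the places not taken by the letters \<open>1, \<dots>, a\<close>: the vertices of the
  simplex in which the places of the letter \<open>n\<close> form a face.
\<close>

definition slots :: "nat \<Rightarrow> nat \<Rightarrow> (nat \<Rightarrow> nat) \<Rightarrow> nat set" where
  "slots b n w = {i\<in>{1..b}. w i = 0 \<or> w i = n}"

definition first_slot :: "nat \<Rightarrow> nat \<Rightarrow> (nat \<Rightarrow> nat) \<Rightarrow> nat" where
  "first_slot b n w = Min (slots b n w)"

text \<open>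
  The words over the alphabet \<open>{1..a + 1}\<close> are divided into three kinds according to the first slot.
  Toggling the letter there between \<open>a + 1\<close> and \<open>0\<close> matches \<open>raised\<close> words with \<open>lowered\<close> words of the
  next degree. A \<open>lone\<close> word has no partner, as deleting its only letter \<open>a + 1\<close> leaves a word over
  \<open>{1..a}\<close>, but in this way lone words correspond to all words over \<open>{1..a}\<close> that contain a zero.
\<close>

definition raised :: "nat \<Rightarrow> nat \<Rightarrow> nat \<Rightarrow> (nat \<Rightarrow> nat) set" where
  "raised b a t = {w \<in> words b (Suc a) t. w (first_slot b (Suc a) w) = Suc a \<and>
     (\<exists>i. i \<noteq> first_slot b (Suc a) w \<and> w i = Suc a)}"

definition lowered :: "nat \<Rightarrow> nat \<Rightarrow> nat \<Rightarrow> (nat \<Rightarrow> nat) set" where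
  "lowered b a t = {w \<in> words b (Suc a) t. w (first_slot b (Suc a) w) = 0}"

definition lone :: "nat \<Rightarrow> nat \<Rightarrow> nat \<Rightarrow> (nat \<Rightarrow> nat) set" where
  "lone b a t = {w \<in> words b (Suc a) t. w (first_slot b (Suc a) w) = Suc a \<and>
     (\<forall>i. i \<noteq> first_slot b (Suc a) w \<longrightarrow> w i \<noteq> Suc a)}"

lemma finite_slots [simp]: "finite (slots b n w)"
  by (simp add: slots_def)

lemma first_slot_mem:
  assumes "w \<in> words b (Suc a) t" shows "first_slot b (Suc a) w \<in> slots b (Suc a) w"
proof -
  have "Suc a \<in> {1..Suc a}" by simp
  then obtain i where i: "w i = Suc a" using assms unfolding words_def by blast
  then have "i \<in> {1..b}" using assms by (fastforce simp: words_def)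
  then have "slots b (Suc a) w \<noteq> {}" using i by (auto simp: slots_def)
  then show ?thesis by (simp add: first_slot_def)
qed

lemma words_Suc_cases:
  "words b (Suc a) t = raised b a t \<union> lowered b a t \<union> lone b a t"
  using first_slot_mem by (fastforce simp: raised_def lowered_def lone_def slots_def)

lemma raised_lowered_lone_disjoint:
  "raised b a t \<inter> lowered b a t = {}" "raised b a t \<inter> lone b a t = {}" "lowered b a t \<inter> lone b a t = {}"
  by (auto simp: raised_def lowered_def lone_def)

lemma slots_upd:
  assumes "i \<in> slots b n w" "x = 0 \<or> x = n" shows "slots b n (w(i := x)) = slots b n w"
  using assms by (auto simp: slots_def)

lemma first_slot_upd:
  assumes "i \<in> slots b n w" "x = 0 \<or> x = n" shows "first_slot b n (w(i := x)) = first_slot b n w"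
  using slots_upd[OF assms] by (simp add: first_slot_def)

lemma zeros_subset_slots: "zeros b w \<subseteq> slots b n w"
  by (auto simp: zeros_def slots_def)

lemma zeros_erase: "i \<in> {1..b} \<Longrightarrow> zeros b (w(i := 0)) = insert i (zeros b w)"
  by (auto simp: zeros_def)

lemma words_erase:
  assumes "w \<in> words b n t" "w i \<noteq> 0" "j \<noteq> i" "w j = w i"
  shows "w(i := 0) \<in> words b n (Suc t)"
proof -
  have i: "i \<in> {1..b}" using assms by (auto simp: words_def)
  have "\<exists>k. (w(i := 0)) k = x" if x: "x \<in> {1..n}" for x
  proof -
    obtain k where "w k = x" using assms(1) x by (fastforce simp: words_def)
    then show ?thesis using assms by (cases "k = i") (auto intro: exI[of _ k] exI[of _ j])
  qed
  moreover have "card (zeros b (w(i := 0))) = Suc t"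
    using assms(1,2) i by (simp add: zeros_erase words_def) (simp add: zeros_def)
  ultimately show ?thesis using assms(1) by (simp add: words_def)
qed

lemma lower_raised:
  assumes "w \<in> raised b a t"
  shows "w(first_slot b (Suc a) w := 0) \<in> lowered b a (Suc t)"
proof -
  let ?m = "first_slot b (Suc a) w"
  have w: "w \<in> words b (Suc a) t" "w ?m = Suc a" using assms by (auto simp: raised_def)
  obtain i where "i \<noteq> ?m" "w i = Suc a" using assms by (auto simp: raised_def)
  then have "w(?m := 0) \<in> words b (Suc a) (Suc t)" using w by (intro words_erase[of _ _ _ _ _ i]) auto
  then show ?thesis using first_slot_upd[OF first_slot_mem[OF w(1)], of 0] by (simp add: lowered_def)
qed

lemma first_slot_lower: "w \<in> words b (Suc a) t \<Longrightarrow>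
    first_slot b (Suc a) (w(first_slot b (Suc a) w := 0)) = first_slot b (Suc a) w"
  by (intro first_slot_upd first_slot_mem) auto

lemma raise_lowered:
  assumes "w \<in> lowered b a (Suc t)"
  shows "w(first_slot b (Suc a) w := Suc a) \<in> raised b a t"
proof -
  let ?m = "first_slot b (Suc a) w"
  have w: "w \<in> words b (Suc a) (Suc t)" "w ?m = 0" using assms by (auto simp: lowered_def)
  note m = first_slot_mem[OF w(1)]
  have "?m \<in> zeros b w" using w(2) m by (auto simp: zeros_def slots_def)
  then have 1: "w(?m := Suc a) \<in> words b (Suc a) t" using w(1) by (intro words_upd) auto
  have "Suc a \<in> {1..Suc a}" by simp
  then obtain i where i: "w i = Suc a" using w(1) unfolding words_def by blast
  then have "i \<noteq> ?m" using w(2) by auto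
  then show ?thesis using 1 i first_slot_upd[OF m, of "Suc a"] by (auto simp: raised_def)
qed

lemma bij_lower_raised:
  "bij_betw (\<lambda>w. w(first_slot b (Suc a) w := 0)) (raised b a t) (lowered b a (Suc t))"
proof (rule bij_betw_byWitness[where f' = "\<lambda>w. w(first_slot b (Suc a) w := Suc a)"])
  show "\<forall>w\<in>raised b a t. (\<lambda>w. w(first_slot b (Suc a) w := Suc a)) (w(first_slot b (Suc a) w := 0)) = w"
    by (auto simp: raised_def first_slot_lower fun_upd_idem)
  show "\<forall>w\<in>lowered b a (Suc t). (\<lambda>w. w(first_slot b (Suc a) w := 0)) (w(first_slot b (Suc a) w := Suc a)) = w"
  proof
    fix w assume "w \<in> lowered b a (Suc t)"
    then have "w \<in> words b (Suc a) (Suc t)" "w (first_slot b (Suc a) w) = 0" by (auto simp: lowered_def)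
    then show "(\<lambda>w. w(first_slot b (Suc a) w := 0)) (w(first_slot b (Suc a) w := Suc a)) = w"
      using first_slot_upd[OF first_slot_mem, of w b a "Suc t" "Suc a"] by (simp add: fun_upd_idem)
  qed
qed (auto intro: lower_raised raise_lowered)

lemma Min_zeros:
  assumes "w \<in> words b a (Suc t)"
  shows "Min (zeros b w) \<in> zeros b w" and "w (Min (zeros b w)) = 0"
proof -
  have "card (zeros b w) = Suc t" using assms by (simp add: words_def)
  then have "zeros b w \<noteq> {}" by auto
  then show "Min (zeros b w) \<in> zeros b w" by simp
  then show "w (Min (zeros b w)) = 0" by (simp add: zeros_def)
qed

lemma lift_lone:
  assumes "u \<in> words b a (Suc t)"
  shows "u(Min (zeros b u) := Suc a) \<in> lone b a t"
    and "first_slot b (Suc a) (u(Min (zeros b u) := Suc a)) = Min (zeros b u)"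
proof -
  note m = Min_zeros(1)[OF assms]
  have le: "u i \<le> a" for i using assms by (simp add: words_def)
  then have ne: "u i \<noteq> Suc a" for i by (metis Suc_n_not_le_n)
  have "slots b (Suc a) (u(Min (zeros b u) := Suc a)) = zeros b u"
    using m ne by (auto simp: slots_def zeros_def)
  then show fs: "first_slot b (Suc a) (u(Min (zeros b u) := Suc a)) = Min (zeros b u)"
    by (simp add: first_slot_def)
  show "u(Min (zeros b u) := Suc a) \<in> lone b a t"
    using words_upd_new[OF assms m] fs ne by (simp add: lone_def)
qed

lemma drop_lone:
  assumes "w \<in> lone b a t"
  shows "w(first_slot b (Suc a) w := 0) \<in> words b a (Suc t)"
    and "zeros b (w(first_slot b (Suc a) w := 0)) = slots b (Suc a) w"
proof -
  let ?m = "first_slot b (Suc a) w"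
  have w: "w \<in> words b (Suc a) t" "w ?m = Suc a" "\<And>i. i \<noteq> ?m \<Longrightarrow> w i \<noteq> Suc a"
    using assms by (auto simp: lone_def)
  have m: "?m \<in> {1..b}" using first_slot_mem[OF w(1)] by (simp add: slots_def)
  have le: "w i \<le> a" if "i \<noteq> ?m" for i
    using w(1) w(3)[OF that] by (simp add: words_def) (metis le_SucE)
  have ex: "\<exists>i. (w(?m := 0)) i = x" if x: "x \<in> {1..a}" for x
  proof -
    have "x \<in> {1..Suc a}" using x by simp
    then obtain i where "w i = x" using w(1) unfolding words_def by blast
    then show ?thesis using x w(2) by (intro exI[of _ i]) auto
  qed
  have "card (zeros b (w(?m := 0))) = Suc t"
    using w(1,2) m by (simp add: zeros_erase words_def) (simp add: zeros_def)
  then show "w(?m := 0) \<in> words b a (Suc t)"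
    using w(1) le ex unfolding words_def by auto
  show "zeros b (w(?m := 0)) = slots b (Suc a) w"
    using w m by (auto simp: zeros_def slots_def)
qed

lemma bij_drop_lone:
  "bij_betw (\<lambda>w. w(first_slot b (Suc a) w := 0)) (lone b a t) (words b a (Suc t))"
proof (rule bij_betw_byWitness[where f' = "\<lambda>u. u(Min (zeros b u) := Suc a)"])
  show "\<forall>w\<in>lone b a t. (\<lambda>u. u(Min (zeros b u) := Suc a)) (w(first_slot b (Suc a) w := 0)) = w"
    using drop_lone(2) by (auto simp: first_slot_def[symmetric] lone_def)
  show "\<forall>u\<in>words b a (Suc t). (\<lambda>w. w(first_slot b (Suc a) w := 0)) (u(Min (zeros b u) := Suc a)) = u"
  proof
    fix u assume u: "u \<in> words b a (Suc t)"
    then have "u (Min (zeros b u)) = 0" by (rule Min_zeros)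
    then show "(\<lambda>w. w(first_slot b (Suc a) w := 0)) (u(Min (zeros b u) := Suc a)) = u"
      using lift_lone(2)[OF u] by (simp add: fun_upd_idem)
  qed
qed (auto intro: lift_lone drop_lone)

lemma pos_sign_Min: "pos_sign b w (Min (zeros b w)) = 1"
proof -
  have "{z \<in> zeros b w. z < Min (zeros b w)} = {}" by (auto simp: not_less)
  then show ?thesis by (simp only: pos_sign_def card.empty power_0)
qed

lemma pos_sign_first_slot: "pos_sign b w (first_slot b n w) = 1"
proof -
  have "{z \<in> zeros b w. z < first_slot b n w} = {}"
    using zeros_subset_slots[of b w n] by (auto simp: not_less first_slot_def)
  then show ?thesis by (simp only: pos_sign_def card.empty power_0)
qed

lemma not_raised_if_first_slot_zero:
  assumes "w \<in> words b (Suc a) t" "w (first_slot b (Suc a) w) = 0" "y \<in> slots b (Suc a) w" "y \<noteq> first_slot b (Suc a) w"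
    "x = 0 \<or> x = Suc a"
  shows "(w(y := x)) (first_slot b (Suc a) (w(y := x))) = 0"
  using first_slot_upd[OF assms(3,5)] assms by simp

text \<open>
  The matching is triangular: at a lowered word \<open>q\<close>, the coboundary of a cochain supported on raised
  words is the coefficient of the partner of \<open>q\<close> up to words with one more old letter, that is with
  fewer slots. Filling a zero of \<open>q\<close> other than the first slot with \<open>a + 1\<close> leaves a zero in the
  first slot, so it never gives a raised word.
\<close>

lemma bd_on_lowered:
  assumes q: "q \<in> lowered b a (Suc t)" and c: "supported (raised b a t) c"
  shows "bd b (Suc a) t c q = c (q(first_slot b (Suc a) q := Suc a)) + (\<Sum>x=1..a. insert_letter b x c q)"
proof -
  let ?m = "first_slot b (Suc a) q"
  have w: "q \<in> words b (Suc a) (Suc t)" "q ?m = 0" using q by (auto simp: lowered_def)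
  note m = first_slot_mem[OF w(1)]
  then have mz: "?m \<in> zeros b q" using w(2) by (simp add: slots_def zeros_def)
  have z: "c (q(y := Suc a)) = 0" if "y \<in> zeros b q - {?m}" for y
  proof -
    have "y \<in> slots b (Suc a) q" using that zeros_subset_slots by blast
    then have "(q(y := Suc a)) (first_slot b (Suc a) (q(y := Suc a))) = 0"
      using that w by (intro not_raised_if_first_slot_zero) auto
    then have "q(y := Suc a) \<notin> raised b a t" by (simp add: raised_def)
    then show ?thesis using c by (simp add: supported_def)
  qed
  have "insert_letter b (Suc a) c q = c (q(?m := Suc a))"
    unfolding insert_letter_def using z mz
    by (subst sum.remove[of _ ?m]) (auto simp: pos_sign_first_slot)
  then show ?thesis using w(1) by (simp add: bd_in)
qed

lemma slots_insert_old_letter: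
  assumes "y \<in> zeros b q" "0 < x" "x < n"
  shows "card (slots b n (q(y := x))) < card (slots b n q)"
proof -
  have "slots b n (q(y := x)) = slots b n q - {y}" "y \<in> slots b n q"
    using assms by (auto simp: slots_def zeros_def)
  then show ?thesis by (metis card_Diff1_less finite_slots)
qed

lemma lower_raise_eq:
  assumes "w \<in> raised b a t"
  shows "first_slot b (Suc a) (w(first_slot b (Suc a) w := 0)) = first_slot b (Suc a) w"
    "(w(first_slot b (Suc a) w := 0))(first_slot b (Suc a) w := Suc a) = w"
    "slots b (Suc a) (w(first_slot b (Suc a) w := 0)) = slots b (Suc a) w"
  using assms slots_upd[OF first_slot_mem, of w b a t 0] by (auto simp: raised_def first_slot_lower)

text \<open>
  The triangular system \<open>bd_on_lowered\<close> is solved by recursion on the number of slots; this is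
  uniqueness of the solution.
\<close>

lemma raised_unique:
  assumes c: "supported (raised b a t) c" and 0: "\<And>q. q \<in> lowered b a (Suc t) \<Longrightarrow> bd b (Suc a) t c q = 0"
  shows "c w = 0"
proof (induction "card (slots b (Suc a) w)" arbitrary: w rule: less_induct)
  case less
  show ?case
  proof (cases "w \<in> raised b a t")
    case True
    let ?q = "w(first_slot b (Suc a) w := 0)"
    have q: "?q \<in> lowered b a (Suc t)" using lower_raised True by blast
    note e = lower_raise_eq[OF True]
    have "c (?q(y := x)) = 0" if "y \<in> zeros b ?q" "x \<in> {1..a}" for x y
      using slots_insert_old_letter[OF that(1), of x "Suc a"] that e(3) by (intro less) auto
    then have "insert_letter b x c ?q = 0" if "x \<in> {1..a}" for x
      unfolding insert_letter_def using that by (intro sum.neutral) simp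
    then show ?thesis using bd_on_lowered[OF q c] 0[OF q] unfolding e(1,2) by simp
  next
    case False
    then show ?thesis using c by (simp add: supported_def)
  qed
qed

text \<open>
  Existence for the same system: a solution for all lowered words with fewer than \<open>n\<close> slots is
  corrected on the raised words with exactly \<open>n\<close> slots, which does not disturb the equations
  already solved.
\<close>

lemma raised_solution_upto:
  "\<exists>c. supported (raised b a t) c \<and>
     (\<forall>q\<in>lowered b a (Suc t). card (slots b (Suc a) q) < n \<longrightarrow> bd b (Suc a) t c q = z q)"
proof (induction n)
  case 0
  show ?case by (intro exI[of _ "\<lambda>_. 0"]) (simp add: supported_def)
next
  case (Suc n)
  then obtain c where c: "supported (raised b a t) c"
    "\<And>q. q\<in>lowered b a (Suc t) \<Longrightarrow> card (slots b (Suc a) q) < n \<Longrightarrow> bd b (Suc a) t c q = z q" by blast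
  define low where "low w = w(first_slot b (Suc a) w := 0)" for w :: "nat \<Rightarrow> nat"
  \<comment> \<open>The coefficient of the partner in the equation at a lowered word is 1, so no division occurs.\<close>
  define c' where "c' w = (if w \<in> raised b a t \<and> card (slots b (Suc a) w) = n
     then c w + z (low w) - bd b (Suc a) t c (low w) else c w)" for w
  have c'0: "supported (raised b a t) c'" using c(1) by (simp add: supported_def c'_def)
  have same: "insert_letter b x c' q = insert_letter b x c q"
    if "card (slots b (Suc a) q) \<le> n" "x \<in> {1..a}" for q x
  proof (rule insert_letter_cong)
    fix y assume "y \<in> zeros b q"
    then have "card (slots b (Suc a) (q(y := x))) < n"
      using slots_insert_old_letter[of y b q x "Suc a"] that by auto
    then show "c' (q(y := x)) = c (q(y := x))" by (simp add: c'_def)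
  qed
  have "bd b (Suc a) t c' q = z q" if q: "q\<in>lowered b a (Suc t)" "card (slots b (Suc a) q) < Suc n" for q
  proof -
    let ?w = "q(first_slot b (Suc a) q := Suc a)"
    have q': "q \<in> words b (Suc a) (Suc t)" "q (first_slot b (Suc a) q) = 0" using q(1) by (auto simp: lowered_def)
    have w: "?w \<in> raised b a t" using raise_lowered q(1) by blast
    have sl: "slots b (Suc a) ?w = slots b (Suc a) q" by (intro slots_upd first_slot_mem[OF q'(1)]) auto
    then have "first_slot b (Suc a) ?w = first_slot b (Suc a) q" by (simp add: first_slot_def)
    then have low: "low ?w = q" using q'(2) by (simp add: low_def fun_upd_idem)
    have "bd b (Suc a) t c' q - bd b (Suc a) t c q = c' ?w - c ?w"
      using same q(2) by (simp add: bd_on_lowered[OF q(1) c'0] bd_on_lowered[OF q(1) c(1)])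
    then show ?thesis
      using c(2)[OF q(1)] q(2) w low sl by (cases "card (slots b (Suc a) q) = n") (auto simp: c'_def)
  qed
  then show ?case using c'0 by blast
qed

lemma raised_solution:
  obtains c where "supported (raised b a t) c" "\<And>q. q \<in> lowered b a (Suc t) \<Longrightarrow> bd b (Suc a) t c q = z q"
proof -
  obtain c where c: "supported (raised b a t) c"
    "\<forall>q\<in>lowered b a (Suc t). card (slots b (Suc a) q) < Suc b \<longrightarrow> bd b (Suc a) t c q = z q"
    using raised_solution_upto by blast
  have "card (slots b (Suc a) q) < Suc b" for q
    using card_mono[of "{1..b}" "slots b (Suc a) q"] by (simp add: slots_def less_Suc_eq_le subset_eq)
  then show ?thesis using c that by blast
qed

lemma insert_letter_linear:
  "insert_letter b x (\<lambda>w. c w + c' w) u = insert_letter b x c u + insert_letter b x c' u"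
  "insert_letter b x (\<lambda>w. c w - c' w) u = insert_letter b x c u - insert_letter b x c' u"
  "insert_letter b x (\<lambda>w. r * c w) u = r * insert_letter b x c u"
  by (simp_all add: insert_letter_def algebra_simps sum.distrib sum_subtractf sum_distrib_left)

lemma bd_linear:
  "bd b a t (\<lambda>w. c w + c' w) u = bd b a t c u + bd b a t c' u"
  "bd b a t (\<lambda>w. c w - c' w) u = bd b a t c u - bd b a t c' u"
  "bd b a t (\<lambda>w. r * c w) u = r * bd b a t c u"
  by (simp_all add: bd_def insert_letter_linear sum.distrib sum_subtractf sum_distrib_left)

lemma peel_linear:
  "peel b a t (\<lambda>w. c w + c' w) u = peel b a t c u + peel b a t c' u"
  "peel b a t (\<lambda>w. c w - c' w) u = peel b a t c u - peel b a t c' u"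
  "peel b a t (\<lambda>w. r * c w) u = r * peel b a t c u"
  by (simp_all add: peel_def insert_letter_linear)

lemma bd_zero: "bd b a t (\<lambda>w. 0) u = 0"
  using bd_linear(3)[of b a t 0 "\<lambda>_. 0" u] by simp

lemma peel_zero: "peel b a t (\<lambda>w. 0) u = 0"
  using peel_linear(3)[of b a t 0 "\<lambda>_. 0" u] by simp

lemma supported_bd: "supported (words b a (Suc t)) (bd b a t c)"
  by (simp add: supported_def bd_out)

lemma supported_peel: "supported (words b a (Suc t)) (peel b a t c)"
  by (simp add: supported_def peel_out)

lemma supported_linear:
  assumes "supported S c" "supported S c'"
  shows "supported S (\<lambda>w. c w + c' w)" "supported S (\<lambda>w. c w - c' w)" "supported S (\<lambda>w. r * c w)"
  using assms by (simp_all add: supported_def)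

lemma supported_mono: "supported S c \<Longrightarrow> S \<subseteq> T \<Longrightarrow> supported T c"
  by (auto simp: supported_def)

text \<open>
  Among the words obtained from \<open>u\<close> by filling a zero with the new letter, only filling the first zero
  gives a word that is not lowered, and the sign of the first zero is \<open>1\<close>.
\<close>

lemma peel_off_lowered:
  assumes c: "\<And>w. w \<in> lowered b a t \<Longrightarrow> c w = 0" and u: "u \<in> words b a (Suc t)"
  shows "peel b a t c u = c (u(Min (zeros b u) := Suc a))"
proof -
  let ?w = "u(Min (zeros b u) := Suc a)"
  note l = lift_lone[OF u]
  note m = Min_zeros(1)[OF u]
  have "c (u(y := Suc a)) = 0" if y: "y \<in> zeros b u - {Min (zeros b u)}" for y
  proof -
    have nl: "u i \<noteq> Suc a" for i using u by (metis (mono_tags, lifting) words_def mem_Collect_eq Suc_n_not_le_n)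
    have "slots b (Suc a) (u(y := Suc a)) = zeros b u"
      using y nl by (auto simp: slots_def zeros_def)
    then have "first_slot b (Suc a) (u(y := Suc a)) = Min (zeros b u)" by (simp add: first_slot_def)
    then have "u(y := Suc a) \<in> lowered b a t"
      using words_upd_new[OF u, of y] y m by (simp add: lowered_def) (simp add: zeros_def)
    then show ?thesis by (rule c)
  qed
  then show ?thesis unfolding peel_in[OF u] insert_letter_def using m
    by (subst sum.remove[of _ "Min (zeros b u)"]) (auto simp: pos_sign_Min)
qed

lemma peel_raised:
  assumes "supported (raised b a t) c" shows "peel b a t c = (\<lambda>w. 0)"
proof
  fix u
  show "peel b a t c u = 0"
  proof (cases "u \<in> words b a (Suc t)")
    case True
    have "c w = 0" if "w \<in> lowered b a t \<union> lone b a t" for w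
      using that assms raised_lowered_lone_disjoint[of b a t] by (auto simp: supported_def)
    then show ?thesis using lift_lone(1)[OF True] by (subst peel_off_lowered[OF _ True]) auto
  qed (simp add: peel_out)
qed

text \<open>
  Vanishing on lowered words and in the image of \<open>peel\<close> forces vanishing on lone words, so \<open>c\<close> is
  supported on raised words, where \<open>raised_unique\<close> applies.
\<close>

lemma closed_unpeeled_zero:
  assumes c: "supported (words b (Suc a) t) c" and low: "\<And>w. w \<in> lowered b a t \<Longrightarrow> c w = 0"
    and closed: "\<And>w. bd b (Suc a) t c w = 0" and peel: "\<And>w. peel b a t c w = 0"
  shows "c w = 0"
proof (rule raised_unique[of b a t c w])
  have lone: "c w = 0" if w: "w \<in> lone b a t" for w
  proof -
    let ?u = "w(first_slot b (Suc a) w := 0)"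
    have m: "Min (zeros b ?u) = first_slot b (Suc a) w"
      unfolding drop_lone(2)[OF w] by (simp only: first_slot_def)
    have "w (first_slot b (Suc a) w) = Suc a" using w by (simp add: lone_def)
    then have "?u(Min (zeros b ?u) := Suc a) = w" unfolding m by (simp add: fun_upd_idem)
    then show ?thesis using peel_off_lowered[of b a t c, OF low drop_lone(1)[OF w]] peel[of ?u] by simp
  qed
  show "supported (raised b a t) c"
    unfolding supported_def using c low lone words_Suc_cases[of b a t] by (fastforce simp: supported_def)
qed (rule closed)

text \<open>
  Acyclicity of the kernel of \<open>peel\<close>. A cochain on raised words is chosen whose coboundary agrees
  with \<open>z\<close> on lowered words; the difference is then zero by \<open>closed_unpeeled_zero\<close>.
\<close>

lemma closed_unpeeled_exact:
  assumes z: "supported (words b (Suc a) (Suc t)) z"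
    and closed: "\<And>w. bd b (Suc a) (Suc t) z w = 0" and peel: "\<And>w. peel b a (Suc t) z w = 0"
  obtains c where "supported (raised b a t) c" "z = bd b (Suc a) t c"
proof -
  obtain c where c: "supported (raised b a t) c"
    "\<And>q. q \<in> lowered b a (Suc t) \<Longrightarrow> bd b (Suc a) t c q = z q"
    using raised_solution by blast
  define y where "y = (\<lambda>w. z w - bd b (Suc a) t c w)"
  have "y w = 0" for w
  proof (rule closed_unpeeled_zero[of b a "Suc t" y w])
    show "supported (words b (Suc a) (Suc t)) y"
      unfolding y_def by (intro supported_linear z supported_bd)
    show "y w = 0" if "w \<in> lowered b a (Suc t)" for w using c(2)[OF that] by (simp add: y_def)
    show "bd b (Suc a) (Suc t) y w = 0" for w
      unfolding y_def bd_linear by (simp add: closed bd_bd)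
    show "peel b a (Suc t) y w = 0" for w
      unfolding y_def peel_linear peel_bd using peel peel_raised[OF c(1)] bd_linear(3)[of b a "Suc t" 0 "\<lambda>_. 0" w] by simp
  qed
  then have "z = bd b (Suc a) t c" by (auto simp: y_def fun_eq_iff)
  then show ?thesis using c(1) that by blast
qed

section \<open>Induction on the number of letters\<close>

definition lift :: "nat \<Rightarrow> nat \<Rightarrow> nat \<Rightarrow> ((nat \<Rightarrow> nat) \<Rightarrow> int) \<Rightarrow> (nat \<Rightarrow> nat) \<Rightarrow> int" where
  "lift b a t c w = (if w \<in> lone b a t then c (w(first_slot b (Suc a) w := 0)) else 0)"

lemma supported_lift: "supported (lone b a t) (lift b a t c)"
  by (simp add: supported_def lift_def)

lemma lone_words: "lone b a t \<subseteq> words b (Suc a) t"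
  by (auto simp: lone_def)

lemma raised_words: "raised b a t \<subseteq> words b (Suc a) t"
  by (auto simp: raised_def)

text \<open>
  Lone words give a linear section of \<open>peel\<close>, which is therefore onto.
\<close>

lemma peel_lift:
  assumes "supported (words b a (Suc t)) c" shows "peel b a t (lift b a t c) = c"
proof
  fix u
  show "peel b a t (lift b a t c) u = c u"
  proof (cases "u \<in> words b a (Suc t)")
    case True
    note m = Min_zeros(2)[OF True]
    have "lift b a t c w = 0" if "w \<in> lowered b a t" for w
      using that raised_lowered_lone_disjoint[of b a t] by (auto simp: lift_def)
    then show ?thesis
      using lift_lone[OF True] m by (subst peel_off_lowered[OF _ True]) (auto simp: lift_def fun_upd_idem)
  next
    case False then show ?thesis using assms by (simp add: peel_out supported_def)
  qed
qed

text \<open>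
  A pivot stands for a word on which the differential can be inverted: all raised words by the
  matching, and among the lone words, which carry the complex with one letter less in a degree higher
  by one, those that are pivots there.
\<close>

fun pivots :: "nat \<Rightarrow> nat \<Rightarrow> nat \<Rightarrow> (nat \<Rightarrow> nat) set" where
  "pivots b 0 t = {}"
| "pivots b (Suc a) t = raised b a t \<union> {w \<in> lone b a t. w(first_slot b (Suc a) w := 0) \<in> pivots b a (Suc t)}"

lemma pivots_words: "pivots b a t \<subseteq> words b a t"
  by (cases a) (auto simp: raised_def lone_def)

text \<open>
  Peeling a closed cochain supported on pivots gives one with the same properties for one letter
  less, which vanishes by induction; what remains is \<open>closed_unpeeled_zero\<close>.
\<close>

lemma closed_pivot_zero:
  assumes "supported (pivots b a t) c" "\<And>w. bd b a t c w = 0"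
  shows "c w = 0"
  using assms
proof (induction a arbitrary: t c w)
  case 0 then show ?case by (simp add: supported_def)
next
  case (Suc a)
  have low: "c w = 0" if "w \<in> lowered b a t" for w
    using that Suc.prems(1) raised_lowered_lone_disjoint[of b a t] by (auto simp: supported_def)
  have "supported (pivots b a (Suc t)) (peel b a t c)"
    unfolding supported_def
  proof (intro allI impI)
    fix u assume u: "u \<notin> pivots b a (Suc t)"
    show "peel b a t c u = 0"
    proof (cases "u \<in> words b a (Suc t)")
      case True
      let ?w = "u(Min (zeros b u) := Suc a)"
      have "u (Min (zeros b u)) = 0" using True by (rule Min_zeros)
      then have "?w(first_slot b (Suc a) ?w := 0) = u" using lift_lone(2)[OF True] by (simp add: fun_upd_idem)
      then have "?w \<notin> pivots b (Suc a) t"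
        using lift_lone(1)[OF True] raised_lowered_lone_disjoint(2)[of b a t] u by auto
      then show ?thesis using Suc.prems(1) peel_off_lowered[OF low True] by (simp add: supported_def)
    qed (simp add: peel_out)
  qed
  moreover have "bd b a (Suc t) (peel b a t c) w = 0" for w
  proof -
    have "bd b (Suc a) t c = (\<lambda>w. 0)" using Suc.prems(2) by (rule ext)
    then have "peel b a (Suc t) (bd b (Suc a) t c) w = 0" by (simp only: peel_zero)
    then show ?thesis unfolding peel_bd by simp
  qed
  ultimately have peel: "peel b a t c w = 0" for w by (rule Suc.IH)
  show ?case
    by (rule closed_unpeeled_zero[OF supported_mono[OF Suc.prems(1) pivots_words] low Suc.prems(2) peel])
qed

text \<open>
  The induction hypothesis makes the peeled cochain agree up to a cocycle with one supported on
  pivots. After subtracting a lift of the latter, the coboundary lies in the kernel of \<open>peel\<close>, and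
  \<open>closed_unpeeled_exact\<close> writes it as the coboundary of a cochain on raised words.
\<close>

lemma bd_pivots:
  "\<exists>p. supported (pivots b a t) p \<and> bd b a t p = bd b a t c"
proof (induction a arbitrary: t c)
  case 0
  show ?case by (intro exI[of _ "\<lambda>_. 0"]) (auto simp: bd_def supported_def)
next
  case (Suc a)
  obtain p where p: "supported (pivots b a (Suc t)) p" "bd b a (Suc t) p = bd b a (Suc t) (peel b a t c)"
    using Suc by blast
  have sp: "supported (words b a (Suc t)) p" using p(1) pivots_words by (rule supported_mono)
  define p2 where "p2 = lift b a t p"
  have p2: "supported (pivots b (Suc a) t) p2"
    using p(1) by (auto simp: supported_def p2_def lift_def)
  define c' where "c' = (\<lambda>w. c w - p2 w)"
  obtain p1 where p1: "supported (raised b a t) p1" "bd b (Suc a) t c' = bd b (Suc a) t p1"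
  proof (rule closed_unpeeled_exact[of b a t "bd b (Suc a) t c'"])
    show "peel b a (Suc t) (bd b (Suc a) t c') w = 0" for w
    proof -
      have "peel b a t c' = (\<lambda>w. peel b a t c w - p w)"
        using peel_lift[OF sp] by (simp add: c'_def peel_linear p2_def fun_eq_iff)
      then have "bd b a (Suc t) (peel b a t c') w = 0" for w
        by (simp only: bd_linear p(2) diff_self)
      then show ?thesis by (simp add: peel_bd)
    qed
  qed (auto simp: supported_bd bd_bd)
  have "bd b (Suc a) t (\<lambda>w. p1 w + p2 w) = bd b (Suc a) t c"
    using p1(2) by (simp add: bd_linear fun_eq_iff c'_def algebra_simps)
  moreover have "supported (pivots b (Suc a) t) (\<lambda>w. p1 w + p2 w)"
    using p1(1) by (intro supported_linear p2) (auto simp: supported_def)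
  ultimately show ?case by blast
qed

text \<open>
  Peeling off all letters lands in the complex of the empty alphabet, which is spanned by the zero word
  in degree \<open>b\<close>. On words of degree \<open>b - a\<close>, which are bijections from a subset of \<open>{1..b}\<close> to \<open>{1..a}\<close>,
  this is a signed sum of the coefficients.
\<close>

fun top_functional :: "nat \<Rightarrow> nat \<Rightarrow> nat \<Rightarrow> ((nat \<Rightarrow> nat) \<Rightarrow> int) \<Rightarrow> int" where
  "top_functional b 0 t c = c (\<lambda>_. 0)"
| "top_functional b (Suc a) t c = top_functional b a (Suc t) (peel b a t c)"

lemma top_functional_linear:
  "top_functional b a t (\<lambda>w. c w + c' w) = top_functional b a t c + top_functional b a t c'"
  "top_functional b a t (\<lambda>w. r * c w) = r * top_functional b a t c"
  by (induction a arbitrary: t c c') (simp_all add: peel_linear[abs_def])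

lemma top_functional_zero: "top_functional b a t (\<lambda>w. 0) = 0"
  using top_functional_linear(2)[of b a t 0 "\<lambda>_. 0"] by simp

lemma top_functional_bd: "top_functional b a (Suc t) (bd b a t c) = 0"
proof (induction a arbitrary: t c)
  case (Suc a)
  have "peel b a (Suc t) (bd b (Suc a) t c) = (\<lambda>w. (-1) * bd b a (Suc t) (peel b a t c) w)"
    by (simp add: peel_bd[abs_def] fun_eq_iff)
  then have "top_functional b (Suc a) (Suc t) (bd b (Suc a) t c) = (-1) * top_functional b a (Suc (Suc t)) (bd b a (Suc t) (peel b a t c))"
    by (simp only: top_functional.simps top_functional_linear)
  then show ?case using Suc by simp
qed (simp add: bd_def)

lemma words_0: "words b 0 t = (if t = b then {\<lambda>_. 0} else {})"
proof -
  have "zeros b (\<lambda>_. 0) = {1..b}" by (auto simp: zeros_def)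
  moreover have "w = (\<lambda>_. 0)" if "w \<in> words b 0 t" for w
    using that by (auto simp: words_def fun_eq_iff)
  moreover have "(\<lambda>_. 0) \<in> words b 0 t \<longleftrightarrow> t = b"
    using calculation(1) by (auto simp: words_def)
  ultimately have "w \<in> words b 0 t \<longleftrightarrow> w = (\<lambda>_. 0) \<and> t = b" for w by blast
  then show ?thesis by (intro Set.set_eqI) simp
qed

lemma top_functional_other_degree:
  assumes "supported (words b a t) c" "t + a \<noteq> b" shows "top_functional b a t c = 0"
  using assms
proof (induction a arbitrary: t c)
  case 0 then show ?case by (simp add: words_0 supported_def)
next
  case (Suc a) then show ?case using supported_peel by simp
qed

lemma top_class_exists:
  assumes "a + t = b"
  shows "\<exists>c. supported (words b a t) c \<and> top_functional b a t c = 1"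
  using assms
proof (induction a arbitrary: t)
  case 0 then show ?case by (intro exI[of _ "\<lambda>w. if w = (\<lambda>_. 0) then 1 else 0"]) (simp add: supported_def words_0)
next
  case (Suc a)
  then obtain c where c: "supported (words b a (Suc t)) c" "top_functional b a (Suc t) c = 1"
    by (metis add_Suc add_Suc_right)
  then have "supported (words b (Suc a) t) (lift b a t c)" "top_functional b (Suc a) t (lift b a t c) = 1"
    using supported_mono[OF supported_lift lone_words] by (simp_all add: peel_lift)
  then show ?case by blast
qed

text \<open>
  Exactness in positive degrees up to the class detected by \<open>top_functional\<close>: peel, solve the problem
  for one letter less, lift the solution, and correct the error, which lies in the acyclic kernel of
  \<open>peel\<close>. The solution can be lifted because its words contain a zero; for a cocycle of degree \<open>0\<close> it
  would have degree \<open>0\<close> as well.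
\<close>

lemma bd_exact:
  assumes "supported (words b a (Suc t)) z" "\<And>w. bd b a (Suc t) z w = 0" "top_functional b a (Suc t) z = 0"
  shows "\<exists>c. supported (words b a t) c \<and> z = bd b a t c"
  using assms
proof (induction a arbitrary: t z)
  case 0
  have "z w = 0" for w
    using 0(1,3) unfolding supported_def words_0 by (cases "w = (\<lambda>_. 0)") simp_all
  then have "z = (\<lambda>_. 0)" by (rule ext)
  then show ?case by (intro exI[of _ "\<lambda>_. 0"]) (auto simp: supported_def bd_zero)
next
  case (Suc a)
  have "bd b a (Suc (Suc t)) (peel b a (Suc t) z) w = 0" for w
  proof -
    have "bd b (Suc a) (Suc t) z = (\<lambda>w. 0)" using Suc.prems(2) by (rule ext)
    then have "peel b a (Suc (Suc t)) (bd b (Suc a) (Suc t) z) w = 0" by (simp only: peel_zero)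
    then show ?thesis unfolding peel_bd by simp
  qed
  moreover have "top_functional b a (Suc (Suc t)) (peel b a (Suc t) z) = 0" using Suc.prems(3) by simp
  ultimately obtain c where c: "supported (words b a (Suc t)) c" "peel b a (Suc t) z = bd b a (Suc t) c"
    using Suc.IH supported_peel by blast
  define c2 where "c2 = lift b a t c"
  have c2: "supported (words b (Suc a) t) c2" unfolding c2_def by (rule supported_mono[OF supported_lift lone_words])
  define y where "y = (\<lambda>w. z w + bd b (Suc a) t c2 w)"
  obtain c1 where c1: "supported (raised b a t) c1" "y = bd b (Suc a) t c1"
  proof (rule closed_unpeeled_exact[of b a t y])
    show "supported (words b (Suc a) (Suc t)) y" unfolding y_def by (intro supported_linear Suc.prems supported_bd)
    show "bd b (Suc a) (Suc t) y w = 0" for w by (simp add: y_def bd_linear bd_bd Suc.prems)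
    show "peel b a (Suc t) y w = 0" for w
      by (simp add: y_def peel_linear peel_bd c(2) c2_def peel_lift[OF c(1)])
  qed
  have "z = bd b (Suc a) t (\<lambda>w. c1 w - c2 w)"
    using c1(2) by (auto simp: y_def bd_linear fun_eq_iff algebra_simps)
  moreover have "supported (words b (Suc a) t) (\<lambda>w. c1 w - c2 w)"
    using supported_mono[OF c1(1) raised_words] c2 by (rule supported_linear)
  ultimately show ?case by blast
qed

lemma finite_pivots: "finite (pivots b a t)"
  using finite_subset[OF pivots_words finite_words] .

lemma card_pivots_Suc:
  "card (pivots b (Suc a) t) = card (raised b a t) + card (pivots b a (Suc t))"
proof -
  let ?f = "\<lambda>w. w(first_slot b (Suc a) w := 0)"
  let ?L = "{w \<in> lone b a t. ?f w \<in> pivots b a (Suc t)}"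
  have bij: "bij_betw ?f ?L (pivots b a (Suc t))"
  proof (rule bij_betw_subset[OF bij_drop_lone])
    show "?f ` ?L = pivots b a (Suc t)"
    proof
      show "pivots b a (Suc t) \<subseteq> ?f ` ?L"
      proof
        fix u assume u: "u \<in> pivots b a (Suc t)"
        then have "u \<in> ?f ` lone b a t" using bij_drop_lone[of b a t] pivots_words by (auto simp: bij_betw_def)
        then show "u \<in> ?f ` ?L" using u by auto
      qed
    qed auto
  qed auto
  have "finite (raised b a t)" "finite ?L"
    using finite_subset[OF raised_words finite_words] finite_subset[OF lone_words finite_words] by auto
  then have "card (pivots b (Suc a) t) = card (raised b a t) + card ?L"
    using raised_lowered_lone_disjoint(2)[of b a t] by (simp add: card_Un_disjoint disjoint_iff)
  then show ?thesis using bij_betw_same_card[OF bij] by simp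
qed

text \<open>
  By the matching, the words over \<open>{1..a + 1}\<close> in degree \<open>t + 1\<close> are the raised words of degrees \<open>t + 1\<close>
  and \<open>t\<close> together with the lone words, which are counted by the induction hypothesis. The last
  summand is the top class.
\<close>

lemma card_words_pivots:
  "card (words b a (Suc t)) = card (pivots b a (Suc t)) + card (pivots b a t) + (if Suc t + a = b then 1 else 0)"
proof (induction a arbitrary: t)
  case 0 then show ?case by (simp add: words_0)
next
  case (Suc a)
  have f: "finite (raised b a (Suc t))" "finite (lowered b a (Suc t))" "finite (lone b a (Suc t))"
    using finite_words[of b "Suc a" "Suc t"] words_Suc_cases[of b a "Suc t"] by (auto intro: finite_subset)
  have "card (words b (Suc a) (Suc t)) = card (raised b a (Suc t)) + card (lowered b a (Suc t)) + card (lone b a (Suc t))"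
    unfolding words_Suc_cases using raised_lowered_lone_disjoint[of b a "Suc t"] f
    by (subst card_Un_disjoint, auto)+
  also have "card (lowered b a (Suc t)) = card (raised b a t)"
    using bij_betw_same_card[OF bij_lower_raised] by simp
  also have "card (lone b a (Suc t)) = card (words b a (Suc (Suc t)))"
    using bij_betw_same_card[OF bij_drop_lone] .
  finally show ?case unfolding card_pivots_Suc using Suc[of "Suc t"] by simp
qed

section \<open>The splitting as a family of integer matrices\<close>

definition delta :: "'w \<Rightarrow> 'w \<Rightarrow> int" where
  "delta w = (\<lambda>v. if v = w then 1 else 0)"

lemma supported_delta: "w \<in> S \<Longrightarrow> supported S (delta w)"
  by (auto simp: supported_def delta_def)

lemma expand_delta:
  assumes "finite S" "supported S c" shows "c = (\<lambda>v. \<Sum>w\<in>S. c w * delta w v)"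
proof
  fix v
  have "c w * delta w v = (if v = w then c v else 0)" for w by (simp add: delta_def)
  then show "c v = (\<Sum>w\<in>S. c w * delta w v)"
    using assms by (simp add: supported_def)
qed

lemma bd_sum: "bd b a t (\<lambda>v. \<Sum>w\<in>S. r w * f w v) u = (\<Sum>w\<in>S. r w * bd b a t (f w) u)"
proof (induction S rule: infinite_finite_induct)
  case (insert x F) then show ?case by (simp add: bd_linear)
qed (simp_all add: bd_zero)

lemma top_functional_sum:
  "top_functional b a t (\<lambda>v. \<Sum>w\<in>S. r w * f w v) = (\<Sum>w\<in>S. r w * top_functional b a t (f w))"
proof (induction S rule: infinite_finite_induct)
  case (insert x F) then show ?case by (simp add: top_functional_linear)
qed (simp_all add: top_functional_zero)

lemma bd_expand:
  assumes "supported (words b a t) c"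
  shows "bd b a t c u = (\<Sum>w\<in>words b a t. c w * bd b a t (delta w) u)"
  using bd_sum[of b a t "\<lambda>w. c w" delta "words b a t" u]
  by (simp flip: expand_delta[OF finite_words assms])

lemma top_functional_expand:
  assumes "supported (words b a t) c"
  shows "top_functional b a t c = (\<Sum>w\<in>words b a t. c w * top_functional b a t (delta w))"
  using top_functional_sum[of b a t "\<lambda>w. c w" delta "words b a t"]
  by (simp flip: expand_delta[OF finite_words assms])

text \<open>
  The matrix of \<open>bd\<close>: a column is indexed by a word \<open>w\<close>, and its nonzero entries are signs at the words
  obtained from \<open>w\<close> by deleting one letter.
\<close>

lemma bd_delta_hit:
  assumes "w y \<noteq> 0" "w \<in> words b a t" "w(y := 0) \<in> words b a (Suc t)"
  shows "bd b a t (delta w) (w(y := 0)) = pos_sign b (w(y := 0)) y"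
proof -
  let ?u = "w(y := 0)"
  have "w y \<le> a" using assms(2) by (simp add: words_def)
  then have y: "w y \<in> {1..a}" using assms(1) by simp
  have "y \<notin> {1..b} \<longrightarrow> w y = 0" using assms(2) by (simp add: words_def)
  then have y': "y \<in> {1..b}" using assms(1) by blast
  have "insert_letter b x (delta w) ?u = (if x = w y then pos_sign b ?u y else 0)" if "x \<in> {1..a}" for x
  proof -
    have "?u(z := x) = w \<longleftrightarrow> z = y \<and> x = w y" if "z \<in> zeros b ?u" for z
    proof
      assume eq: "?u(z := x) = w"
      have "(?u(z := x)) y \<noteq> 0" unfolding eq by (rule assms(1))
      then have "z = y" by (cases "z = y") simp_all
      then show "z = y \<and> x = w y" using fun_cong[OF eq, of y] by simp
    qed simp
    then have "insert_letter b x (delta w) ?u = (\<Sum>z\<in>zeros b ?u. if z = y then (if x = w y then pos_sign b ?u y else 0) else 0)"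
      unfolding insert_letter_def delta_def by (intro sum.cong) auto
    also have "\<dots> = (if x = w y then pos_sign b ?u y else 0)" using y' by (simp add: zeros_def)
    finally show ?thesis .
  qed
  then have "bd b a t (delta w) ?u = (\<Sum>x=1..a. if x = w y then pos_sign b ?u y else 0)"
    unfolding bd_in[OF assms(3)] by (intro sum.cong) auto
  then show ?thesis using y by simp
qed

lemma bd_delta_miss:
  assumes "\<And>y. w y \<noteq> 0 \<Longrightarrow> w(y := 0) \<noteq> u"
  shows "bd b a t (delta w) u = 0"
proof -
  have "u(y := x) \<noteq> w" if "y \<in> zeros b u" "x \<in> {1..a}" for x y
  proof
    assume "u(y := x) = w"
    then have "w y = x" "w(y := 0) = u" using that by (auto simp: zeros_def)
    then show False using assms[of y] that by auto
  qed
  then have "insert_letter b x (delta w) u = 0" if "x \<in> {1..a}" for x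
    using that unfolding insert_letter_def delta_def by (intro sum.neutral) auto
  then show ?thesis by (simp add: bd_def)
qed

lemma words_high_degree:
  assumes "b < a + t" shows "words b a t = {}"
proof -
  have "w \<notin> words b a t" for w
  proof
    assume w: "w \<in> words b a t"
    have "{1..a} \<subseteq> w ` ({1..b} - zeros b w)" 
    proof
      fix x assume x: "x \<in> {1..a}"
      then obtain i where i: "w i = x" using w unfolding words_def by blast
      then have "i \<in> {1..b}" using w x unfolding words_def by fastforce
      then show "x \<in> w ` ({1..b} - zeros b w)" using i x by (auto simp: zeros_def)
    qed
    then have "a \<le> card ({1..b} - zeros b w)" using surj_card_le[of "{1..b} - zeros b w" "{1..a}" w] by simp
    moreover have z: "zeros b w \<subseteq> {1..b}" by (auto simp: zeros_def)
    moreover have "t \<le> b" using card_mono[OF _ z] w by (simp add: words_def)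
    moreover have "card ({1..b} - zeros b w) = b - t"
      using w z by (subst card_Diff_subset) (auto simp: words_def)
    ultimately show False using assms by simp
  qed
  then show ?thesis by blast
qed

text \<open>
  A contracting homotopy \<open>h\<close> in matrix form. In positive degrees \<open>d h + h d\<close> is the identity up to the
  rank one map given by the top functional and a cochain \<open>k\<close> of top degree; in degree \<open>0\<close>, \<open>h d\<close> fixes
  the pivots, and \<open>h\<close> takes values in cochains supported on pivots.
  
  For a basis vector \<open>e\<close>, let \<open>p\<close> be supported on pivots with \<open>d p = d e\<close>. Then \<open>e - p\<close> is a cocycle, and
  after removing a multiple of \<open>k\<close> it is a coboundary; \<open>h e\<close> is its unique primitive that is supported
  on pivots. The uniqueness yields \<open>h (d e) = p\<close>, and with it the identities.
\<close>

lemma integral_splitting: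
  assumes ab: "a < b"
  obtains h :: "nat \<Rightarrow> (nat \<Rightarrow> nat) \<Rightarrow> (nat \<Rightarrow> nat) \<Rightarrow> int" and k :: "(nat \<Rightarrow> nat) \<Rightarrow> int"
  where
    "\<And>t w w'. w \<in> words b a (Suc t) \<Longrightarrow> w' \<in> words b a (Suc t) \<Longrightarrow>
       (\<Sum>v\<in>words b a t. bd b a t (delta v) w * h t v w') +
       (\<Sum>v\<in>words b a (Suc (Suc t)). h (Suc t) w v * bd b a (Suc t) (delta w') v) +
       k w * top_functional b a (Suc t) (delta w') = delta w' w"
    "\<And>w w'. w \<in> words b a 0 \<Longrightarrow> w' \<in> pivots b a 0 \<Longrightarrow>
       (\<Sum>v\<in>words b a (Suc 0). h 0 w v * bd b a 0 (delta w') v) = delta w' w"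
    "\<And>w w'. w \<notin> pivots b a 0 \<Longrightarrow> h 0 w w' = 0"
proof -
  obtain k where k: "supported (words b a (b - a)) k" "top_functional b a (b - a) k = 1"
    using top_class_exists[of a "b - a" b] ab by auto
  have "\<forall>t w. \<exists>p. supported (pivots b a t) p \<and> bd b a t p = bd b a t (delta w)"
    using bd_pivots by blast
  then obtain p where p: "\<And>t w. supported (pivots b a t) (p t w)" "\<And>t w. bd b a t (p t w) = bd b a t (delta w)"
    by metis
  have "\<exists>q. supported (pivots b a t) q \<and>
     bd b a t q = (\<lambda>v. delta w v - p (Suc t) w v - top_functional b a (Suc t) (delta w) * k v)"
    if w: "w \<in> words b a (Suc t)" for t w
  proof -
    let ?z = "\<lambda>v. delta w v - p (Suc t) w v"
    let ?e = "top_functional b a (Suc t)"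
    \<comment> \<open>In the top degree everything is closed and there are no pivots, so \<open>k\<close> is a cocycle there.\<close>
    have pz: "p (Suc t) w = (\<lambda>_. 0)" and kd: "\<And>v. bd b a (Suc t) k v = 0" if "Suc t = b - a"
    proof -
      have "card (words b a (Suc (b - a))) = card (pivots b a (Suc (b - a))) + card (pivots b a (b - a)) + 0"
        using card_words_pivots[of b a "b - a"] ab by simp
      moreover have 0: "words b a (Suc (b - a)) = {}" using ab by (intro words_high_degree) simp
      ultimately have "pivots b a (b - a) = {}" using finite_pivots by simp
      then show "p (Suc t) w = (\<lambda>_. 0)" using p(1)[of "Suc t" w] that by (simp add: supported_def fun_eq_iff)
      show "bd b a (Suc t) k v = 0" for v using 0 that by (simp add: bd_def)
    qed
    have ez: "?e ?z = ?e (delta w)"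
    proof (cases "Suc t = b - a")
      case True show ?thesis by (simp only: pz[OF True] diff_zero)
    next
      case False
      then have "Suc t + a \<noteq> b" by simp
      then show ?thesis using top_functional_other_degree supported_delta[OF w]
        supported_linear(2)[OF supported_delta[OF w] supported_mono[OF p(1) pivots_words]] by simp
    qed
    let ?z' = "\<lambda>v. ?z v - ?e (delta w) * k v"
    have z's: "supported (words b a (Suc t)) ?z'"
    proof (cases "Suc t = b - a")
      case True then show ?thesis
        using supported_delta[OF w] supported_mono[OF p(1) pivots_words] k(1) by (intro supported_linear) auto
    next
      case False
      then have "Suc t + a \<noteq> b" by simp
      then have "?e (delta w) = 0" using top_functional_other_degree supported_delta[OF w] by blast
      then show ?thesis using supported_delta[OF w] supported_mono[OF p(1) pivots_words]
        by (simp add: supported_linear)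
    qed
    have "?e (delta w) * bd b a (Suc t) k v = 0" for v
    proof (cases "Suc t = b - a")
      case False
      then have "Suc t + a \<noteq> b" by simp
      then show ?thesis using top_functional_other_degree[OF supported_delta[OF w]] by simp
    next
      case True show ?thesis by (simp only: kd[OF True] mult_zero_right)
    qed
    then have z'd: "bd b a (Suc t) ?z' v = 0" for v
      by (simp add: bd_linear p(2))
    have z'e: "?e ?z' = 0"
    proof -
      have "?e ?z = ?e (\<lambda>v. ?z' v + ?e (delta w) * k v)" by simp
      also have "\<dots> = ?e ?z' + ?e (delta w) * ?e k" by (simp only: top_functional_linear)
      finally have "?e ?z' = ?e (delta w) - ?e (delta w) * ?e k" unfolding ez by simp
      moreover have "?e (delta w) = ?e (delta w) * ?e k"
      proof (cases "Suc t = b - a")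
        case False
        then have "Suc t + a \<noteq> b" by simp
        then show ?thesis using top_functional_other_degree[OF supported_delta[OF w]] by simp
      qed (simp add: k)
      ultimately show ?thesis by simp
    qed
    obtain c where "?z' = bd b a t c" using bd_exact[OF z's z'd z'e] by blast
    then show ?thesis using bd_pivots[of b a t c] by metis
  qed
  then have "\<forall>t w. \<exists>q. w \<in> words b a (Suc t) \<longrightarrow> supported (pivots b a t) q \<and>
     bd b a t q = (\<lambda>v. delta w v - p (Suc t) w v - top_functional b a (Suc t) (delta w) * k v)"
    by blast
  then obtain q where q0: "\<forall>t w. w \<in> words b a (Suc t) \<longrightarrow> supported (pivots b a t) (q t w) \<and>
     bd b a t (q t w) = (\<lambda>v. delta w v - p (Suc t) w v - top_functional b a (Suc t) (delta w) * k v)"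
    by metis
  have q: "supported (pivots b a t) (q t w)"
     "bd b a t (q t w) v = delta w v - p (Suc t) w v - top_functional b a (Suc t) (delta w) * k v"
    if "w \<in> words b a (Suc t)" for t w v using q0 that by auto
  define h where "h t v w = (if w \<in> words b a (Suc t) then q t w v else 0)" for t v w
  have hd: "(\<Sum>v\<in>words b a (Suc t). h t w v * bd b a t (delta w') v) = p t w' w" 
    if w': "w' \<in> words b a t" for t w w'
  proof -
    let ?W = "words b a (Suc t)"
    let ?d = "bd b a t (delta w')"
    let ?g = "\<lambda>u. \<Sum>v\<in>?W. ?d v * q t v u"
    have gs: "supported (pivots b a t) ?g"
      using q(1) by (auto simp: supported_def intro!: sum.neutral)
    \<comment> \<open>The pivot part of the coboundary \<open>?d\<close> is closed and supported on pivots, hence zero.\<close>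
    have pd: "(\<Sum>v\<in>?W. ?d v * p (Suc t) v u) = 0" for u
    proof (rule closed_pivot_zero[of b a "Suc t" "\<lambda>u. \<Sum>v\<in>?W. ?d v * p (Suc t) v u" u])
      show "supported (pivots b a (Suc t)) (\<lambda>u. \<Sum>v\<in>?W. ?d v * p (Suc t) v u)"
        using p(1) by (auto simp: supported_def intro!: sum.neutral)
      show "bd b a (Suc t) (\<lambda>u. \<Sum>v\<in>?W. ?d v * p (Suc t) v u) x = 0" for x
        unfolding bd_sum p(2) bd_expand[OF supported_bd, symmetric] bd_bd ..
    qed
    have "bd b a t ?g u = ?d u" for u
    proof -
      have "bd b a t ?g u = (\<Sum>v\<in>?W. ?d v * delta v u) - (\<Sum>v\<in>?W. ?d v * p (Suc t) v u)
         - (\<Sum>v\<in>?W. ?d v * top_functional b a (Suc t) (delta v)) * k u"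
        unfolding bd_sum sum_distrib_right sum_subtractf[symmetric]
        by (intro sum.cong refl) (simp add: q(2) algebra_simps)
      also have "(\<Sum>v\<in>?W. ?d v * delta v u) = ?d u"
        using fun_cong[OF expand_delta[OF finite_words supported_bd, of b a t "delta w'"], of u] by (rule sym)
      also have "(\<Sum>v\<in>?W. ?d v * top_functional b a (Suc t) (delta v)) = 0"
        unfolding top_functional_expand[OF supported_bd, symmetric] by (rule top_functional_bd)
      finally show ?thesis by (simp add: pd)
    qed
    \<comment> \<open>Both \<open>?g\<close> and \<open>p t w'\<close> are supported on pivots and have the same coboundary.\<close>
    then have "?g w - p t w' w = 0"
      using gs p by (intro closed_pivot_zero[of b a t "\<lambda>u. ?g u - p t w' u"] supported_linear) (simp_all add: bd_linear)
    then show ?thesis by (simp add: h_def mult.commute)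
  qed
  show thesis
  proof (rule that[of h k])
    fix t w w' assume w: "w \<in> words b a (Suc t)" "w' \<in> words b a (Suc t)"
    have "(\<Sum>v\<in>words b a t. bd b a t (delta v) w * h t v w') = bd b a t (q t w') w"
      using bd_expand[OF supported_mono[OF q(1)[OF w(2)] pivots_words]] w(2) by (simp add: h_def mult.commute)
    then show "(\<Sum>v\<in>words b a t. bd b a t (delta v) w * h t v w') +
       (\<Sum>v\<in>words b a (Suc (Suc t)). h (Suc t) w v * bd b a (Suc t) (delta w') v) +
       k w * top_functional b a (Suc t) (delta w') = delta w' w"
      using hd[OF w(2)] q(2)[OF w(2)] by simp
  next
    fix w w' assume w: "w \<in> words b a 0" "w' \<in> pivots b a 0"
    have "p 0 w' v - delta w' v = 0" for v
      using p w by (intro closed_pivot_zero[of b a 0 "\<lambda>u. p 0 w' u - delta w' u"] supported_linear supported_delta) (simp_all add: bd_linear)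
    then show "(\<Sum>v\<in>words b a (Suc 0). h 0 w v * bd b a 0 (delta w') v) = delta w' w"
      using hd[of w' 0 w] w(2) pivots_words[of b a 0] by auto
  next
    fix w w' assume "w \<notin> pivots b a 0"
    then show "h 0 w w' = 0" using q(1)[of w' 0] by (auto simp: h_def supported_def)
  qed
qed

text \<open>
  The numbers of pivots telescope in the alternating sum of \<open>card_words_pivots\<close>.
\<close>

lemma sum_card_words:
  "(\<Sum>t=0..m. (-1) ^ t * int (card (words b a t)))
    = int (card (words b a 0)) - int (card (pivots b a 0)) + (-1) ^ m * int (card (pivots b a m))
      + (if a < b \<and> b \<le> a + m then (-1) ^ (b - a) else 0)"
proof (induction m)
  case (Suc m)
  show ?case
    unfolding sum.atLeast0_atMost_Suc Suc card_words_pivots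
    by (auto simp: algebra_simps le_Suc_eq)
qed auto

section \<open>Modules, submodules and quotients\<close>

text \<open>
  Linear functionals on a module are its homomorphisms to \<open>R\<close>, regarded as a module over itself.
\<close>

definition regular_module :: "('r, 'x) ring_scheme \<Rightarrow> ('r, 'r) module" where
  "regular_module R = \<lparr>carrier = carrier R, monoid.mult = undefined, one = undefined, zero = \<zero>\<^bsub>R\<^esub>,
     add = (\<oplus>\<^bsub>R\<^esub>), smult = (\<otimes>\<^bsub>R\<^esub>)\<rparr>"

lemma quot_module_carrier: "carrier (quot_module M N) = (\<lambda>x. N +>\<^bsub>M\<^esub> x) ` carrier M"
  by (auto simp: quot_module_def A_RCOSETS_def')

text \<open>
  Generation is stated through submodules instead of linear combinations, as most arguments below
  transport a submodule along a homomorphism.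
\<close>

definition generates :: "('r, 'x) ring_scheme \<Rightarrow> ('r, 'm) module \<Rightarrow> 'm set \<Rightarrow> bool" where
  "generates R M A \<longleftrightarrow> A \<subseteq> carrier M \<and> (\<forall>H. submodule H R M \<longrightarrow> A \<subseteq> H \<longrightarrow> carrier M \<subseteq> H)"

lemma regular_module_simps [simp]:
  "carrier (regular_module R) = carrier R" "\<zero>\<^bsub>regular_module R\<^esub> = \<zero>\<^bsub>R\<^esub>"
  "x \<oplus>\<^bsub>regular_module R\<^esub> y = x \<oplus>\<^bsub>R\<^esub> y" "x \<odot>\<^bsub>regular_module R\<^esub> y = x \<otimes>\<^bsub>R\<^esub> y"
  by (simp_all add: regular_module_def)

lemma free_module_simps [simp]:
  "\<zero>\<^bsub>free_module R X\<^esub> = (\<lambda>x. \<zero>\<^bsub>R\<^esub>)"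
  "u \<oplus>\<^bsub>free_module R X\<^esub> v = (\<lambda>x. u x \<oplus>\<^bsub>R\<^esub> v x)"
  "r \<odot>\<^bsub>free_module R X\<^esub> u = (\<lambda>x. r \<otimes>\<^bsub>R\<^esub> u x)"
  by (simp_all add: free_module_def)

lemma free_module_carrier:
  "u \<in> carrier (free_module R X) \<longleftrightarrow> (\<forall>x. u x \<in> carrier R) \<and> (\<forall>x. x \<notin> X \<longrightarrow> u x = \<zero>\<^bsub>R\<^esub>) \<and>
                   finite {x. u x \<noteq> \<zero>\<^bsub>R\<^esub>}"
  by (simp add: free_module_def)

lemma mod_homI:
  assumes "\<And>u. u \<in> carrier M \<Longrightarrow> h u \<in> carrier N"
    "\<And>u v. u \<in> carrier M \<Longrightarrow> v \<in> carrier M \<Longrightarrow> h (u \<oplus>\<^bsub>M\<^esub> v) = h u \<oplus>\<^bsub>N\<^esub> h v"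
    "\<And>r u. r \<in> carrier R \<Longrightarrow> u \<in> carrier M \<Longrightarrow> h (r \<odot>\<^bsub>M\<^esub> u) = r \<odot>\<^bsub>N\<^esub> h u"
  shows "h \<in> mod_hom R M N"
  using assms by (auto simp: mod_hom_def)

lemma mod_homD:
  assumes "h \<in> mod_hom R M N" "u \<in> carrier M"
  shows "h u \<in> carrier N"
    "v \<in> carrier M \<Longrightarrow> h (u \<oplus>\<^bsub>M\<^esub> v) = h u \<oplus>\<^bsub>N\<^esub> h v"
    "r \<in> carrier R \<Longrightarrow> h (r \<odot>\<^bsub>M\<^esub> u) = r \<odot>\<^bsub>N\<^esub> h u"
  using assms by (auto simp: mod_hom_def)

lemma mod_hom_comp:
  "h \<in> mod_hom R M N \<Longrightarrow> g \<in> mod_hom R N P \<Longrightarrow> (\<lambda>x. g (h x)) \<in> mod_hom R M P"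
  by (auto simp: mod_hom_def Pi_iff)

lemma generatesI:
  assumes "A \<subseteq> carrier M" "\<And>H x. submodule H R M \<Longrightarrow> A \<subseteq> H \<Longrightarrow> x \<in> carrier M \<Longrightarrow> x \<in> H"
  shows "generates R M A"
  using assms by (auto simp: generates_def)

lemma submodule_incl: "module R M \<Longrightarrow> submodule H R M \<Longrightarrow> H \<subseteq> carrier M"
  by (rule module.submoduleE(1))

lemma submodule_closed:
  assumes "module R M" "submodule H R M"
  shows "\<zero>\<^bsub>M\<^esub> \<in> H" "\<And>x y. x \<in> H \<Longrightarrow> y \<in> H \<Longrightarrow> x \<oplus>\<^bsub>M\<^esub> y \<in> H"
    "\<And>r x. r \<in> carrier R \<Longrightarrow> x \<in> H \<Longrightarrow> r \<odot>\<^bsub>M\<^esub> x \<in> H"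
    "\<And>x. x \<in> H \<Longrightarrow> \<ominus>\<^bsub>M\<^esub> x \<in> H"
    "\<And>x y. x \<in> H \<Longrightarrow> y \<in> H \<Longrightarrow> x \<ominus>\<^bsub>M\<^esub> y \<in> H"
proof -
  note E = module.submoduleE[OF assms]
  show "\<zero>\<^bsub>M\<^esub> \<in> H" using subgroup.one_closed[OF submodule.axioms(1)[OF assms(2)]] by simp
  show *: "\<And>x y. x \<in> H \<Longrightarrow> y \<in> H \<Longrightarrow> x \<oplus>\<^bsub>M\<^esub> y \<in> H" by (rule E(5))
  show "\<And>r x. r \<in> carrier R \<Longrightarrow> x \<in> H \<Longrightarrow> r \<odot>\<^bsub>M\<^esub> x \<in> H" by (rule E(4))
  show **: "\<And>x. x \<in> H \<Longrightarrow> \<ominus>\<^bsub>M\<^esub> x \<in> H" by (rule E(3))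
  show "\<And>x y. x \<in> H \<Longrightarrow> y \<in> H \<Longrightarrow> x \<ominus>\<^bsub>M\<^esub> y \<in> H" by (simp add: a_minus_def * **)
qed

context cring
begin

lemma regular_module_module: "module R (regular_module R)"
proof (intro moduleI abelian_groupI)
  show "cring R" by (rule is_cring)
  show "\<exists>y\<in>carrier (regular_module R). y \<oplus>\<^bsub>regular_module R\<^esub> x = \<zero>\<^bsub>regular_module R\<^esub>"
    if "x \<in> carrier (regular_module R)" for x
    using that by (intro bexI[of _ "\<ominus> x"]) (simp_all add: l_neg)
qed (simp_all add: a_ac m_assoc l_distr r_distr)

lemma free_module_module: "module R (free_module R X)"
proof (intro moduleI abelian_groupI)
  show "cring R" by (rule is_cring)
  have fin: "finite {x. u x \<oplus> v x \<noteq> \<zero>}" if "finite {x. u x \<noteq> \<zero>}" "finite {x. v x \<noteq> \<zero>}" for u v :: "_ \<Rightarrow> _"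
    by (rule finite_subset[OF _ finite_UnI[OF that]]) auto
  show "\<exists>y\<in>carrier (free_module R X). y \<oplus>\<^bsub>free_module R X\<^esub> x = \<zero>\<^bsub>free_module R X\<^esub>"
    if "x \<in> carrier (free_module R X)" for x
  proof (intro bexI[of _ "\<lambda>i. \<ominus> x i"])
    show "(\<lambda>i. \<ominus> x i) \<in> carrier (free_module R X)"
      using that by (auto simp: free_module_carrier elim: rev_finite_subset)
  qed (use that in \<open>simp add: free_module_carrier l_neg\<close>)
  fix r u v assume *: "u \<in> carrier (free_module R X)"
  show "u \<oplus>\<^bsub>free_module R X\<^esub> v \<in> carrier (free_module R X)" if "v \<in> carrier (free_module R X)"
    using * that by (auto simp: free_module_carrier intro: fin)
  show "r \<odot>\<^bsub>free_module R X\<^esub> u \<in> carrier (free_module R X)" if "r \<in> carrier R"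
    using * that by (auto simp: free_module_carrier elim: rev_finite_subset)
qed (auto simp: free_module_carrier a_ac m_assoc l_distr r_distr)

lemma basis_vec_closed: "x \<in> X \<Longrightarrow> basis_vec R x \<in> carrier (free_module R X)"
  by (auto simp: free_module_carrier basis_vec_def intro: finite_subset[of _ "{x}"])

lemma hom_zero:
  assumes "module R M" "module R N" "h \<in> mod_hom R M N"
  shows "h \<zero>\<^bsub>M\<^esub> = \<zero>\<^bsub>N\<^esub>"
proof -
  interpret M: module R M by fact
  interpret N: module R N by fact
  have "h (\<zero> \<odot>\<^bsub>M\<^esub> \<zero>\<^bsub>M\<^esub>) = \<zero> \<odot>\<^bsub>N\<^esub> h \<zero>\<^bsub>M\<^esub>"
    by (rule mod_homD(3)[OF assms(3) M.zero_closed zero_closed])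
  then show ?thesis using mod_homD(1)[OF assms(3) M.zero_closed] by simp
qed

lemma hom_uminus:
  assumes "module R M" "module R N" "h \<in> mod_hom R M N" "x \<in> carrier M"
  shows "h (\<ominus>\<^bsub>M\<^esub> x) = \<ominus>\<^bsub>N\<^esub> h x"
proof -
  interpret M: module R M by fact
  interpret N: module R N by fact
  have "h ((\<ominus> \<one>) \<odot>\<^bsub>M\<^esub> x) = (\<ominus> \<one>) \<odot>\<^bsub>N\<^esub> h x"
    by (rule mod_homD(3)[OF assms(3,4)]) simp
  then show ?thesis using mod_homD(1)[OF assms(3,4)] assms(4) by (simp add: M.smult_l_minus N.smult_l_minus)
qed

lemma hom_minus:
  assumes "module R M" "module R N" "h \<in> mod_hom R M N" "x \<in> carrier M" "y \<in> carrier M"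
  shows "h (x \<ominus>\<^bsub>M\<^esub> y) = h x \<ominus>\<^bsub>N\<^esub> h y"
proof -
  interpret M: module R M by fact
  show ?thesis using assms by (simp add: a_minus_def mod_homD(2) hom_uminus)
qed

lemma hom_finsum:
  assumes "module R M" "module R N" "h \<in> mod_hom R M N" "\<And>i. i \<in> I \<Longrightarrow> f i \<in> carrier M"
  shows "h (finsum M f I) = finsum N (\<lambda>i. h (f i)) I"
proof -
  interpret M: module R M by fact
  interpret N: module R N by fact
  show ?thesis using assms(4)
  proof (induction I rule: infinite_finite_induct)
    case (insert i I)
    then have "f \<in> I \<rightarrow> carrier M" "(\<lambda>i. h (f i)) \<in> I \<rightarrow> carrier N" using mod_homD(1)[OF assms(3)] by auto
    then show ?case using insert mod_homD(1,2)[OF assms(3)] by simp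
  qed (simp_all add: hom_zero[OF assms(1-3)])
qed

lemma preimage_submodule:
  assumes "module R M" "module R N" "h \<in> mod_hom R M N" "submodule H R N"
  shows "submodule {x \<in> carrier M. h x \<in> H} R M"
proof -
  interpret M: module R M by fact
  show ?thesis using submodule_closed[OF assms(2,4)] hom_zero[OF assms(1-3)] hom_uminus[OF assms(1-3)] mod_homD[OF assms(3)]
    by (intro M.submoduleI) auto
qed

lemma equalizer_submodule:
  assumes "module R M" "module R N" "h \<in> mod_hom R M N" "h' \<in> mod_hom R M N"
  shows "submodule {x \<in> carrier M. h x = h' x} R M"
proof -
  interpret M: module R M by fact
  show ?thesis using hom_zero[OF assms(1-3)] hom_uminus[OF assms(1-3)] mod_homD[OF assms(3)]
      hom_zero[OF assms(1-2,4)] hom_uminus[OF assms(1-2,4)] mod_homD[OF assms(4)]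
    by (intro M.submoduleI) auto
qed

lemma hom_eq_on_generators:
  assumes "module R M" "module R N" "h \<in> mod_hom R M N" "h' \<in> mod_hom R M N" "generates R M A"
    "\<And>x. x \<in> A \<Longrightarrow> h x = h' x" "x \<in> carrier M"
  shows "h x = h' x"
proof -
  have "A \<subseteq> {x \<in> carrier M. h x = h' x}" using assms(5,6) by (auto simp: generates_def)
  then show ?thesis using equalizer_submodule[OF assms(1-4)] assms(5,7) unfolding generates_def by blast
qed

lemma zero_submodule:
  assumes "module R M" shows "submodule {\<zero>\<^bsub>M\<^esub>} R M"
proof -
  interpret M: module R M by fact
  show ?thesis by (intro M.submoduleI) auto
qed

lemma submodule_generated_submodule:
  assumes "module R M" "A \<subseteq> carrier M"
  shows "submodule (submodule_generated R M A) R M"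
proof -
  interpret M: module R M by fact
  let ?S = "{H. submodule H R M \<and> A \<subseteq> H}"
  have "carrier M \<in> ?S" using assms(2) M.carrier_is_submodule by auto
  then show ?thesis unfolding submodule_generated_def
    using submodule_closed[OF assms(1)]
    by (intro M.submoduleI Inter_lower InterI) (auto dest!: InterD)
qed

lemma submodule_generated_subset: "A \<subseteq> submodule_generated R M A"
  by (auto simp: submodule_generated_def)

lemma submodule_generated_least: "submodule H R M \<Longrightarrow> A \<subseteq> H \<Longrightarrow> submodule_generated R M A \<subseteq> H"
  by (auto simp: submodule_generated_def)

text \<open>
  The linear functional on a free module with value \<open>g x\<close> at the basis vector of \<open>x\<close>. The sum over the
  support is finite also for an infinite index set, such as the sets of pairs and tuples from which
  tensor products and exterior powers are built.
\<close>

definition lin_ext :: "('i \<Rightarrow> 'a) \<Rightarrow> ('i \<Rightarrow> 'a) \<Rightarrow> 'a" where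
  "lin_ext g u = (\<Oplus>x\<in>{x. u x \<noteq> \<zero>}. u x \<otimes> g x)"

lemma lin_ext_superset:
  assumes "u \<in> carrier (free_module R X)" "g \<in> X \<rightarrow> carrier R" "finite S" "{x. u x \<noteq> \<zero>} \<subseteq> S" "S \<subseteq> X"
  shows "lin_ext g u = (\<Oplus>x\<in>S. u x \<otimes> g x)"
  unfolding lin_ext_def
proof (rule add.finprod_mono_neutral_cong_left[OF assms(3,4)])
  show "u i \<otimes> g i = \<zero>" if "i \<in> S - {x. u x \<noteq> \<zero>}" for i
    using that assms(2,5) by (auto simp: Pi_iff)
  have "g x \<in> carrier R" if "x \<in> S" for x using that assms(2,5) by auto
  then show "(\<lambda>x. u x \<otimes> g x) \<in> S \<rightarrow> carrier R" using assms(1) by (auto simp: free_module_carrier)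
qed simp

lemma free_module_support: "u \<in> carrier (free_module R X) \<Longrightarrow> {x. u x \<noteq> \<zero>} \<subseteq> X \<and> finite {x. u x \<noteq> \<zero>}"
  by (auto simp: free_module_carrier)

lemma lin_ext_hom:
  assumes g: "g \<in> X \<rightarrow> carrier R"
  shows "lin_ext g \<in> mod_hom R (free_module R X) (regular_module R)"
proof (rule mod_homI)
  fix u assume u: "u \<in> carrier (free_module R X)"
  note su = free_module_support[OF u]
  have uR: "u x \<in> carrier R" for x using u by (simp add: free_module_carrier)
  show "lin_ext g u \<in> carrier (regular_module R)"
    unfolding lin_ext_def using su g uR by (auto intro!: finsum_closed simp: Pi_iff)
  { fix v assume v: "v \<in> carrier (free_module R X)"
    note sv = free_module_support[OF v]
    have vR: "v x \<in> carrier R" for x using v by (simp add: free_module_carrier)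
    let ?S = "{x. u x \<noteq> \<zero>} \<union> {x. v x \<noteq> \<zero>}"
    interpret F: module R "free_module R X" by (rule free_module_module)
    have uv: "(\<lambda>x. u x \<oplus> v x) \<in> carrier (free_module R X)" using F.a_closed[OF u v] by simp
    have S: "finite ?S" "?S \<subseteq> X" using su sv by auto
    have gS: "g x \<in> carrier R" if "x \<in> ?S" for x using that S(2) g by auto
    have "lin_ext g (\<lambda>x. u x \<oplus> v x) = (\<Oplus>x\<in>?S. (u x \<oplus> v x) \<otimes> g x)"
      using S by (intro lin_ext_superset[OF uv g]) auto
    also have "\<dots> = (\<Oplus>x\<in>?S. u x \<otimes> g x \<oplus> v x \<otimes> g x)"
      using gS uR vR by (intro finsum_cong' refl) (auto simp: l_distr)
    also have "\<dots> = (\<Oplus>x\<in>?S. u x \<otimes> g x) \<oplus> (\<Oplus>x\<in>?S. v x \<otimes> g x)"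
      using gS uR vR by (intro finsum_addf) auto
    also have "(\<Oplus>x\<in>?S. u x \<otimes> g x) = lin_ext g u" using S by (intro lin_ext_superset[OF u g, symmetric]) auto
    also have "(\<Oplus>x\<in>?S. v x \<otimes> g x) = lin_ext g v" using S by (intro lin_ext_superset[OF v g, symmetric]) auto
    finally show "lin_ext g (u \<oplus>\<^bsub>free_module R X\<^esub> v) = lin_ext g u \<oplus>\<^bsub>regular_module R\<^esub> lin_ext g v" by simp }
  { fix r assume r: "r \<in> carrier R"
    interpret F: module R "free_module R X" by (rule free_module_module)
    have ru: "(\<lambda>x. r \<otimes> u x) \<in> carrier (free_module R X)" using F.smult_closed[OF r u] by simp
    have gS: "g x \<in> carrier R" if "x \<in> {x. u x \<noteq> \<zero>}" for x using that su g by auto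
    have "lin_ext g (\<lambda>x. r \<otimes> u x) = (\<Oplus>x\<in>{x. u x \<noteq> \<zero>}. (r \<otimes> u x) \<otimes> g x)"
      using su r by (intro lin_ext_superset[OF ru g]) auto
    also have "\<dots> = (\<Oplus>x\<in>{x. u x \<noteq> \<zero>}. r \<otimes> (u x \<otimes> g x))"
      using gS uR r by (intro finsum_cong' refl) (auto simp: m_assoc)
    also have "\<dots> = r \<otimes> lin_ext g u" unfolding lin_ext_def
      using su gS uR r by (intro finsum_rdistr[symmetric]) auto
    finally show "lin_ext g (r \<odot>\<^bsub>free_module R X\<^esub> u) = r \<odot>\<^bsub>regular_module R\<^esub> lin_ext g u" by simp }
qed

lemma lin_ext_basis_vec:
  assumes "g \<in> X \<rightarrow> carrier R" "x \<in> X"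
  shows "lin_ext g (basis_vec R x) = g x"
proof -
  have "lin_ext g (basis_vec R x) = (\<Oplus>y\<in>{x}. basis_vec R x y \<otimes> g y)"
    using assms by (intro lin_ext_superset[OF basis_vec_closed]) (auto simp: basis_vec_def)
  also have "\<dots> = g x" using assms by (simp add: basis_vec_def Pi_iff)
  finally show ?thesis .
qed

lemma free_module_generated: "generates R (free_module R X) (basis_vec R ` X)"
proof (rule generatesI)
  show "basis_vec R ` X \<subseteq> carrier (free_module R X)" using basis_vec_closed by auto
  fix H u assume H: "submodule H R (free_module R X)" "basis_vec R ` X \<subseteq> H" and u: "u \<in> carrier (free_module R X)"
  note cl = submodule_closed[OF free_module_module H(1)]
  have "u \<in> H" if "finite S" "u \<in> carrier (free_module R X)" "{x. u x \<noteq> \<zero>} \<subseteq> S" "S \<subseteq> X" for S u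
    using that
  proof (induction S arbitrary: u)
    case empty
    then have "u = \<zero>\<^bsub>free_module R X\<^esub>" by auto
    then show ?case using cl(1) by simp
  next
    case (insert x S)
    have uR: "u y \<in> carrier R" for y using insert.prems(1) by (simp add: free_module_carrier)
    have 1: "u(x := \<zero>) \<in> carrier (free_module R X)"
      using insert.prems(1) by (simp add: free_module_carrier) (auto elim: rev_finite_subset)
    have "u(x := \<zero>) \<in> H" using insert.prems by (intro insert.IH 1) auto
    moreover have "basis_vec R x \<in> H" using insert.prems H(2) by auto
    then have "u x \<odot>\<^bsub>free_module R X\<^esub> basis_vec R x \<in> H" using uR by (intro cl(3))
    ultimately have "u(x := \<zero>) \<oplus>\<^bsub>free_module R X\<^esub> u x \<odot>\<^bsub>free_module R X\<^esub> basis_vec R x \<in> H" by (rule cl(2))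
    also have "u(x := \<zero>) \<oplus>\<^bsub>free_module R X\<^esub> u x \<odot>\<^bsub>free_module R X\<^esub> basis_vec R x = u"
      using uR by (auto simp: basis_vec_def fun_eq_iff)
    finally show ?case .
  qed
  then show "u \<in> H" using free_module_support[OF u] u by blast
qed

context
  fixes M :: "('a, 'm) module" and N
  assumes M: "module R M" and N: "submodule N R M"
begin

interpretation M: module R M by (rule M)

lemma submodule_abelian_subgroup: "abelian_subgroup N M"
  using submodule.axioms(1)[OF N] by (intro abelian_subgroupI3 additive_subgroupI M.abelian_group_axioms)

interpretation N: abelian_subgroup N M by (rule submodule_abelian_subgroup)

lemma coset_eq_iff:
  assumes "x \<in> carrier M" "y \<in> carrier M"
  shows "N +>\<^bsub>M\<^esub> x = N +>\<^bsub>M\<^esub> y \<longleftrightarrow> x \<ominus>\<^bsub>M\<^esub> y \<in> N"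
proof -
  have "N +>\<^bsub>M\<^esub> x = N +>\<^bsub>M\<^esub> y \<longleftrightarrow> x \<in> N +>\<^bsub>M\<^esub> y"
    using N.a_repr_independence'[OF _ assms(2), of x] N.a_rcos_self[OF assms(1)] by auto
  also have "\<dots> \<longleftrightarrow> x \<ominus>\<^bsub>M\<^esub> y \<in> N" using N.a_rcos_module[OF assms(2,1)] by (simp add: a_minus_def)
  finally show ?thesis .
qed

lemma coset_self: "x \<in> carrier M \<Longrightarrow> x \<in> N +>\<^bsub>M\<^esub> x"
  by (rule N.a_rcos_self)

lemma coset_memD:
  assumes "x \<in> carrier M" "y \<in> N +>\<^bsub>M\<^esub> x"
  shows "y \<in> carrier M" "N +>\<^bsub>M\<^esub> y = N +>\<^bsub>M\<^esub> x"
  using N.a_elemrcos_carrier[OF assms] N.a_repr_independence'[OF assms(2,1)] by auto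

lemma quot_add:
  assumes "x \<in> carrier M" "y \<in> carrier M"
  shows "(N +>\<^bsub>M\<^esub> x) \<oplus>\<^bsub>quot_module M N\<^esub> (N +>\<^bsub>M\<^esub> y) = N +>\<^bsub>M\<^esub> (x \<oplus>\<^bsub>M\<^esub> y)"
  using N.a_rcos_sum[OF assms] by (simp add: quot_module_def)

lemma coset_smult_cong:
  assumes "x \<in> carrier M" "y \<in> carrier M" "N +>\<^bsub>M\<^esub> x = N +>\<^bsub>M\<^esub> y" "r \<in> carrier R"
  shows "N +>\<^bsub>M\<^esub> (r \<odot>\<^bsub>M\<^esub> x) = N +>\<^bsub>M\<^esub> (r \<odot>\<^bsub>M\<^esub> y)"
proof -
  have "x \<ominus>\<^bsub>M\<^esub> y \<in> N" using assms(3) coset_eq_iff[OF assms(1,2)] by simp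
  then have "r \<odot>\<^bsub>M\<^esub> (x \<ominus>\<^bsub>M\<^esub> y) \<in> N" by (rule submodule_closed(3)[OF M N assms(4)])
  moreover have "r \<odot>\<^bsub>M\<^esub> (x \<ominus>\<^bsub>M\<^esub> y) = r \<odot>\<^bsub>M\<^esub> x \<ominus>\<^bsub>M\<^esub> r \<odot>\<^bsub>M\<^esub> y"
    using assms by (simp add: a_minus_def M.smult_r_distr M.smult_r_minus)
  ultimately show ?thesis using coset_eq_iff assms by simp
qed

lemma quot_smult:
  assumes "x \<in> carrier M" "r \<in> carrier R"
  shows "r \<odot>\<^bsub>quot_module M N\<^esub> (N +>\<^bsub>M\<^esub> x) = N +>\<^bsub>M\<^esub> (r \<odot>\<^bsub>M\<^esub> x)"
proof -
  have "N +>\<^bsub>M\<^esub> (r \<odot>\<^bsub>M\<^esub> u) = N +>\<^bsub>M\<^esub> (r \<odot>\<^bsub>M\<^esub> x)" if "u \<in> N +>\<^bsub>M\<^esub> x" for u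
    using coset_memD[OF assms(1) that] assms by (intro coset_smult_cong) auto
  then have "(\<Union>u\<in>N +>\<^bsub>M\<^esub> x. N +>\<^bsub>M\<^esub> (r \<odot>\<^bsub>M\<^esub> u)) = N +>\<^bsub>M\<^esub> (r \<odot>\<^bsub>M\<^esub> x)"
    by (intro UN_constant_eq[OF coset_self[OF assms(1)]] ballI)
  then show ?thesis by (simp add: quot_module_def)
qed

lemma quot_zero: "\<zero>\<^bsub>quot_module M N\<^esub> = N +>\<^bsub>M\<^esub> \<zero>\<^bsub>M\<^esub>"
  using N.a_rcos_const[OF submodule_closed(1)[OF M N]] by (simp add: quot_module_def)

lemma quot_module_module: "module R (quot_module M N)"
proof (intro moduleI abelian_groupI)
  show "cring R" by (rule is_cring)
  let ?Q = "quot_module M N"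
  show "\<exists>y\<in>carrier ?Q. y \<oplus>\<^bsub>?Q\<^esub> x = \<zero>\<^bsub>?Q\<^esub>" if x: "x \<in> carrier ?Q" for x
  proof -
    obtain u where u: "u \<in> carrier M" "x = N +>\<^bsub>M\<^esub> u" using x by (auto simp: quot_module_carrier)
    then show ?thesis by (intro bexI[of _ "N +>\<^bsub>M\<^esub> (\<ominus>\<^bsub>M\<^esub> u)"])
        (auto simp: quot_module_carrier quot_add quot_zero M.l_neg)
  qed
qed (auto simp: quot_module_carrier quot_add quot_smult quot_zero M.a_ac M.smult_l_distr M.smult_r_distr M.smult_assoc1)

lemma coset_hom: "(\<lambda>x. N +>\<^bsub>M\<^esub> x) \<in> mod_hom R M (quot_module M N)"
  by (rule mod_homI) (auto simp: quot_module_carrier quot_add quot_smult)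

lemma quot_generated:
  assumes "generates R M A"
  shows "generates R (quot_module M N) ((\<lambda>x. N +>\<^bsub>M\<^esub> x) ` A)"
proof (rule generatesI)
  show "(\<lambda>x. N +>\<^bsub>M\<^esub> x) ` A \<subseteq> carrier (quot_module M N)"
    using assms by (auto simp: generates_def quot_module_carrier)
  fix H q assume H: "submodule H R (quot_module M N)" "(\<lambda>x. N +>\<^bsub>M\<^esub> x) ` A \<subseteq> H" "q \<in> carrier (quot_module M N)"
  have "submodule {x \<in> carrier M. N +>\<^bsub>M\<^esub> x \<in> H} R M"
    by (rule preimage_submodule[OF M quot_module_module coset_hom H(1)])
  moreover have "A \<subseteq> {x \<in> carrier M. N +>\<^bsub>M\<^esub> x \<in> H}" using H(2) assms by (auto simp: generates_def)
  ultimately have "carrier M \<subseteq> {x \<in> carrier M. N +>\<^bsub>M\<^esub> x \<in> H}" using assms by (auto simp: generates_def)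
  then show "q \<in> H" using H(3) by (auto simp: quot_module_carrier)
qed

text \<open>
  A homomorphism that vanishes on \<open>N\<close> is constant on each coset of \<open>N\<close>, so the image of a coset is a
  singleton, whose element is the value of the induced map.
\<close>

lemma quot_lift:
  assumes P: "module R P" and h: "h \<in> mod_hom R M P" and ker: "\<And>x. x \<in> N \<Longrightarrow> h x = \<zero>\<^bsub>P\<^esub>"
  shows "\<And>x. x \<in> carrier M \<Longrightarrow> the_elem (h ` (N +>\<^bsub>M\<^esub> x)) = h x"
    and "\<And>x. x \<in> carrier M \<Longrightarrow> h ` (N +>\<^bsub>M\<^esub> x) = {h x}"
    and "(\<lambda>A. the_elem (h ` A)) \<in> mod_hom R (quot_module M N) P"
proof -
  interpret P: module R P by (rule P)
  have *: "h y = h x" if "x \<in> carrier M" "y \<in> N +>\<^bsub>M\<^esub> x" for x y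
  proof -
    note y = coset_memD[OF that]
    then have "y \<ominus>\<^bsub>M\<^esub> x \<in> N" using coset_eq_iff[OF y(1) that(1)] by simp
    then have "h y \<ominus>\<^bsub>P\<^esub> h x = \<zero>\<^bsub>P\<^esub>" using ker hom_minus[OF M P h y(1) that(1)] by simp
    then show ?thesis using mod_homD(1)[OF h] y(1) that(1) by (simp add: a_minus_def P.minus_equality P.add.inv_solve_right')
  qed
  show 0: "h ` (N +>\<^bsub>M\<^esub> x) = {h x}" if "x \<in> carrier M" for x
    using *[OF that] coset_self[OF that] by blast
  show 1: "the_elem (h ` (N +>\<^bsub>M\<^esub> x)) = h x" if "x \<in> carrier M" for x
    using 0[OF that] by simp
  show "(\<lambda>A. the_elem (h ` A)) \<in> mod_hom R (quot_module M N) P"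
    by (rule mod_homI) (auto simp: quot_module_carrier quot_add quot_smult 1 mod_homD[OF h])
qed

lemma first_isomorphism:
  assumes P: "module R P" and h: "h \<in> mod_hom R M P" and surj: "h ` carrier M = carrier P"
    and ker: "\<And>x. x \<in> carrier M \<Longrightarrow> x \<in> N \<longleftrightarrow> h x = \<zero>\<^bsub>P\<^esub>"
  shows "mod_isomorphic R (quot_module M N) P"
proof -
  interpret P: module R P by (rule P)
  have k: "\<And>x. x \<in> N \<Longrightarrow> h x = \<zero>\<^bsub>P\<^esub>" using ker submodule_incl[OF M N] by auto
  note l = quot_lift[OF P h k]
  have "inj_on (\<lambda>A. the_elem (h ` A)) (carrier (quot_module M N))"
  proof (rule inj_onI)
    fix A B assume "A \<in> carrier (quot_module M N)" "B \<in> carrier (quot_module M N)" "the_elem (h ` A) = the_elem (h ` B)"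
    then obtain x y where xy: "x \<in> carrier M" "y \<in> carrier M" "A = N +>\<^bsub>M\<^esub> x" "B = N +>\<^bsub>M\<^esub> y" "h x = h y"
      using l(1) by (auto simp: quot_module_carrier)
    then have "h (x \<ominus>\<^bsub>M\<^esub> y) = \<zero>\<^bsub>P\<^esub>" using hom_minus[OF M P h] mod_homD(1)[OF h] by (simp add: a_minus_def P.r_neg)
    then have "x \<ominus>\<^bsub>M\<^esub> y \<in> N" using ker[of "x \<ominus>\<^bsub>M\<^esub> y"] xy(1,2) by simp
    then show "A = B" using coset_eq_iff[OF xy(1,2)] xy by simp
  qed
  moreover have "(\<lambda>A. the_elem (h ` A)) ` carrier (quot_module M N) = carrier P"
    unfolding surj[symmetric] quot_module_carrier image_image using l(1) by (intro image_cong) auto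
  ultimately show ?thesis
    unfolding mod_isomorphic_def bij_betw_def using quot_module_module P l(3) by blast
qed

end

lemma direct_sum_simps [simp]:
  "\<zero>\<^bsub>direct_sum I M\<^esub> = (\<lambda>i\<in>I. \<zero>\<^bsub>M i\<^esub>)"
  "c \<oplus>\<^bsub>direct_sum I M\<^esub> c' = (\<lambda>i\<in>I. c i \<oplus>\<^bsub>M i\<^esub> c' i)"
  "r \<odot>\<^bsub>direct_sum I M\<^esub> c = (\<lambda>i\<in>I. r \<odot>\<^bsub>M i\<^esub> c i)"
  by (simp_all add: direct_sum_def)

lemma direct_sum_carrier:
  "finite I \<Longrightarrow> carrier (direct_sum I M) = (\<Pi>\<^sub>E i\<in>I. carrier (M i))"
  by (auto simp: direct_sum_def)

context
  fixes I :: "'i set" and M :: "'i \<Rightarrow> ('a, 'm) module"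
  assumes I: "finite I" and M: "\<And>i. i \<in> I \<Longrightarrow> module R (M i)"
begin

lemma direct_sum_module: "module R (direct_sum I M)"
proof -
  have ab: "abelian_group (M i)" if "i \<in> I" for i using M[OF that] by (rule module.axioms)
  note simps = module.smult_l_distr[OF M] module.smult_r_distr[OF M] module.smult_assoc1[OF M] module.smult_one[OF M]
    module.smult_closed[OF M]
    abelian_monoid.a_closed[OF abelian_group.axioms(1)[OF ab]] abelian_monoid.a_assoc[OF abelian_group.axioms(1)[OF ab]]
    abelian_monoid.zero_closed[OF abelian_group.axioms(1)[OF ab]] abelian_monoid.l_zero[OF abelian_group.axioms(1)[OF ab]]
  show ?thesis
  proof (intro moduleI abelian_groupI)
    show "cring R" by (rule is_cring)
    fix x assume x: "x \<in> carrier (direct_sum I M)"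
    then have x': "x i \<in> carrier (M i)" if "i \<in> I" for i using that I by (auto simp: direct_sum_carrier)
    show "\<exists>y\<in>carrier (direct_sum I M). y \<oplus>\<^bsub>direct_sum I M\<^esub> x = \<zero>\<^bsub>direct_sum I M\<^esub>"
    proof (intro bexI[of _ "\<lambda>i\<in>I. \<ominus>\<^bsub>M i\<^esub> x i"])
      show "(\<lambda>i\<in>I. \<ominus>\<^bsub>M i\<^esub> x i) \<in> carrier (direct_sum I M)"
        using x' I by (auto simp: direct_sum_carrier abelian_group.a_inv_closed[OF ab])
      show "(\<lambda>i\<in>I. \<ominus>\<^bsub>M i\<^esub> x i) \<oplus>\<^bsub>direct_sum I M\<^esub> x = \<zero>\<^bsub>direct_sum I M\<^esub>"
        using x' by (auto simp: abelian_group.l_neg[OF ab])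
    qed
    fix y assume y: "y \<in> carrier (direct_sum I M)"
    then have y': "y i \<in> carrier (M i)" if "i \<in> I" for i using that I by (auto simp: direct_sum_carrier)
    show "x \<oplus>\<^bsub>direct_sum I M\<^esub> y = y \<oplus>\<^bsub>direct_sum I M\<^esub> x"
      using x' y' by (auto simp: fun_eq_iff abelian_monoid.a_comm[OF abelian_group.axioms(1)[OF ab]])
  qed (use I in \<open>auto simp: direct_sum_carrier PiE_iff fun_eq_iff extensional_def simps\<close>)
qed

lemma direct_sum_proj: "i \<in> I \<Longrightarrow> (\<lambda>c. c i) \<in> mod_hom R (direct_sum I M) (M i)"
  using I by (intro mod_homI) (auto simp: direct_sum_carrier)

lemma summand_inj_hom: "i \<in> I \<Longrightarrow> summand_inj I M i \<in> mod_hom R (M i) (direct_sum I M)"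
proof (rule mod_homI)
  assume i: "i \<in> I"
  have ab: "abelian_group (M j)" if "j \<in> I" for j using M[OF that] by (rule module.axioms)
  note simps = abelian_monoid.zero_closed[OF abelian_group.axioms(1)[OF ab]] abelian_monoid.l_zero[OF abelian_group.axioms(1)[OF ab]]
    module.smult_r_null[OF M]
  show "summand_inj I M i u \<in> carrier (direct_sum I M)" if "u \<in> carrier (M i)" for u
    using that I i by (auto simp: summand_inj_def direct_sum_carrier simps)
  show "summand_inj I M i (u \<oplus>\<^bsub>M i\<^esub> v) = summand_inj I M i u \<oplus>\<^bsub>direct_sum I M\<^esub> summand_inj I M i v" for u v
    by (auto simp: summand_inj_def fun_eq_iff simps)
  show "summand_inj I M i (r \<odot>\<^bsub>M i\<^esub> u) = r \<odot>\<^bsub>direct_sum I M\<^esub> summand_inj I M i u" if "r \<in> carrier R" for r u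
    using that by (auto simp: summand_inj_def fun_eq_iff simps)
qed

lemma direct_sum_generated:
  assumes "\<And>i. i \<in> I \<Longrightarrow> generates R (M i) (A i)"
  shows "generates R (direct_sum I M) (\<Union>i\<in>I. summand_inj I M i ` A i)"
proof (rule generatesI)
  have A: "A i \<subseteq> carrier (M i)" if "i \<in> I" for i using assms[OF that] by (simp add: generates_def)
  show "(\<Union>i\<in>I. summand_inj I M i ` A i) \<subseteq> carrier (direct_sum I M)"
    using A mod_homD(1)[OF summand_inj_hom] by auto
  fix H c assume H: "submodule H R (direct_sum I M)" "(\<Union>i\<in>I. summand_inj I M i ` A i) \<subseteq> H"
    and c: "c \<in> carrier (direct_sum I M)"
  note cl = submodule_closed[OF direct_sum_module H(1)]
  have inj: "summand_inj I M i u \<in> H" if "i \<in> I" "u \<in> carrier (M i)" for i u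
  proof -
    have "submodule {x \<in> carrier (M i). summand_inj I M i x \<in> H} R (M i)"
      by (rule preimage_submodule[OF M[OF that(1)] direct_sum_module summand_inj_hom[OF that(1)] H(1)])
    moreover have "A i \<subseteq> {x \<in> carrier (M i). summand_inj I M i x \<in> H}" using H(2) A that by auto
    ultimately have "carrier (M i) \<subseteq> {x \<in> carrier (M i). summand_inj I M i x \<in> H}"
      using assms[OF that(1)] by (auto simp: generates_def)
    then show ?thesis using that(2) by auto
  qed
  have "(\<lambda>i\<in>I. if i \<in> J then c i else \<zero>\<^bsub>M i\<^esub>) \<in> H" if "finite J" "J \<subseteq> I" for J
    using that
  proof (induction J)
    case empty then show ?case using cl(1) by (simp add: restrict_def)
  next
    case (insert j J)
    have ab: "abelian_group (M j)" if "j \<in> I" for j using M[OF that] by (rule module.axioms)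
    have ci: "c i \<in> carrier (M i)" if "i \<in> I" for i using c I that by (auto simp: direct_sum_carrier)
    have "(\<lambda>i\<in>I. if i \<in> J then c i else \<zero>\<^bsub>M i\<^esub>) \<oplus>\<^bsub>direct_sum I M\<^esub> summand_inj I M j (c j) \<in> H"
    proof (rule cl(2))
      show "(\<lambda>i\<in>I. if i \<in> J then c i else \<zero>\<^bsub>M i\<^esub>) \<in> H" using insert.IH insert.prems by blast
      show "summand_inj I M j (c j) \<in> H" using insert.prems ci by (intro inj) auto
    qed
    also have "(\<lambda>i\<in>I. if i \<in> J then c i else \<zero>\<^bsub>M i\<^esub>) \<oplus>\<^bsub>direct_sum I M\<^esub> summand_inj I M j (c j)
       = (\<lambda>i\<in>I. if i \<in> insert j J then c i else \<zero>\<^bsub>M i\<^esub>)"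
      using insert ci by (auto simp: fun_eq_iff summand_inj_def abelian_monoid.l_zero[OF abelian_group.axioms(1)[OF ab]]
        abelian_monoid.r_zero[OF abelian_group.axioms(1)[OF ab]] abelian_monoid.zero_closed[OF abelian_group.axioms(1)[OF ab]])
    finally show ?case .
  qed
  from this[OF I subset_refl] have "restrict c I \<in> H" by (simp cong: restrict_cong)
  then show "c \<in> H" using c I by (simp add: direct_sum_carrier extensional_restrict PiE_def)
qed

end

text \<open>
  A finite generating family with a dual family of functionals is a basis: the coordinate map and the
  linear combination map are inverse to each other, as can be checked on generators.
\<close>

lemma dual_basis_iso:
  fixes M :: "('a, 'm) module"
  assumes M: "module R M" and X: "finite X"
    and surj_gen: "generates R M (g ` X)"
    and l: "\<And>x. x \<in> X \<Longrightarrow> l x \<in> mod_hom R M (regular_module R)"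
    and dual: "\<And>x y. x \<in> X \<Longrightarrow> y \<in> X \<Longrightarrow> l x (g y) = (if x = y then \<one> else \<zero>)"
  defines "\<Psi> \<equiv> \<lambda>m x. if x \<in> X then l x m else \<zero>"
  shows "\<Psi> \<in> mod_hom R M (free_module R X)" "bij_betw \<Psi> (carrier M) (carrier (free_module R X))"
proof -
  interpret M: module R M by (rule M)
  have lc: "l x m \<in> carrier R" if "x \<in> X" "m \<in> carrier M" for x m using mod_homD(1)[OF l] that by auto
  show \<Psi>: "\<Psi> \<in> mod_hom R M (free_module R X)"
  proof (rule mod_homI)
    show "\<Psi> u \<in> carrier (free_module R X)" if "u \<in> carrier M" for u
      using that lc by (auto simp: \<Psi>_def free_module_carrier intro: finite_subset[OF _ X])
  qed (use mod_homD(2,3)[OF l] in \<open>auto simp: \<Psi>_def fun_eq_iff\<close>)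
  have gc: "g x \<in> carrier M" if "x \<in> X" for x using surj_gen that by (auto simp: generates_def)
  have \<Psi>g: "\<Psi> (g y) = basis_vec R y" if "y \<in> X" for y
    using that dual by (auto simp: \<Psi>_def basis_vec_def fun_eq_iff)
  define \<Theta> where "\<Theta> u = (\<Oplus>\<^bsub>M\<^esub>x\<in>X. u x \<odot>\<^bsub>M\<^esub> g x)" for u
  have \<Theta>: "\<Theta> \<in> mod_hom R (free_module R X) M"
  proof (rule mod_homI)
    fix u assume u: "u \<in> carrier (free_module R X)"
    then have uR: "u x \<in> carrier R" for x by (simp add: free_module_carrier)
    show "\<Theta> u \<in> carrier M" unfolding \<Theta>_def using uR gc by (intro M.finsum_closed) auto
    show "\<Theta> (u \<oplus>\<^bsub>free_module R X\<^esub> v) = \<Theta> u \<oplus>\<^bsub>M\<^esub> \<Theta> v" if v: "v \<in> carrier (free_module R X)" for v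
    proof -
      have vR: "v x \<in> carrier R" for x using v by (simp add: free_module_carrier)
      have "\<Theta> (u \<oplus>\<^bsub>free_module R X\<^esub> v) = (\<Oplus>\<^bsub>M\<^esub>x\<in>X. u x \<odot>\<^bsub>M\<^esub> g x \<oplus>\<^bsub>M\<^esub> v x \<odot>\<^bsub>M\<^esub> g x)"
        unfolding \<Theta>_def using uR vR gc by (intro M.finsum_cong') (auto simp: M.smult_l_distr)
      then show ?thesis unfolding \<Theta>_def using uR vR gc by (simp add: M.finsum_addf Pi_iff)
    qed
    show "\<Theta> (r \<odot>\<^bsub>free_module R X\<^esub> u) = r \<odot>\<^bsub>M\<^esub> \<Theta> u" if r: "r \<in> carrier R" for r
    proof -
      have "\<Theta> (r \<odot>\<^bsub>free_module R X\<^esub> u) = (\<Oplus>\<^bsub>M\<^esub>x\<in>X. r \<odot>\<^bsub>M\<^esub> (u x \<odot>\<^bsub>M\<^esub> g x))"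
        unfolding \<Theta>_def using uR r gc by (intro M.finsum_cong') (auto simp: M.smult_assoc1)
      then show ?thesis unfolding \<Theta>_def using uR r gc X by (simp add: M.finsum_smult_ldistr Pi_iff)
    qed
  qed
  have \<Theta>b: "\<Theta> (basis_vec R y) = g y" if "y \<in> X" for y
  proof -
    have "\<Theta> (basis_vec R y) = (\<Oplus>\<^bsub>M\<^esub>x\<in>X. if y = x then g x else \<zero>\<^bsub>M\<^esub>)"
      unfolding \<Theta>_def using gc by (intro M.finsum_cong') (auto simp: basis_vec_def)
    also have "\<dots> = g y" using that X gc by (intro M.finsum_singleton) auto
    finally show ?thesis .
  qed
  have 1: "\<Theta> (\<Psi> m) = m" if "m \<in> carrier M" for m
  proof (rule hom_eq_on_generators[OF M M mod_hom_comp[OF \<Psi> \<Theta>] _ surj_gen _ that])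
    show "(\<lambda>m. m) \<in> mod_hom R M M" by (rule mod_homI) auto
    show "\<Theta> (\<Psi> m) = m" if "m \<in> g ` X" for m using that \<Psi>g \<Theta>b by auto
  qed
  have 2: "\<Psi> (\<Theta> u) = u" if "u \<in> carrier (free_module R X)" for u
  proof (rule hom_eq_on_generators[OF free_module_module free_module_module mod_hom_comp[OF \<Theta> \<Psi>] _ free_module_generated _ that])
    show "(\<lambda>m. m) \<in> mod_hom R (free_module R X) (free_module R X)" by (rule mod_homI) auto
    show "\<Psi> (\<Theta> u) = u" if "u \<in> basis_vec R ` X" for u using that \<Psi>g \<Theta>b by auto
  qed
  show "bij_betw \<Psi> (carrier M) (carrier (free_module R X))"
    by (rule bij_betw_byWitness[where f' = \<Theta>]) (use 1 2 mod_homD(1)[OF \<Psi>] mod_homD(1)[OF \<Theta>] in auto)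
qed

end

section \<open>Tensor products\<close>

context cring begin

text \<open>
  The unique ring homomorphism from the integers to \<open>R\<close>.
\<close>

definition of_integer :: "int \<Rightarrow> 'a" where
  "of_integer k = add_pow R k \<one>"

lemma of_integer_closed [simp]: "of_integer k \<in> carrier R"
  by (simp add: of_integer_def)

lemma of_integer_add: "of_integer (k + l) = of_integer k \<oplus> of_integer l"
  by (simp add: of_integer_def add.int_pow_mult)

lemma of_integer_mult: "of_integer (k * l) = of_integer k \<otimes> of_integer l"
  by (simp add: of_integer_def add_pow_ldistr_int add.int_pow_pow mult.commute)

lemma of_integer_0 [simp]: "of_integer 0 = \<zero>"
  by (simp add: of_integer_def add_pow_def)

lemma of_integer_1 [simp]: "of_integer 1 = \<one>"
  by (simp add: of_integer_def)

lemma of_integer_uminus: "of_integer (- k) = \<ominus> of_integer k"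
proof -
  have "of_integer (- k) \<oplus> of_integer k = \<zero>" by (simp flip: of_integer_add)
  then show ?thesis by (metis minus_equality of_integer_closed)
qed

lemma of_integer_sum: "of_integer (\<Sum>i\<in>I. f i) = (\<Oplus>i\<in>I. of_integer (f i))"
proof (induction I rule: infinite_finite_induct)
  case (insert i I) then show ?case by (simp add: of_integer_add Pi_def)
qed simp_all

context
  fixes M :: "('a, 'm) module" and N :: "('a, 'n) module"
  assumes M: "module R M" and N: "module R N"
begin

interpretation M: module R M by (rule M)
interpretation N: module R N by (rule N)

abbreviation (input) "pair_module \<equiv> free_module R (carrier M \<times> carrier N)"
abbreviation (input) "tensor \<equiv> tensor_module R M N"

interpretation F: module R pair_module by (rule free_module_module)

lemma basis_pair_closed: "u \<in> carrier M \<Longrightarrow> v \<in> carrier N \<Longrightarrow> basis_vec R (u, v) \<in> carrier pair_module"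
  by (intro basis_vec_closed) simp

lemma tensor_rels_submodule: "submodule (tensor_rels R M N) R pair_module"
  unfolding tensor_rels_def Let_def
proof (rule submodule_generated_submodule[OF free_module_module])
qed (auto intro!: F.minus_closed F.a_closed F.smult_closed basis_pair_closed simp del: free_module_simps)

lemma tensor_module_module: "module R tensor"
  unfolding tensor_module_def by (rule quot_module_module[OF free_module_module tensor_rels_submodule])

lemma pure_tensor_closed: "u \<in> carrier M \<Longrightarrow> v \<in> carrier N \<Longrightarrow> pure_tensor R M N u v \<in> carrier tensor"
  unfolding tensor_module_def pure_tensor_def quot_module_carrier by (intro imageI basis_pair_closed)

lemma tensor_rels_mem:
  "x \<in> {basis_vec R (u \<oplus>\<^bsub>M\<^esub> u', v) \<ominus>\<^bsub>pair_module\<^esub> (basis_vec R (u, v) \<oplus>\<^bsub>pair_module\<^esub> basis_vec R (u', v)) | u u' v.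
          u \<in> carrier M \<and> u' \<in> carrier M \<and> v \<in> carrier N} \<union>
       {basis_vec R (u, v \<oplus>\<^bsub>N\<^esub> v') \<ominus>\<^bsub>pair_module\<^esub> (basis_vec R (u, v) \<oplus>\<^bsub>pair_module\<^esub> basis_vec R (u, v')) | u v v'.
          u \<in> carrier M \<and> v \<in> carrier N \<and> v' \<in> carrier N} \<union>
       {basis_vec R (r \<odot>\<^bsub>M\<^esub> u, v) \<ominus>\<^bsub>pair_module\<^esub> r \<odot>\<^bsub>pair_module\<^esub> basis_vec R (u, v) | r u v.
          r \<in> carrier R \<and> u \<in> carrier M \<and> v \<in> carrier N} \<union>
       {basis_vec R (u, r \<odot>\<^bsub>N\<^esub> v) \<ominus>\<^bsub>pair_module\<^esub> r \<odot>\<^bsub>pair_module\<^esub> basis_vec R (u, v) | r u v.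
          r \<in> carrier R \<and> u \<in> carrier M \<and> v \<in> carrier N} \<Longrightarrow> x \<in> tensor_rels R M N"
  unfolding tensor_rels_def Let_def by (rule subsetD[OF submodule_generated_subset])

lemma tensor_coset_eqI:
  assumes "x \<in> carrier pair_module" "y \<in> carrier pair_module" "x \<ominus>\<^bsub>pair_module\<^esub> y \<in> tensor_rels R M N"
  shows "tensor_rels R M N +>\<^bsub>pair_module\<^esub> x = tensor_rels R M N +>\<^bsub>pair_module\<^esub> y"
  using coset_eq_iff[OF free_module_module tensor_rels_submodule assms(1,2)] assms(3) by simp

lemma tensor_coset_add:
  assumes "x \<in> carrier pair_module" "y \<in> carrier pair_module"
  shows "tensor_rels R M N +>\<^bsub>pair_module\<^esub> (x \<oplus>\<^bsub>pair_module\<^esub> y) = (tensor_rels R M N +>\<^bsub>pair_module\<^esub> x) \<oplus>\<^bsub>tensor\<^esub> (tensor_rels R M N +>\<^bsub>pair_module\<^esub> y)"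
  unfolding tensor_module_def by (rule quot_add[OF free_module_module tensor_rels_submodule assms, symmetric])

lemma tensor_coset_smult:
  assumes "x \<in> carrier pair_module" "r \<in> carrier R"
  shows "tensor_rels R M N +>\<^bsub>pair_module\<^esub> (r \<odot>\<^bsub>pair_module\<^esub> x) = r \<odot>\<^bsub>tensor\<^esub> (tensor_rels R M N +>\<^bsub>pair_module\<^esub> x)"
  unfolding tensor_module_def by (rule quot_smult[OF free_module_module tensor_rels_submodule assms, symmetric])

lemma pure_tensor_hom_left:
  assumes v: "v \<in> carrier N" shows "(\<lambda>u. pure_tensor R M N u v) \<in> mod_hom R M tensor"
proof (rule mod_homI)
  fix u assume u: "u \<in> carrier M"
  show "pure_tensor R M N u v \<in> carrier tensor" using u v by (rule pure_tensor_closed)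
  show "pure_tensor R M N (u \<oplus>\<^bsub>M\<^esub> u') v = pure_tensor R M N u v \<oplus>\<^bsub>tensor\<^esub> pure_tensor R M N u' v"
    if u': "u' \<in> carrier M" for u'
    unfolding pure_tensor_def tensor_coset_add[OF basis_pair_closed[OF u v] basis_pair_closed[OF u' v], symmetric]
    using u v u' by (intro tensor_coset_eqI basis_pair_closed F.a_closed M.a_closed tensor_rels_mem) blast+
  show "pure_tensor R M N (r \<odot>\<^bsub>M\<^esub> u) v = r \<odot>\<^bsub>tensor\<^esub> pure_tensor R M N u v"
    if r: "r \<in> carrier R" for r
    unfolding pure_tensor_def tensor_coset_smult[OF basis_pair_closed[OF u v] r, symmetric]
    using u v r by (intro tensor_coset_eqI basis_pair_closed F.smult_closed M.smult_closed tensor_rels_mem) blast+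
qed

lemma pure_tensor_hom_right:
  assumes u: "u \<in> carrier M" shows "(\<lambda>v. pure_tensor R M N u v) \<in> mod_hom R N tensor"
proof (rule mod_homI)
  fix v assume v: "v \<in> carrier N"
  show "pure_tensor R M N u v \<in> carrier tensor" using u v by (rule pure_tensor_closed)
  show "pure_tensor R M N u (v \<oplus>\<^bsub>N\<^esub> v') = pure_tensor R M N u v \<oplus>\<^bsub>tensor\<^esub> pure_tensor R M N u v'"
    if v': "v' \<in> carrier N" for v'
    unfolding pure_tensor_def tensor_coset_add[OF basis_pair_closed[OF u v] basis_pair_closed[OF u v'], symmetric]
    using u v v' by (intro tensor_coset_eqI basis_pair_closed F.a_closed N.a_closed tensor_rels_mem) blast+
  show "pure_tensor R M N u (r \<odot>\<^bsub>N\<^esub> v) = r \<odot>\<^bsub>tensor\<^esub> pure_tensor R M N u v"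
    if r: "r \<in> carrier R" for r
    unfolding pure_tensor_def tensor_coset_smult[OF basis_pair_closed[OF u v] r, symmetric]
    using u v r by (intro tensor_coset_eqI basis_pair_closed F.smult_closed N.smult_closed tensor_rels_mem) blast+
qed

text \<open>
  If the submodule \<open>H\<close> contains all \<open>u \<otimes> v\<close> with \<open>u \<in> A\<close> and \<open>v \<in> B\<close>, then for fixed \<open>v\<close> the \<open>u\<close> with
  \<open>u \<otimes> v \<in> H\<close> form a submodule, so \<open>A\<close> may be replaced by the whole module, and then likewise \<open>B\<close>.
\<close>

lemma tensor_generated:
  assumes A: "generates R M A" and B: "generates R N B"
  shows "generates R tensor ((\<lambda>(u, v). pure_tensor R M N u v) ` (A \<times> B))"
proof (rule generatesI)
  have sub: "A \<subseteq> carrier M" "B \<subseteq> carrier N" using A B by (auto simp: generates_def)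
  show "(\<lambda>(u, v). pure_tensor R M N u v) ` (A \<times> B) \<subseteq> carrier tensor"
    using sub pure_tensor_closed by auto
  fix H x assume H: "submodule H R tensor" "(\<lambda>(u, v). pure_tensor R M N u v) ` (A \<times> B) \<subseteq> H" and x: "x \<in> carrier tensor"
  have 1: "pure_tensor R M N u v \<in> H" if u: "u \<in> carrier M" and v: "v \<in> B" for u v
  proof -
    have v': "v \<in> carrier N" using v sub by auto
    have "submodule {u \<in> carrier M. pure_tensor R M N u v \<in> H} R M"
      by (rule preimage_submodule[OF M tensor_module_module pure_tensor_hom_left[OF v'] H(1)])
    moreover have "A \<subseteq> {u \<in> carrier M. pure_tensor R M N u v \<in> H}" using sub H(2) v by auto
    ultimately have "carrier M \<subseteq> {u \<in> carrier M. pure_tensor R M N u v \<in> H}"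
      using A by (simp add: generates_def)
    then show ?thesis using u by blast
  qed
  have 2: "pure_tensor R M N u v \<in> H" if u: "u \<in> carrier M" and v: "v \<in> carrier N" for u v
  proof -
    have "submodule {v \<in> carrier N. pure_tensor R M N u v \<in> H} R N"
      by (rule preimage_submodule[OF N tensor_module_module pure_tensor_hom_right[OF u] H(1)])
    moreover have "B \<subseteq> {v \<in> carrier N. pure_tensor R M N u v \<in> H}" using sub 1 u by auto
    ultimately have "carrier N \<subseteq> {v \<in> carrier N. pure_tensor R M N u v \<in> H}"
      using B by (simp add: generates_def)
    then show ?thesis using v by blast
  qed
  have "generates R tensor ((\<lambda>x. tensor_rels R M N +>\<^bsub>pair_module\<^esub> x) ` (basis_vec R ` (carrier M \<times> carrier N)))"
    unfolding tensor_module_def by (rule quot_generated[OF free_module_module tensor_rels_submodule free_module_generated])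
  moreover have "(\<lambda>x. tensor_rels R M N +>\<^bsub>pair_module\<^esub> x) ` (basis_vec R ` (carrier M \<times> carrier N)) \<subseteq> H"
    using 2 by (auto simp: pure_tensor_def)
  ultimately show "x \<in> H" using H(1) x unfolding generates_def by blast
qed

text \<open>
  The universal property for bilinear forms: the linear extension of \<open>g\<close> to the free module on pairs
  kills the relations.
\<close>

lemma tensor_functional:
  assumes g1: "\<And>v. v \<in> carrier N \<Longrightarrow> (\<lambda>u. g u v) \<in> mod_hom R M (regular_module R)"
    and g2: "\<And>u. u \<in> carrier M \<Longrightarrow> (\<lambda>v. g u v) \<in> mod_hom R N (regular_module R)"
  obtains l where "l \<in> mod_hom R tensor (regular_module R)"
    "\<And>u v. u \<in> carrier M \<Longrightarrow> v \<in> carrier N \<Longrightarrow> l (pure_tensor R M N u v) = g u v"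
proof -
  let ?g = "\<lambda>(u, v). g u v"
  let ?L = "lin_ext ?g"
  have g: "?g \<in> carrier M \<times> carrier N \<rightarrow> carrier R" using mod_homD(1)[OF g1] by auto
  have gc: "g u v \<in> carrier R" if "u \<in> carrier M" "v \<in> carrier N" for u v
    using mod_homD(1)[OF g1[OF that(2)] that(1)] by simp
  note L = lin_ext_hom[OF g]
  have Le: "?L (basis_vec R (u, v)) = g u v" if "u \<in> carrier M" "v \<in> carrier N" for u v
    using lin_ext_basis_vec[OF g, of "(u, v)"] that by simp
  note Lm = hom_minus[OF free_module_module regular_module_module L, unfolded a_minus_def[of "regular_module R"]]
  have ab: "\<ominus>\<^bsub>regular_module R\<^esub> x = \<ominus> x" for x
    by (simp add: a_inv_def m_inv_def regular_module_def)
  have "tensor_rels R M N \<subseteq> {x \<in> carrier pair_module. ?L x \<in> {\<zero>\<^bsub>regular_module R\<^esub>}}"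
    unfolding tensor_rels_def Let_def
  proof (rule submodule_generated_least)
    show "submodule {x \<in> carrier pair_module. ?L x \<in> {\<zero>\<^bsub>regular_module R\<^esub>}} R pair_module"
      by (rule preimage_submodule[OF free_module_module regular_module_module L zero_submodule[OF regular_module_module]])
  qed (auto simp del: free_module_simps simp: Lm ab Le gc basis_pair_closed mod_homD(2,3)[OF L] mod_homD(2,3)[OF g1] mod_homD(2,3)[OF g2] r_neg
      intro!: F.minus_closed F.a_closed F.smult_closed)
  then have ker: "?L x = \<zero>\<^bsub>regular_module R\<^esub>" if "x \<in> tensor_rels R M N" for x using that by auto
  note q = quot_lift[OF free_module_module tensor_rels_submodule regular_module_module L ker]
  show thesis
  proof (rule that)
    show "(\<lambda>A. the_elem (?L ` A)) \<in> mod_hom R tensor (regular_module R)" unfolding tensor_module_def by (rule q(3))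
    show "the_elem (?L ` pure_tensor R M N u v) = g u v" if "u \<in> carrier M" "v \<in> carrier N" for u v
      unfolding pure_tensor_def by (subst q(1)) (auto simp: basis_pair_closed Le that)
  qed
qed

end

end

section \<open>Exterior powers\<close>

context cring begin

definition wedge_class :: "nat \<Rightarrow> ('a, 'm) module \<Rightarrow> 'm list \<Rightarrow> ('m list \<Rightarrow> 'a) set" where
  "wedge_class n M ms = ext_rels R n M +>\<^bsub>free_module R (tuples n (carrier M))\<^esub> basis_vec R ms"

context
  fixes M :: "('a, 'm) module" and n :: nat
  assumes M: "module R M"
begin

interpretation M: module R M by (rule M)

abbreviation (input) "tuple_module \<equiv> free_module R (tuples n (carrier M))"
abbreviation (input) "exterior \<equiv> ext_power R n M"

interpretation F: module R tuple_module by (rule free_module_module)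

lemma basis_tuple_closed: "ms \<in> tuples n (carrier M) \<Longrightarrow> basis_vec R ms \<in> carrier tuple_module"
  by (rule basis_vec_closed)

lemma tuple_replace:
  assumes "ms @ u # ms' \<in> tuples n (carrier M)" "v \<in> carrier M"
  shows "ms @ v # ms' \<in> tuples n (carrier M)"
  using assms by (auto simp: tuples_def)

lemma ext_rels_submodule: "submodule (ext_rels R n M) R tuple_module"
  unfolding ext_rels_def Let_def
proof (rule submodule_generated_submodule[OF free_module_module])
qed (auto intro!: F.minus_closed F.a_closed F.smult_closed basis_tuple_closed simp del: free_module_simps, auto simp: tuples_def)

lemma ext_power_module: "module R exterior"
  unfolding ext_power_def by (rule quot_module_module[OF free_module_module ext_rels_submodule])

lemma wedge_class_closed: "ms \<in> tuples n (carrier M) \<Longrightarrow> wedge_class n M ms \<in> carrier exterior"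
  unfolding ext_power_def wedge_class_def quot_module_carrier by (intro imageI basis_tuple_closed)

lemma ext_rels_mem:
  "x \<in> {basis_vec R (ms @ (u \<oplus>\<^bsub>M\<^esub> v) # ms') \<ominus>\<^bsub>tuple_module\<^esub> (basis_vec R (ms @ u # ms') \<oplus>\<^bsub>tuple_module\<^esub> basis_vec R (ms @ v # ms'))
          | ms u v ms'. ms @ u # ms' \<in> tuples n (carrier M) \<and> v \<in> carrier M} \<union>
       {basis_vec R (ms @ (r \<odot>\<^bsub>M\<^esub> u) # ms') \<ominus>\<^bsub>tuple_module\<^esub> r \<odot>\<^bsub>tuple_module\<^esub> basis_vec R (ms @ u # ms')
          | ms r u ms'. ms @ u # ms' \<in> tuples n (carrier M) \<and> r \<in> carrier R} \<union>
       {basis_vec R ms | ms. ms \<in> tuples n (carrier M) \<and> \<not> distinct ms} \<Longrightarrow> x \<in> ext_rels R n M"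
  unfolding ext_rels_def Let_def by (rule subsetD[OF submodule_generated_subset])

lemma ext_coset_eqI:
  assumes "x \<in> carrier tuple_module" "y \<in> carrier tuple_module" "x \<ominus>\<^bsub>tuple_module\<^esub> y \<in> ext_rels R n M"
  shows "ext_rels R n M +>\<^bsub>tuple_module\<^esub> x = ext_rels R n M +>\<^bsub>tuple_module\<^esub> y"
  using coset_eq_iff[OF free_module_module ext_rels_submodule assms(1,2)] assms(3) by simp

lemma ext_coset_add:
  assumes "x \<in> carrier tuple_module" "y \<in> carrier tuple_module"
  shows "ext_rels R n M +>\<^bsub>tuple_module\<^esub> (x \<oplus>\<^bsub>tuple_module\<^esub> y) = (ext_rels R n M +>\<^bsub>tuple_module\<^esub> x) \<oplus>\<^bsub>exterior\<^esub> (ext_rels R n M +>\<^bsub>tuple_module\<^esub> y)"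
  unfolding ext_power_def by (rule quot_add[OF free_module_module ext_rels_submodule assms, symmetric])

lemma ext_coset_smult:
  assumes "x \<in> carrier tuple_module" "r \<in> carrier R"
  shows "ext_rels R n M +>\<^bsub>tuple_module\<^esub> (r \<odot>\<^bsub>tuple_module\<^esub> x) = r \<odot>\<^bsub>exterior\<^esub> (ext_rels R n M +>\<^bsub>tuple_module\<^esub> x)"
  unfolding ext_power_def by (rule quot_smult[OF free_module_module ext_rels_submodule assms, symmetric])

lemma wedge_class_multilinear:
  assumes t: "length ms + length ms' + 1 = n" "set ms \<subseteq> carrier M" "set ms' \<subseteq> carrier M"
  shows "(\<lambda>u. wedge_class n M (ms @ u # ms')) \<in> mod_hom R M exterior"
proof (rule mod_homI)
  have tu: "ms @ u # ms' \<in> tuples n (carrier M)" if "u \<in> carrier M" for u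
    using t that by (auto simp: tuples_def)
  fix u assume u: "u \<in> carrier M"
  show "wedge_class n M (ms @ u # ms') \<in> carrier exterior" using tu[OF u] by (rule wedge_class_closed)
  show "wedge_class n M (ms @ (u \<oplus>\<^bsub>M\<^esub> v) # ms') = wedge_class n M (ms @ u # ms') \<oplus>\<^bsub>exterior\<^esub> wedge_class n M (ms @ v # ms')"
    if v: "v \<in> carrier M" for v
    unfolding wedge_class_def ext_coset_add[OF basis_tuple_closed[OF tu[OF u]] basis_tuple_closed[OF tu[OF v]], symmetric]
    using u v tu by (intro ext_coset_eqI basis_tuple_closed tu F.a_closed M.a_closed ext_rels_mem) blast+
  show "wedge_class n M (ms @ (r \<odot>\<^bsub>M\<^esub> u) # ms') = r \<odot>\<^bsub>exterior\<^esub> wedge_class n M (ms @ u # ms')"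
    if r: "r \<in> carrier R" for r
    unfolding wedge_class_def ext_coset_smult[OF basis_tuple_closed[OF tu[OF u]] r, symmetric]
    using u r tu by (intro ext_coset_eqI basis_tuple_closed tu F.smult_closed M.smult_closed ext_rels_mem) blast+
qed

lemma wedge_class_nondistinct:
  assumes "ms \<in> tuples n (carrier M)" "\<not> distinct ms"
  shows "wedge_class n M ms = \<zero>\<^bsub>exterior\<^esub>"
proof -
  have "\<ominus>\<^bsub>tuple_module\<^esub> \<zero>\<^bsub>tuple_module\<^esub> = \<zero>\<^bsub>tuple_module\<^esub>"
    using F.minus_equality[OF F.l_zero[OF F.zero_closed]] F.zero_closed by blast
  then have "basis_vec R ms \<ominus>\<^bsub>tuple_module\<^esub> \<zero>\<^bsub>tuple_module\<^esub> = basis_vec R ms"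
    using F.minus_eq[of "basis_vec R ms" "\<zero>\<^bsub>tuple_module\<^esub>"] F.r_zero[OF basis_tuple_closed[OF assms(1)]] by (simp only:)
  moreover have "basis_vec R ms \<in> ext_rels R n M" using assms by (intro ext_rels_mem) blast
  ultimately have "ext_rels R n M +>\<^bsub>tuple_module\<^esub> basis_vec R ms = ext_rels R n M +>\<^bsub>tuple_module\<^esub> \<zero>\<^bsub>tuple_module\<^esub>"
    by (intro ext_coset_eqI basis_tuple_closed assms F.zero_closed) (simp only:)
  then show ?thesis unfolding wedge_class_def ext_power_def quot_zero[OF free_module_module ext_rels_submodule] .
qed

text \<open>
  Expand the vanishing wedge with two adjacent entries equal to \<open>u + v\<close>.
\<close>

lemma wedge_class_swap:
  assumes t: "ms @ u # v # ms' \<in> tuples n (carrier M)"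
  shows "wedge_class n M (ms @ u # v # ms') = \<ominus>\<^bsub>exterior\<^esub> wedge_class n M (ms @ v # u # ms')"
proof -
  interpret E: module R exterior by (rule ext_power_module)
  let ?w = "\<lambda>x y. wedge_class n M (ms @ x # y # ms')"
  have uv: "u \<in> carrier M" "v \<in> carrier M" and s: "set ms \<subseteq> carrier M" "set ms' \<subseteq> carrier M" and l: "length ms + length ms' + 2 = n"
    using t by (auto simp: tuples_def)
  have tt: "ms @ x # y # ms' \<in> tuples n (carrier M)" if "x \<in> carrier M" "y \<in> carrier M" for x y
    using s l that by (auto simp: tuples_def)
  note c = wedge_class_closed[OF tt]
  have z: "?w x x = \<zero>\<^bsub>exterior\<^esub>" if "x \<in> carrier M" for x using tt[OF that that] by (intro wedge_class_nondistinct) auto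
  have h1: "(\<lambda>x. ?w x y) \<in> mod_hom R M exterior" if "y \<in> carrier M" for y
    using wedge_class_multilinear[of ms "y # ms'"] that s l by simp
  have h2: "(\<lambda>y. ?w x y) \<in> mod_hom R M exterior" if "x \<in> carrier M" for x
    using wedge_class_multilinear[of "ms @ [x]" "ms'"] that s l by simp
  let ?s = "u \<oplus>\<^bsub>M\<^esub> v"
  have su: "?s \<in> carrier M" using uv by simp
  have "\<zero>\<^bsub>exterior\<^esub> = ?w ?s ?s" using z[OF su] by simp
  also have "\<dots> = ?w u ?s \<oplus>\<^bsub>exterior\<^esub> ?w v ?s" by (rule mod_homD(2)[OF h1[OF su] uv])
  also have "?w u ?s = ?w u u \<oplus>\<^bsub>exterior\<^esub> ?w u v" by (rule mod_homD(2)[OF h2[OF uv(1)] uv])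
  also have "?w v ?s = ?w v u \<oplus>\<^bsub>exterior\<^esub> ?w v v" by (rule mod_homD(2)[OF h2[OF uv(2)] uv])
  finally have "?w u v \<oplus>\<^bsub>exterior\<^esub> ?w v u = \<zero>\<^bsub>exterior\<^esub>" using c uv z by simp
  then show ?thesis using c uv by (metis E.minus_equality)
qed

text \<open>
  Entries from the whole module are replaced by generators one at a time, each time by transporting a
  submodule along the wedge with the other entries fixed.
\<close>

lemma ext_power_generated:
  assumes A: "generates R M A"
  shows "generates R exterior (wedge_class n M ` tuples n A)"
proof (rule generatesI)
  have sub: "A \<subseteq> carrier M" using A by (simp add: generates_def)
  then have "tuples n A \<subseteq> tuples n (carrier M)" by (auto simp: tuples_def)
  then show "wedge_class n M ` tuples n A \<subseteq> carrier exterior" using wedge_class_closed by auto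
  fix H x assume H: "submodule H R exterior" "wedge_class n M ` tuples n A \<subseteq> H" and x: "x \<in> carrier exterior"
  have *: "wedge_class n M (ms @ as) \<in> H" if "length ms + length as = n" "set ms \<subseteq> carrier M" "set as \<subseteq> A" for ms as
    using that
  proof (induction ms arbitrary: as rule: rev_induct)
    case Nil then show ?case using H(2) by (auto simp: tuples_def)
  next
    case (snoc m ms)
    let ?K = "{u \<in> carrier M. wedge_class n M (ms @ u # as) \<in> H}"
    have h: "(\<lambda>u. wedge_class n M (ms @ u # as)) \<in> mod_hom R M exterior"
      using snoc.prems sub by (intro wedge_class_multilinear) auto
    have "submodule ?K R M" by (rule preimage_submodule[OF M ext_power_module h H(1)])
    moreover have "A \<subseteq> ?K" using snoc.IH[of "_ # as"] snoc.prems sub by auto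
    ultimately have "carrier M \<subseteq> ?K" using A by (simp add: generates_def)
    then show ?case using snoc.prems by auto
  qed
  have "generates R exterior ((\<lambda>x. ext_rels R n M +>\<^bsub>tuple_module\<^esub> x) ` (basis_vec R ` tuples n (carrier M)))"
    unfolding ext_power_def by (rule quot_generated[OF free_module_module ext_rels_submodule free_module_generated])
  moreover have "(\<lambda>x. ext_rels R n M +>\<^bsub>tuple_module\<^esub> x) ` (basis_vec R ` tuples n (carrier M)) \<subseteq> H"
    using *[of _ "[]"] by (auto simp: wedge_class_def tuples_def)
  ultimately show "x \<in> H" using H(1) x unfolding generates_def by blast
qed

text \<open>
  The values on the basis vectors of tuples suffice: if they are multilinear and vanish on tuples
  with a repeated entry, then \<open>L\<close> kills the generators of the relations.
\<close>

lemma ext_rels_killed: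
  assumes P: "module R P" and L: "L \<in> mod_hom R tuple_module P"
    and multi: "\<And>ms ms'. length ms + length ms' + 1 = n \<Longrightarrow> set ms \<subseteq> carrier M \<Longrightarrow> set ms' \<subseteq> carrier M \<Longrightarrow>
      (\<lambda>u. L (basis_vec R (ms @ u # ms'))) \<in> mod_hom R M P"
    and alt: "\<And>ms. ms \<in> tuples n (carrier M) \<Longrightarrow> \<not> distinct ms \<Longrightarrow> L (basis_vec R ms) = \<zero>\<^bsub>P\<^esub>"
    and x: "x \<in> ext_rels R n M"
  shows "L x = \<zero>\<^bsub>P\<^esub>"
proof -
  interpret P: module R P by (rule P)
  have Lm: "L (x \<ominus>\<^bsub>tuple_module\<^esub> y) = \<zero>\<^bsub>P\<^esub>" if "x \<in> carrier tuple_module" "y \<in> carrier tuple_module" "L x = L y" for x y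
    using hom_minus[OF free_module_module P L that(1,2)] mod_homD(1)[OF L that(2)] that(3) by (simp add: a_minus_def P.r_neg)
  have tr: "length ms + length ms' + 1 = n" "set ms \<subseteq> carrier M" "set ms' \<subseteq> carrier M" "u \<in> carrier M"
    if "ms @ u # ms' \<in> tuples n (carrier M)" for ms u ms' using that by (auto simp: tuples_def)
  have Lc: "L (basis_vec R ms) \<in> carrier P" if "ms \<in> tuples n (carrier M)" for ms using mod_homD(1)[OF L basis_tuple_closed[OF that]] .
  have "ext_rels R n M \<subseteq> {x \<in> carrier tuple_module. L x \<in> {\<zero>\<^bsub>P\<^esub>}}"
    unfolding ext_rels_def Let_def
  proof (rule submodule_generated_least)
    show "submodule {x \<in> carrier tuple_module. L x \<in> {\<zero>\<^bsub>P\<^esub>}} R tuple_module"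
      by (rule preimage_submodule[OF free_module_module P L zero_submodule[OF P]])
    have 1: "basis_vec R (ms @ (u \<oplus>\<^bsub>M\<^esub> v) # ms') \<ominus>\<^bsub>tuple_module\<^esub> (basis_vec R (ms @ u # ms') \<oplus>\<^bsub>tuple_module\<^esub> basis_vec R (ms @ v # ms'))
        \<in> {x \<in> carrier tuple_module. L x \<in> {\<zero>\<^bsub>P\<^esub>}}" if t: "ms @ u # ms' \<in> tuples n (carrier M)" and v: "v \<in> carrier M" for ms u v ms'
    proof -
      note cl = basis_tuple_closed[OF t] basis_tuple_closed[OF tuple_replace[OF t v]] basis_tuple_closed[OF tuple_replace[OF t M.a_closed[OF tr(4)[OF t] v]]]
      have "L (basis_vec R (ms @ (u \<oplus>\<^bsub>M\<^esub> v) # ms')) = L (basis_vec R (ms @ u # ms') \<oplus>\<^bsub>tuple_module\<^esub> basis_vec R (ms @ v # ms'))"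
        unfolding mod_homD(2)[OF L cl(1,2)] by (rule mod_homD(2)[OF multi[OF tr(1-3)[OF t]] tr(4)[OF t] v])
      then show ?thesis using Lm[OF cl(3) F.a_closed[OF cl(1,2)]] F.minus_closed[OF cl(3) F.a_closed[OF cl(1,2)]] by blast
    qed
    have 2: "basis_vec R (ms @ (r \<odot>\<^bsub>M\<^esub> u) # ms') \<ominus>\<^bsub>tuple_module\<^esub> r \<odot>\<^bsub>tuple_module\<^esub> basis_vec R (ms @ u # ms')
        \<in> {x \<in> carrier tuple_module. L x \<in> {\<zero>\<^bsub>P\<^esub>}}" if t: "ms @ u # ms' \<in> tuples n (carrier M)" and r: "r \<in> carrier R" for ms r u ms'
    proof -
      note cl = basis_tuple_closed[OF t] basis_tuple_closed[OF tuple_replace[OF t M.smult_closed[OF r tr(4)[OF t]]]]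
      have "L (basis_vec R (ms @ (r \<odot>\<^bsub>M\<^esub> u) # ms')) = L (r \<odot>\<^bsub>tuple_module\<^esub> basis_vec R (ms @ u # ms'))"
        unfolding mod_homD(3)[OF L cl(1) r] by (rule mod_homD(3)[OF multi[OF tr(1-3)[OF t]] tr(4)[OF t] r])
      then show ?thesis using Lm[OF cl(2) F.smult_closed[OF r cl(1)]] F.minus_closed[OF cl(2) F.smult_closed[OF r cl(1)]] by blast
    qed
    have 3: "basis_vec R ms \<in> {x \<in> carrier tuple_module. L x \<in> {\<zero>\<^bsub>P\<^esub>}}" if "ms \<in> tuples n (carrier M)" "\<not> distinct ms" for ms
      using alt[OF that] basis_tuple_closed[OF that(1)] by simp
    show "{basis_vec R (ms @ (u \<oplus>\<^bsub>M\<^esub> v) # ms') \<ominus>\<^bsub>tuple_module\<^esub> (basis_vec R (ms @ u # ms') \<oplus>\<^bsub>tuple_module\<^esub> basis_vec R (ms @ v # ms'))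
          | ms u v ms'. ms @ u # ms' \<in> tuples n (carrier M) \<and> v \<in> carrier M} \<union>
       {basis_vec R (ms @ (r \<odot>\<^bsub>M\<^esub> u) # ms') \<ominus>\<^bsub>tuple_module\<^esub> r \<odot>\<^bsub>tuple_module\<^esub> basis_vec R (ms @ u # ms')
          | ms r u ms'. ms @ u # ms' \<in> tuples n (carrier M) \<and> r \<in> carrier R} \<union>
       {basis_vec R ms | ms. ms \<in> tuples n (carrier M) \<and> \<not> distinct ms} \<subseteq> {x \<in> carrier tuple_module. L x \<in> {\<zero>\<^bsub>P\<^esub>}}"
      using 1 2 3 by blast
  qed
  then show ?thesis using x by auto
qed

lemma ext_power_lift:
  assumes P: "module R P" and L: "L \<in> mod_hom R tuple_module P"
    and multi: "\<And>ms ms'. length ms + length ms' + 1 = n \<Longrightarrow> set ms \<subseteq> carrier M \<Longrightarrow> set ms' \<subseteq> carrier M \<Longrightarrow>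
      (\<lambda>u. L (basis_vec R (ms @ u # ms'))) \<in> mod_hom R M P"
    and alt: "\<And>ms. ms \<in> tuples n (carrier M) \<Longrightarrow> \<not> distinct ms \<Longrightarrow> L (basis_vec R ms) = \<zero>\<^bsub>P\<^esub>"
  shows "(\<lambda>A. the_elem (L ` A)) \<in> mod_hom R exterior P"
    "\<And>ms. ms \<in> tuples n (carrier M) \<Longrightarrow> the_elem (L ` wedge_class n M ms) = L (basis_vec R ms)"
    "\<And>A. A \<in> carrier exterior \<Longrightarrow> L ` A = {the_elem (L ` A)}"
proof -
  have "L x = \<zero>\<^bsub>P\<^esub>" if "x \<in> ext_rels R n M" for x by (rule ext_rels_killed[OF P L multi alt that])
  note q = quot_lift[OF free_module_module ext_rels_submodule P L this]
  show "(\<lambda>A. the_elem (L ` A)) \<in> mod_hom R exterior P" unfolding ext_power_def by (rule q(3))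
  show "the_elem (L ` wedge_class n M ms) = L (basis_vec R ms)" if "ms \<in> tuples n (carrier M)" for ms
    unfolding wedge_class_def by (rule q(1)[OF _ basis_tuple_closed[OF that]])
  show "L ` A = {the_elem (L ` A)}" if "A \<in> carrier exterior" for A
  proof -
    obtain x where x: "x \<in> carrier tuple_module" "A = ext_rels R n M +>\<^bsub>tuple_module\<^esub> x"
      using \<open>A \<in> carrier exterior\<close> unfolding ext_power_def quot_module_carrier by blast
    have "L ` A = {L x}" unfolding x(2) by (rule q(2)[OF _ x(1)])
    then show ?thesis by simp
  qed
qed

end

end

section \<open>Orientation modules have rank one\<close>

context cring begin

lemma mod_hom_cong:
  assumes "module R M" "h' \<in> mod_hom R M N" "\<And>x. x \<in> carrier M \<Longrightarrow> h x = h' x"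
  shows "h \<in> mod_hom R M N"
proof -
  interpret M: module R M by fact
  show ?thesis using mod_homD[OF assms(2)] assms(3) by (intro mod_homI) simp_all
qed

text \<open>
  Each swap that moves \<open>f x\<close> to its place past a smaller entry contributes a factor \<open>-1\<close>.
\<close>

lemma wedge_insort:
  fixes f :: "'i::linorder \<Rightarrow> 'm"
  assumes M: "module R M" and f: "set pre \<subseteq> carrier M" "f x \<in> carrier M" "f ` set ys \<subseteq> carrier M"
    and n: "length pre + Suc (length ys) = n" and s: "sorted ys"
  shows "wedge_class n M (pre @ f x # map f ys) =
    of_integer ((-1) ^ length (filter (\<lambda>y. y < x) ys)) \<odot>\<^bsub>ext_power R n M\<^esub> wedge_class n M (pre @ map f (insort x ys))"
  using f n s
proof (induction ys arbitrary: pre)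
  case Nil
  interpret E: module R "ext_power R n M" by (rule ext_power_module[OF M])
  have "pre @ f x # [] \<in> tuples n (carrier M)" using Nil by (auto simp: tuples_def)
  then show ?case using wedge_class_closed[OF M] by (simp del: append_Cons)
next
  case (Cons y ys)
  interpret E: module R "ext_power R n M" by (rule ext_power_module[OF M])
  have t: "pre @ f x # map f (y # ys) \<in> tuples n (carrier M)" using Cons.prems by (auto simp: tuples_def)
  show ?case
  proof (cases "x \<le> y")
    case True
    then have "filter (\<lambda>y. y < x) (y # ys) = []" using Cons.prems(5) by (auto simp: filter_empty_conv)
    then show ?thesis using wedge_class_closed[OF M t] True by simp
  next
    case False
    let ?c = "(-1 :: int) ^ length (filter (\<lambda>y. y < x) ys)"
    let ?w = "wedge_class n M (pre @ f y # map f (insort x ys))"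
    have t2: "pre @ f y # map f (insort x ys) \<in> tuples n (carrier M)"
      using Cons.prems by (auto simp: tuples_def set_insort_key)
    have "wedge_class n M (pre @ f x # map f (y # ys)) = \<ominus>\<^bsub>ext_power R n M\<^esub> wedge_class n M (pre @ f y # f x # map f ys)"
      using wedge_class_swap[OF M, of pre "f x" "f y" "map f ys"] t by simp
    also have "wedge_class n M (pre @ f y # f x # map f ys) = of_integer ?c \<odot>\<^bsub>ext_power R n M\<^esub> ?w"
      using Cons.IH[of "pre @ [f y]"] Cons.prems by simp
    also have "\<ominus>\<^bsub>ext_power R n M\<^esub> (of_integer ?c \<odot>\<^bsub>ext_power R n M\<^esub> ?w) = of_integer (- ?c) \<odot>\<^bsub>ext_power R n M\<^esub> ?w"
      using wedge_class_closed[OF M t2] by (simp add: E.smult_l_minus of_integer_uminus)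
    finally have eq: "wedge_class n M (pre @ f x # map f (y # ys)) = of_integer (- ?c) \<odot>\<^bsub>ext_power R n M\<^esub> ?w" .
    have "y < x" "\<not> x \<le> y" using False by auto
    then show ?thesis unfolding eq by simp
  qed
qed

lemma wedge_sort:
  fixes f :: "'i::linorder \<Rightarrow> 'm"
  assumes M: "module R M" and f: "set pre \<subseteq> carrier M" "f ` set xs \<subseteq> carrier M"
    and n: "length pre + length xs = n"
  shows "\<exists>c. wedge_class n M (pre @ map f xs) = of_integer c \<odot>\<^bsub>ext_power R n M\<^esub> wedge_class n M (pre @ map f (sort xs))"
  using f n
proof (induction xs arbitrary: pre)
  case Nil
  interpret E: module R "ext_power R n M" by (rule ext_power_module[OF M])
  have "pre \<in> tuples n (carrier M)" using Nil by (auto simp: tuples_def)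
  then show ?case using wedge_class_closed[OF M] by (intro exI[of _ 1]) simp
next
  case (Cons x xs)
  interpret E: module R "ext_power R n M" by (rule ext_power_module[OF M])
  have "\<exists>c. wedge_class n M ((pre @ [f x]) @ map f xs) = of_integer c \<odot>\<^bsub>ext_power R n M\<^esub> wedge_class n M ((pre @ [f x]) @ map f (sort xs))"
    using Cons.prems by (intro Cons.IH) auto
  then obtain c where c: "wedge_class n M (pre @ map f (x # xs)) = of_integer c \<odot>\<^bsub>ext_power R n M\<^esub> wedge_class n M (pre @ f x # map f (sort xs))"
    by auto
  obtain d where d: "wedge_class n M (pre @ f x # map f (sort xs)) = of_integer d \<odot>\<^bsub>ext_power R n M\<^esub> wedge_class n M (pre @ map f (insort x (sort xs)))"
    using wedge_insort[OF M, of pre f x "sort xs" n] Cons.prems by auto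
  have "pre @ map f (insort x (sort xs)) \<in> tuples n (carrier M)"
    using Cons.prems by (auto simp: tuples_def set_insort_key)
  then show ?case
    using wedge_class_closed[OF M] unfolding c d sort_key_simps
    by (intro exI[of _ "c * d"]) (simp add: of_integer_mult E.smult_assoc1)
qed

definition top_wedge :: "'i::linorder set \<Rightarrow> (('i \<Rightarrow> 'a) list \<Rightarrow> 'a) set" where
  "top_wedge S = wedge_class (card S) (free_module R S) (map (basis_vec R) (sorted_list_of_set S))"

lemma Or_module: "module R (Or R S)"
  unfolding Or_def by (rule ext_power_module[OF free_module_module])

lemma top_wedge_closed:
  assumes "finite S" shows "top_wedge S \<in> carrier (Or R S)"
  unfolding Or_def top_wedge_def using assms basis_vec_closed
  by (intro wedge_class_closed[OF free_module_module]) (auto simp: tuples_def)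

text \<open>
  The wedges of basis vectors generate. Such a wedge vanishes if a basis vector is repeated;
  otherwise it contains each element of \<open>S\<close> once, and sorting it changes only the sign.
\<close>

lemma Or_generated:
  fixes S :: "'i::linorder set"
  assumes S: "finite S"
  shows "generates R (Or R S) {top_wedge S}"
proof (rule generatesI)
  show "{top_wedge S} \<subseteq> carrier (Or R S)" using top_wedge_closed[OF S] by simp
  fix H x assume H: "submodule H R (Or R S)" "{top_wedge S} \<subseteq> H" and x: "x \<in> carrier (Or R S)"
  note cl = submodule_closed[OF Or_module H(1)]
  let ?n = "card S"
  let ?w = "wedge_class ?n (free_module R S)"
  have b: "basis_vec R ` S \<subseteq> carrier (free_module R S)" using basis_vec_closed by auto
  have "?w ms \<in> H" if ms: "ms \<in> tuples ?n (basis_vec R ` S)" for ms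
  proof -
    have "ms \<in> lists (basis_vec R ` S)" using ms by (auto simp: tuples_def)
    then obtain xs where xs: "ms = map (basis_vec R) xs" "set xs \<subseteq> S" by (auto simp: lists_image)
    have l: "length xs = ?n" using ms xs by (simp add: tuples_def)
    have t: "ms \<in> tuples ?n (carrier (free_module R S))" using ms b by (auto simp: tuples_def)
    show ?thesis
    proof (cases "distinct xs")
      case True
      then have "set xs = S" using xs(2) l S by (metis card_subset_eq distinct_card)
      then have s: "sort xs = sorted_list_of_set S" using True by (metis distinct_remdups_id sorted_list_of_set_sort_remdups)
      obtain c where "?w ([] @ map (basis_vec R) xs) = of_integer c \<odot>\<^bsub>ext_power R ?n (free_module R S)\<^esub> ?w ([] @ map (basis_vec R) (sort xs))"
        using wedge_sort[OF free_module_module[of S], of "[]" "basis_vec R" xs ?n] xs(2) b l by auto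
      then have "?w ms = of_integer c \<odot>\<^bsub>Or R S\<^esub> top_wedge S" unfolding s Or_def top_wedge_def xs(1) by simp
      then show ?thesis using cl(3) H(2) by simp
    next
      case False
      then have "\<not> distinct ms" using xs(1) by (auto simp: distinct_map)
      then show ?thesis using wedge_class_nondistinct[OF free_module_module t] cl(1) by (simp add: Or_def)
    qed
  qed
  then have "?w ` tuples ?n (basis_vec R ` S) \<subseteq> H" by auto
  then show "x \<in> H"
    using ext_power_generated[OF free_module_module free_module_generated[of S], of ?n] H(1) x unfolding Or_def generates_def by blast
qed

section \<open>The determinant functional\<close>

definition leibniz :: "nat \<Rightarrow> 'i list \<Rightarrow> ('i \<Rightarrow> 'a) list \<Rightarrow> 'a" where
  "leibniz n xs ms = (\<Oplus>p\<in>{p. p permutes {..<n}}.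
     of_integer (sign p) \<otimes> (\<Otimes>i\<in>{..<n}. (ms ! i) (xs ! p i)))"

lemma weighted_evaluation_hom:
  assumes "finite P" "\<And>p. p \<in> P \<Longrightarrow> a p \<in> carrier R"
  shows "(\<lambda>u. \<Oplus>p\<in>P. a p \<otimes> u (y p)) \<in> mod_hom R (free_module R S) (regular_module R)"
proof (rule mod_homI)
  fix u assume u: "u \<in> carrier (free_module R S)"
  then have uR: "u x \<in> carrier R" for x by (simp add: free_module_carrier)
  show "(\<Oplus>p\<in>P. a p \<otimes> u (y p)) \<in> carrier (regular_module R)"
    using assms uR by (auto intro!: finsum_closed)
  show "(\<Oplus>p\<in>P. a p \<otimes> (u \<oplus>\<^bsub>free_module R S\<^esub> v) (y p)) =
     (\<Oplus>p\<in>P. a p \<otimes> u (y p)) \<oplus>\<^bsub>regular_module R\<^esub> (\<Oplus>p\<in>P. a p \<otimes> v (y p))"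
    if v: "v \<in> carrier (free_module R S)" for v
  proof -
    have vR: "v x \<in> carrier R" for x using v by (simp add: free_module_carrier)
    have "(\<Oplus>p\<in>P. a p \<otimes> (u \<oplus>\<^bsub>free_module R S\<^esub> v) (y p)) = (\<Oplus>p\<in>P. a p \<otimes> u (y p) \<oplus> a p \<otimes> v (y p))"
      using assms uR vR by (intro finsum_cong') (auto simp: r_distr)
    then show ?thesis using assms uR vR by (simp add: finsum_addf Pi_iff)
  qed
  show "(\<Oplus>p\<in>P. a p \<otimes> (r \<odot>\<^bsub>free_module R S\<^esub> u) (y p)) =
     r \<odot>\<^bsub>regular_module R\<^esub> (\<Oplus>p\<in>P. a p \<otimes> u (y p))" if r: "r \<in> carrier R" for r
  proof -
    have "(\<Oplus>p\<in>P. a p \<otimes> (r \<odot>\<^bsub>free_module R S\<^esub> u) (y p)) = (\<Oplus>p\<in>P. r \<otimes> (a p \<otimes> u (y p)))"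
      using assms uR r by (intro finsum_cong') (auto simp: m_ac)
    then show ?thesis using assms uR r by (simp add: finsum_rdistr Pi_iff)
  qed
qed

lemma leibniz_multilinear:
  assumes n: "length ms + length ms' + 1 = n"
    and c: "set ms \<subseteq> carrier (free_module R S)" "set ms' \<subseteq> carrier (free_module R S)"
  shows "(\<lambda>u. leibniz n xs (ms @ u # ms')) \<in> mod_hom R (free_module R S) (regular_module R)"
proof -
  let ?j = "length ms"
  let ?P = "{p. p permutes {..<n}}"
  let ?z = "\<lambda>_. \<zero>"
  \<comment> \<open>The factor at position \<open>length ms\<close> is split off; the vector \<open>?z\<close> only fills that position.\<close>
  define a where "a p = of_integer (sign p) \<otimes> (\<Otimes>i\<in>{..<n} - {?j}. ((ms @ ?z # ms') ! i) (xs ! p i))" for p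
  have in_c: "((ms @ u # ms') ! i) x \<in> carrier R" if "i < n" "\<And>x. u x \<in> carrier R" for i x u
  proof -
    have "(ms @ u # ms') ! i \<in> set (ms @ u # ms')" using that(1) n by (intro nth_mem) simp
    then show ?thesis using c that(2) by (auto simp: free_module_carrier)
  qed
  have a: "a p \<in> carrier R" for p unfolding a_def using in_c by (intro m_closed finprod_closed) auto
  have "leibniz n xs (ms @ u # ms') = (\<Oplus>p\<in>?P. a p \<otimes> u (xs ! p ?j))" if u: "u \<in> carrier (free_module R S)" for u
    unfolding leibniz_def
  proof (rule finsum_cong')
    have uR: "u x \<in> carrier R" for x using u by (simp add: free_module_carrier)
    show "(\<lambda>p. a p \<otimes> u (xs ! p ?j)) \<in> ?P \<rightarrow> carrier R" using a uR by auto
    fix p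
    have rest: "(\<Otimes>i\<in>{..<n} - {?j}. ((ms @ u # ms') ! i) (xs ! p i)) = (\<Otimes>i\<in>{..<n} - {?j}. ((ms @ ?z # ms') ! i) (xs ! p i))"
      using in_c[of _ ?z] by (intro finprod_cong') (auto simp: nth_append nth_Cons')
    have "{..<n} = insert ?j ({..<n} - {?j})" using n by auto
    then have "(\<Otimes>i\<in>{..<n}. ((ms @ u # ms') ! i) (xs ! p i))
       = (\<Otimes>i\<in>insert ?j ({..<n} - {?j}). ((ms @ u # ms') ! i) (xs ! p i))" by simp
    also have "\<dots> = u (xs ! p ?j) \<otimes> (\<Otimes>i\<in>{..<n} - {?j}. ((ms @ u # ms') ! i) (xs ! p i))"
      using in_c[of _ u] uR by (subst finprod_insert) auto
    finally show "of_integer (sign p) \<otimes> (\<Otimes>i\<in>{..<n}. ((ms @ u # ms') ! i) (xs ! p i)) = a p \<otimes> u (xs ! p ?j)"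
      unfolding rest a_def using in_c[of _ ?z] uR by (simp add: m_ac finprod_closed Pi_iff)
  qed simp
  then show ?thesis
    using a finite_permutations[of "{..<n}"]
    by (intro mod_hom_cong[OF free_module_module weighted_evaluation_hom[of ?P a "\<lambda>p. xs ! p ?j"]]) auto
qed

text \<open>
  If the entries at \<open>i\<close> and \<open>j\<close> agree, composition with the transposition of \<open>i\<close> and \<open>j\<close> maps the even
  permutations onto the odd ones, preserving the product and reversing the sign. Splitting the sum in
  this way avoids a division by two.
\<close>

lemma leibniz_alternating:
  assumes t: "ms \<in> tuples n (carrier (free_module R S))" and nd: "\<not> distinct ms"
  shows "leibniz n xs ms = \<zero>"
proof -
  let ?P = "{p. p permutes {..<n}}"
  obtain i j where ij: "i < n" "j < n" "i \<noteq> j" "ms ! i = ms ! j"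
    using nd t by (auto simp: distinct_conv_nth tuples_def)
  define \<tau> where "\<tau> = Transposition.transpose i j"
  have \<tau>: "\<tau> permutes {..<n}" unfolding \<tau>_def using ij by (intro permutes_swap_id) auto
  have \<tau>\<tau>: "\<tau> \<circ> \<tau> = id" by (simp add: \<tau>_def)
  have s\<tau>: "sign \<tau> = -1" using ij(3) by (simp add: \<tau>_def sign_swap_id)
  define f where "f p = of_integer (sign p) \<otimes> (\<Otimes>i\<in>{..<n}. (ms ! i) (xs ! p i))" for p
  have mR: "(ms ! i) x \<in> carrier R" if "i < n" for i x
  proof -
    have "ms ! i \<in> carrier (free_module R S)" using t that by (auto simp: tuples_def)
    then show ?thesis by (simp add: free_module_carrier)
  qed
  have fR: "f p \<in> carrier R" for p unfolding f_def using mR by (intro m_closed finprod_closed) auto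
  have f\<tau>: "f (p \<circ> \<tau>) = \<ominus> f p" if "p \<in> ?P" for p
  proof -
    have "(\<Otimes>k\<in>{..<n}. (ms ! k) (xs ! p k)) = (\<Otimes>k\<in>\<tau> ` {..<n}. (ms ! k) (xs ! p k))"
      using permutes_image[OF \<tau>] by simp
    also have "\<dots> = (\<Otimes>k\<in>{..<n}. (ms ! \<tau> k) (xs ! p (\<tau> k)))"
      using permutes_image[OF \<tau>] permutes_inj_on[OF \<tau>] mR by (intro finprod_reindex) auto
    also have "\<dots> = (\<Otimes>k\<in>{..<n}. (ms ! k) (xs ! p (\<tau> k)))"
      using ij mR by (intro finprod_cong') (auto simp: \<tau>_def Transposition.transpose_def)
    finally have "f (p \<circ> \<tau>) = of_integer (- sign p) \<otimes> (\<Otimes>k\<in>{..<n}. (ms ! k) (xs ! p k))"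
      using that \<tau> s\<tau> by (simp add: f_def sign_compose permutes_imp_permutation[of "{..<n}"])
    then show ?thesis
      unfolding f_def of_integer_uminus using mR by (simp add: l_minus finprod_closed Pi_iff)
  qed
  let ?E = "{p \<in> ?P. evenperm p}"
  have finP: "finite ?P" by (intro finite_permutations) simp
  have inj: "inj_on (\<lambda>p. p \<circ> \<tau>) ?E"
    by (rule inj_on_inverseI[where g = "\<lambda>p. p \<circ> \<tau>"]) (simp add: comp_assoc \<tau>\<tau>)
  have perm: "permutation p" if "p \<in> ?P" for p using that permutes_imp_permutation[of "{..<n}" p] by simp
  have ev: "evenperm (p \<circ> \<tau>) \<longleftrightarrow> \<not> evenperm p" if "p \<in> ?P" for p
    using that s\<tau> perm[OF that] perm[of \<tau>] \<tau> by (simp add: evenperm_comp sign_def split: if_splits)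
  have O: "(\<lambda>p. p \<circ> \<tau>) ` ?E = ?P - ?E"
  proof
    show "(\<lambda>p. p \<circ> \<tau>) ` ?E \<subseteq> ?P - ?E" using ev \<tau> by (auto intro: permutes_compose)
    show "?P - ?E \<subseteq> (\<lambda>p. p \<circ> \<tau>) ` ?E"
    proof
      fix p assume p: "p \<in> ?P - ?E"
      then have "p \<circ> \<tau> \<in> ?E" using ev \<tau> by (auto intro: permutes_compose)
      moreover have "p = (p \<circ> \<tau>) \<circ> \<tau>" by (simp add: comp_assoc \<tau>\<tau>)
      ultimately show "p \<in> (\<lambda>p. p \<circ> \<tau>) ` ?E" by (intro image_eqI[where x = "p \<circ> \<tau>"])
    qed
  qed
  have "leibniz n xs ms = finsum R f (?E \<union> (\<lambda>p. p \<circ> \<tau>) ` ?E)"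
    unfolding leibniz_def O f_def by (rule arg_cong2[of _ _ _ _ "finsum R"]) auto
  also have "\<dots> = finsum R f ?E \<oplus> finsum R f ((\<lambda>p. p \<circ> \<tau>) ` ?E)"
    using finP fR unfolding O by (intro finsum_Un_disjoint) auto
  also have "finsum R f ((\<lambda>p. p \<circ> \<tau>) ` ?E) = (\<Oplus>p\<in>?E. f (p \<circ> \<tau>))"
    using inj fR by (intro finsum_reindex) auto
  also have "\<dots> = (\<Oplus>p\<in>?E. \<ominus> f p)"
    using f\<tau> fR by (intro finsum_cong') auto
  also have "finsum R f ?E \<oplus> (\<Oplus>p\<in>?E. \<ominus> f p) = (\<Oplus>p\<in>?E. f p \<oplus> \<ominus> f p)"
    using fR by (intro finsum_addf[symmetric]) auto
  also have "\<dots> = \<zero>" using fR by (simp add: r_neg)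
  finally show ?thesis .
qed

lemma leibniz_basis:
  assumes "distinct xs" "length xs = n"
  shows "leibniz n xs (map (basis_vec R) xs) = \<one>"
proof -
  let ?P = "{p. p permutes {..<n}}"
  have "of_integer (sign p) \<otimes> (\<Otimes>i\<in>{..<n}. (map (basis_vec R) xs ! i) (xs ! p i)) = (if id = p then \<one> else \<zero>)"
    if p: "p \<in> ?P" for p
  proof (cases "p = id")
    case True
    have "(\<Otimes>i\<in>{..<n}. (map (basis_vec R) xs ! i) (xs ! p i)) = \<one>"
      using assms True by (intro finprod_one_eqI) (auto simp: basis_vec_def)
    then show ?thesis using True by simp
  next
    case False
    then obtain i where i: "p i \<noteq> i" by (auto simp: fun_eq_iff)
    then have "i < n" using p by (auto simp: permutes_def)
    moreover then have "p i < n" using p permutes_in_image[of p "{..<n}" i] by auto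
    ultimately have z: "(map (basis_vec R) xs ! i) (xs ! p i) = \<zero>"
      using i assms by (auto simp: basis_vec_def nth_eq_iff_index_eq)
    have bR: "(map (basis_vec R) xs ! k) x \<in> carrier R" if "k < n" for k x
      using that assms by (simp add: basis_vec_def)
    have "{..<n} = insert i ({..<n} - {i})" using \<open>i < n\<close> by auto
    then have "(\<Otimes>i\<in>{..<n}. (map (basis_vec R) xs ! i) (xs ! p i))
      = (\<Otimes>i\<in>insert i ({..<n} - {i}). (map (basis_vec R) xs ! i) (xs ! p i))" by simp
    also have "\<dots> = \<zero>" using bR z \<open>i < n\<close> by (subst finprod_insert) auto
    finally show ?thesis using False by simp
  qed
  then have "leibniz n xs (map (basis_vec R) xs) = (\<Oplus>p\<in>?P. if id = p then \<one> else \<zero>)"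
    unfolding leibniz_def by (intro finsum_cong') auto
  also have "\<dots> = \<one>"
    by (rule add.finprod_singleton) (auto simp: permutes_id finite_permutations)
  finally show ?thesis .
qed

text \<open>
  The determinant with respect to the increasing enumeration of \<open>S\<close>. As it takes the value \<open>1\<close> at the
  generator of \<open>Or S\<close>, that generator is a basis.
\<close>

lemma Or_functional:
  fixes S :: "'i::linorder set"
  assumes S: "finite S"
  obtains l where "l \<in> mod_hom R (Or R S) (regular_module R)" "l (top_wedge S) = \<one>"
proof -
  let ?n = "card S" and ?M = "free_module R S"
  let ?xs = "sorted_list_of_set S"
  let ?g = "leibniz ?n ?xs"
  let ?T = "tuples ?n (carrier ?M)"
  have "?g ms \<in> carrier R" if "ms \<in> ?T" for ms
  proof -
    have "(ms ! i) x \<in> carrier R" if "i < ?n" for i x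
    proof -
      have "ms ! i \<in> carrier (free_module R S)" using \<open>ms \<in> ?T\<close> that by (auto simp: tuples_def)
      then show ?thesis by (simp add: free_module_carrier)
    qed
    then show ?thesis unfolding leibniz_def by (intro finsum_closed) auto
  qed
  then have g: "?g \<in> ?T \<rightarrow> carrier R" by auto
  have multi: "(\<lambda>u. lin_ext ?g (basis_vec R (ms @ u # ms'))) \<in> mod_hom R ?M (regular_module R)"
    if *: "length ms + length ms' + 1 = ?n" "set ms \<subseteq> carrier ?M" "set ms' \<subseteq> carrier ?M" for ms ms'
  proof -
    have "lin_ext ?g (basis_vec R (ms @ u # ms')) = ?g (ms @ u # ms')" if "u \<in> carrier ?M" for u
      using * that by (intro lin_ext_basis_vec[OF g]) (auto simp: tuples_def)
    then show ?thesis
      by (rule mod_hom_cong[OF free_module_module leibniz_multilinear[OF *, of ?xs]])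
  qed
  have alt: "lin_ext ?g (basis_vec R ms) = \<zero>\<^bsub>regular_module R\<^esub>" if "ms \<in> ?T" "\<not> distinct ms" for ms
    using lin_ext_basis_vec[OF g that(1)] leibniz_alternating[OF that] by simp
  note l = ext_power_lift[OF free_module_module regular_module_module lin_ext_hom[OF g] multi alt]
  show thesis
  proof (rule that)
    show "(\<lambda>A. the_elem (lin_ext ?g ` A)) \<in> mod_hom R (Or R S) (regular_module R)" unfolding Or_def by (rule l(1))
    have t: "map (basis_vec R) ?xs \<in> ?T" using S basis_vec_closed by (auto simp: tuples_def)
    have "the_elem (lin_ext ?g ` top_wedge S) = lin_ext ?g (basis_vec R (map (basis_vec R) ?xs))"
      unfolding top_wedge_def by (rule l(2)[OF _ _ _ _ _ t])
    also have "\<dots> = \<one>" using lin_ext_basis_vec[OF g t] leibniz_basis[of ?xs ?n] S by simp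
    finally show "the_elem (lin_ext ?g ` top_wedge S) = \<one>" .
  qed
qed

lemma prepend_basis_vec: "prepend R m (basis_vec R ms) = basis_vec R (m # ms)"
  by (auto simp: prepend_def basis_vec_def fun_eq_iff neq_Nil_conv)

lemma prepend_hom:
  assumes "C \<subseteq> C'" "m \<in> C'"
  shows "prepend R m \<in> mod_hom R (free_module R (tuples n C)) (free_module R (tuples (Suc n) C'))"
proof (rule mod_homI)
  fix u assume u: "u \<in> carrier (free_module R (tuples n C))"
  have "{ms. prepend R m u ms \<noteq> \<zero>} \<subseteq> (#) m ` {ms. u ms \<noteq> \<zero>}"
    by (auto simp: prepend_def image_iff neq_Nil_conv split: if_splits)
  then have "finite {ms. prepend R m u ms \<noteq> \<zero>}" using u by (auto simp: free_module_carrier intro: finite_subset)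
  moreover have "prepend R m u ms = \<zero>" if "ms \<notin> tuples (Suc n) C'" for ms
  proof -
    have "tl ms \<notin> tuples n C" if "ms \<noteq> []" "hd ms = m" using that \<open>ms \<notin> _\<close> assms
      by (cases ms) (auto simp: tuples_def)
    then show ?thesis using u by (auto simp: prepend_def free_module_carrier)
  qed
  ultimately show "prepend R m u \<in> carrier (free_module R (tuples (Suc n) C'))"
    using u by (auto simp: free_module_carrier) (simp add: prepend_def)
qed (auto simp: prepend_def fun_eq_iff)

lemma free_module_mono: "S \<subseteq> T \<Longrightarrow> carrier (free_module R S) \<subseteq> carrier (free_module R T)"
  by (rule subsetI) (simp add: free_module_carrier subset_iff, blast)

lemma mod_hom_free_module_mono:
  "S \<subseteq> T \<Longrightarrow> h \<in> mod_hom R (free_module R T) P \<Longrightarrow> h \<in> mod_hom R (free_module R S) P"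
  using free_module_mono[of S T] by (simp add: mod_hom_def Pi_iff subset_iff)

text \<open>
  Prepending \<open>y\<close> to tuples maps relations to relations, because it keeps multilinearity in the other
  entries and repeated entries. The union in the definition of \<open>wedge_left\<close> is thus a union of equal
  cosets. Moving \<open>y\<close> to its place in the increasing wedge costs one sign for each smaller element.
\<close>

lemma Or_wedge_hom:
  fixes S :: "'i::linorder set"
  assumes S: "finite S" and y: "y \<notin> S"
  shows "Or_wedge R S y \<in> mod_hom R (Or R S) (Or R (insert y S))"
    and "Or_wedge R S y (top_wedge S) = of_integer ((-1) ^ card {z\<in>S. z < y}) \<odot>\<^bsub>Or R (insert y S)\<^esub> top_wedge (insert y S)"
proof -
  let ?n = "card S" and ?M = "free_module R S" and ?M' = "free_module R (insert y S)"
  let ?e = "basis_vec R y"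
  let ?F' = "free_module R (tuples (Suc ?n) (carrier ?M'))"
  let ?N' = "ext_rels R (Suc ?n) ?M'"
  let ?E' = "ext_power R (Suc ?n) ?M'"
  define L where "L \<phi> = ?N' +>\<^bsub>?F'\<^esub> prepend R ?e \<phi>" for \<phi>
  have Or': "Or R (insert y S) = ?E'" using S y by (simp add: Or_def)
  have sub: "carrier ?M \<subseteq> carrier ?M'" by (intro free_module_mono) auto
  have e: "?e \<in> carrier ?M'" by (intro basis_vec_closed) simp
  note P = ext_power_module[OF free_module_module, of "Suc ?n" "insert y S"]
  have L: "L \<in> mod_hom R (free_module R (tuples ?n (carrier ?M))) ?E'"
    unfolding L_def ext_power_def
    by (rule mod_hom_comp[OF prepend_hom[OF sub e] coset_hom[OF free_module_module ext_rels_submodule[OF free_module_module]]])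
  have Lb: "L (basis_vec R ms) = wedge_class (Suc ?n) ?M' (?e # ms)" for ms
    by (simp add: L_def prepend_basis_vec wedge_class_def)
  have multi: "(\<lambda>u. L (basis_vec R (ms @ u # ms'))) \<in> mod_hom R ?M ?E'"
    if "length ms + length ms' + 1 = ?n" "set ms \<subseteq> carrier ?M" "set ms' \<subseteq> carrier ?M" for ms ms'
    unfolding Lb append_Cons[symmetric]
  proof (rule mod_hom_free_module_mono[OF subset_insertI[of S y]], rule wedge_class_multilinear[OF free_module_module])
  qed (use that sub e in auto)
  have alt: "L (basis_vec R ms) = \<zero>\<^bsub>?E'\<^esub>" if "ms \<in> tuples ?n (carrier ?M)" "\<not> distinct ms" for ms
    unfolding Lb using that sub e by (intro wedge_class_nondistinct[OF free_module_module]) (auto simp: tuples_def)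
  note l = ext_power_lift[OF free_module_module P L multi alt]
  have W: "Or_wedge R S y \<alpha> = the_elem (L ` \<alpha>)" if "\<alpha> \<in> carrier (Or R S)" for \<alpha>
  proof -
    have "L ` \<alpha> = {the_elem (L ` \<alpha>)}" by (rule l(3)[OF _ _ _ _ _ that[unfolded Or_def]])
    then have "\<Union> (L ` \<alpha>) = the_elem (L ` \<alpha>)" by (metis ccpo_Sup_singleton)
    then show ?thesis by (simp add: Or_wedge_def wedge_left_def L_def)
  qed
  have lh: "(\<lambda>A. the_elem (L ` A)) \<in> mod_hom R (Or R S) (Or R (insert y S))"
    unfolding Or' unfolding Or_def by (rule l(1))
  interpret O: module R "Or R S" by (rule Or_module)
  show "Or_wedge R S y \<in> mod_hom R (Or R S) (Or R (insert y S))"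
    by (rule mod_hom_cong[OF Or_module lh W])
  let ?xs = "sorted_list_of_set S"
  have t: "map (basis_vec R) ?xs \<in> tuples ?n (carrier ?M)" using S basis_vec_closed by (auto simp: tuples_def)
  have "Or_wedge R S y (top_wedge S) = the_elem (L ` top_wedge S)" using W top_wedge_closed[OF S] by simp
  also have "\<dots> = L (basis_vec R (map (basis_vec R) ?xs))" unfolding top_wedge_def by (rule l(2)[OF _ _ _ _ _ t])
  also have "\<dots> = wedge_class (Suc ?n) ?M' ([] @ ?e # map (basis_vec R) ?xs)" by (simp add: Lb)
  also have "\<dots> = of_integer ((-1) ^ length (filter (\<lambda>z. z < y) ?xs)) \<odot>\<^bsub>?E'\<^esub>
      wedge_class (Suc ?n) ?M' ([] @ map (basis_vec R) (insort y ?xs))"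
    using S e by (intro wedge_insort[OF free_module_module]) (auto intro: basis_vec_closed)
  also have "insort y ?xs = sorted_list_of_set (insert y S)" using S y by simp
  also have "length (filter (\<lambda>z. z < y) ?xs) = card {z\<in>S. z < y}"
    using S distinct_card[of "filter (\<lambda>z. z < y) ?xs"] by (simp add: set_filter)
  finally show "Or_wedge R S y (top_wedge S) = of_integer ((-1) ^ card {z\<in>S. z < y}) \<odot>\<^bsub>Or R (insert y S)\<^esub> top_wedge (insert y S)"
    unfolding Or' using S y by (simp add: top_wedge_def)
qed

end

section \<open>The word complex over an arbitrary commutative ring\<close>

context cring begin

definition mat_act :: "('w \<Rightarrow> 'v \<Rightarrow> int) \<Rightarrow> 'v set \<Rightarrow> 'w set \<Rightarrow> ('v \<Rightarrow> 'a) \<Rightarrow> 'w \<Rightarrow> 'a" where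
  "mat_act A S T u w = (if w \<in> T then \<Oplus>v\<in>S. of_integer (A w v) \<otimes> u v else \<zero>)"

lemma mat_act_hom:
  assumes "finite S" "finite T"
  shows "mat_act A S T \<in> mod_hom R (free_module R S) (free_module R T)"
proof (rule mod_homI)
  note h = weighted_evaluation_hom[OF assms(1), where y = "\<lambda>v. v" and S = S, of "\<lambda>v. of_integer (A w v)" for w, simplified]
  fix u assume u: "u \<in> carrier (free_module R S)"
  show "mat_act A S T u \<in> carrier (free_module R T)"
    using mod_homD(1)[OF h u] assms(2) by (auto simp: free_module_carrier mat_act_def intro: finite_subset[of _ T])
  show "mat_act A S T (u \<oplus>\<^bsub>free_module R S\<^esub> v) = mat_act A S T u \<oplus>\<^bsub>free_module R T\<^esub> mat_act A S T v"
    if "v \<in> carrier (free_module R S)" for v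
    using mod_homD(2)[OF h u that] by (auto simp: mat_act_def fun_eq_iff)
  show "mat_act A S T (r \<odot>\<^bsub>free_module R S\<^esub> u) = r \<odot>\<^bsub>free_module R T\<^esub> mat_act A S T u"
    if "r \<in> carrier R" for r
    using mod_homD(3)[OF h u that] that by (auto simp: mat_act_def fun_eq_iff)
qed

text \<open>
  Evaluating an integer matrix at a vector of this shape stays among such vectors, so identities
  between integer matrices can be verified over \<open>R\<close> on basis vectors.
\<close>

definition int_vec :: "'v set \<Rightarrow> ('v \<Rightarrow> int) \<Rightarrow> 'v \<Rightarrow> 'a" where
  "int_vec S c v = (if v \<in> S then of_integer (c v) else \<zero>)"

lemma int_vec_closed: "finite S \<Longrightarrow> int_vec S c \<in> carrier (free_module R S)"
  by (auto simp: int_vec_def free_module_carrier intro: finite_subset[of _ S])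

lemma finsum_int_vec: "(\<Oplus>v\<in>S. of_integer (r v) \<otimes> int_vec S c v) = of_integer (\<Sum>v\<in>S. r v * c v)"
  unfolding of_integer_sum by (intro finsum_cong') (auto simp: int_vec_def of_integer_mult)

lemma mat_act_int_vec: "mat_act A S T (int_vec S c) = int_vec T (\<lambda>w. \<Sum>v\<in>S. A w v * c v)"
  by (rule ext) (simp add: mat_act_def finsum_int_vec, simp add: int_vec_def)

lemma basis_vec_int_vec: "v \<in> S \<Longrightarrow> basis_vec R v = int_vec S (delta v)"
  by (auto simp: basis_vec_def int_vec_def delta_def)

lemma mat_act_basis_vec:
  assumes "finite S" "v \<in> S" shows "mat_act A S T (basis_vec R v) = int_vec T (\<lambda>w. A w v)"
proof -
  have "(\<Sum>x\<in>S. A w x * delta v x) = A w v" for w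
  proof -
    have "A w x * delta v x = (if x = v then A w v else 0)" for x by (simp add: delta_def)
    then show ?thesis using assms by simp
  qed
  then show ?thesis unfolding basis_vec_int_vec[OF assms(2)] mat_act_int_vec by simp
qed

context
  fixes a b :: nat
begin

abbreviation (input) "word_module t \<equiv> free_module R (words b a t)"

definition bd_R :: "nat \<Rightarrow> ((nat \<Rightarrow> nat) \<Rightarrow> 'a) \<Rightarrow> (nat \<Rightarrow> nat) \<Rightarrow> 'a" where
  "bd_R t = mat_act (\<lambda>w v. bd b a t (delta v) w) (words b a t) (words b a (Suc t))"

definition top_R :: "nat \<Rightarrow> ((nat \<Rightarrow> nat) \<Rightarrow> 'a) \<Rightarrow> 'a" where
  "top_R t u = (\<Oplus>v\<in>words b a t. of_integer (top_functional b a t (delta v)) \<otimes> u v)"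

lemma bd_R_hom: "bd_R t \<in> mod_hom R (word_module t) (word_module (Suc t))"
  unfolding bd_R_def by (intro mat_act_hom) simp_all

lemma top_R_hom: "top_R t \<in> mod_hom R (word_module t) (regular_module R)"
  unfolding top_R_def by (intro weighted_evaluation_hom) simp_all

lemma bd_R_basis_vec: "w \<in> words b a t \<Longrightarrow> bd_R t (basis_vec R w) = int_vec (words b a (Suc t)) (bd b a t (delta w))"
  by (simp add: bd_R_def mat_act_basis_vec)

lemma bd_R_int_vec:
  assumes "supported (words b a t) c"
  shows "bd_R t (int_vec (words b a t) c) = int_vec (words b a (Suc t)) (bd b a t c)"
proof -
  have "bd b a t c = (\<lambda>w. \<Sum>v\<in>words b a t. bd b a t (delta v) w * c v)"
    by (rule ext) (simp only: bd_expand[OF assms] mult.commute)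
  then show ?thesis by (simp only: bd_R_def mat_act_int_vec)
qed

lemma top_R_int_vec:
  assumes "supported (words b a t) c"
  shows "top_R t (int_vec (words b a t) c) = of_integer (top_functional b a t c)"
  unfolding top_R_def finsum_int_vec top_functional_expand[OF assms] by (simp only: mult.commute)

lemma top_R_bd_R:
  assumes "u \<in> carrier (word_module t)" shows "top_R (Suc t) (bd_R t u) = \<zero>"
proof (rule hom_eq_on_generators[OF free_module_module regular_module_module mod_hom_comp[OF bd_R_hom top_R_hom] _ free_module_generated _ assms])
  show "(\<lambda>_. \<zero>) \<in> mod_hom R (word_module t) (regular_module R)" by (intro mod_homI) auto
  show "top_R (Suc t) (bd_R t x) = \<zero>" if "x \<in> basis_vec R ` words b a t" for x
    using that by (auto simp: bd_R_basis_vec top_R_int_vec supported_bd top_functional_bd)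
qed

lemma bd_R_bd_R:
  assumes "u \<in> carrier (word_module t)" shows "bd_R (Suc t) (bd_R t u) = (\<lambda>_. \<zero>)"
proof (rule hom_eq_on_generators[OF free_module_module free_module_module mod_hom_comp[OF bd_R_hom bd_R_hom] _ free_module_generated _ assms])
  show "(\<lambda>_ _. \<zero>) \<in> mod_hom R (word_module t) (word_module (Suc (Suc t)))" by (intro mod_homI) (auto simp: free_module_carrier)
  show "bd_R (Suc t) (bd_R t x) = (\<lambda>_. \<zero>)" if "x \<in> basis_vec R ` words b a t" for x
    using that by (auto simp: bd_R_basis_vec bd_R_int_vec supported_bd bd_bd) (simp add: int_vec_def fun_eq_iff)
qed

lemma top_R_other_degree:
  assumes "u \<in> carrier (word_module t)" "t + a \<noteq> b" shows "top_R t u = \<zero>"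
proof (rule hom_eq_on_generators[OF free_module_module regular_module_module top_R_hom _ free_module_generated _ assms(1)])
  show "(\<lambda>_. \<zero>) \<in> mod_hom R (word_module t) (regular_module R)" by (intro mod_homI) auto
  show "top_R t x = \<zero>" if x: "x \<in> basis_vec R ` words b a t" for x
  proof -
    obtain w where w: "w \<in> words b a t" "x = basis_vec R w" using x by auto
    then have "top_functional b a t (delta w) = 0" using assms(2) by (intro top_functional_other_degree supported_delta)
    then show ?thesis using w by (simp add: basis_vec_int_vec[OF w(1)] top_R_int_vec supported_delta)
  qed
qed

context
  assumes ab: "a < b"
begin

lemma top_R_onto: "\<exists>u\<in>carrier (word_module (b - a)). top_R (b - a) u = \<one>"
proof -
  obtain k where "supported (words b a (b - a)) k" "top_functional b a (b - a) k = 1"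
    using top_class_exists[of a "b - a" b] ab by auto
  then show ?thesis
    by (intro bexI[of _ "int_vec (words b a (b - a)) k"]) (simp_all add: top_R_int_vec int_vec_closed)
qed

text \<open>
  The base change of \<open>integral_splitting\<close>, phrased for cocycles.
\<close>

lemma splitting_R:
  obtains h where
    "\<And>t. h t \<in> mod_hom R (word_module (Suc t)) (word_module t)"
    "\<And>t u. u \<in> carrier (word_module (Suc t)) \<Longrightarrow> bd_R (Suc t) u = (\<lambda>_. \<zero>) \<Longrightarrow> top_R (Suc t) u = \<zero> \<Longrightarrow> u = bd_R t (h t u)"
    "\<And>u. u \<in> carrier (free_module R (pivots b a 0)) \<Longrightarrow> h 0 (bd_R 0 u) = u"
    "\<And>u w. u \<in> carrier (word_module (Suc 0)) \<Longrightarrow> w \<notin> pivots b a 0 \<Longrightarrow> h 0 u w = \<zero>"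
proof (rule integral_splitting[OF ab])
  fix h :: "nat \<Rightarrow> (nat \<Rightarrow> nat) \<Rightarrow> (nat \<Rightarrow> nat) \<Rightarrow> int" and k :: "(nat \<Rightarrow> nat) \<Rightarrow> int"
  assume H:
    "\<And>t w w'. w \<in> words b a (Suc t) \<Longrightarrow> w' \<in> words b a (Suc t) \<Longrightarrow>
       (\<Sum>v\<in>words b a t. bd b a t (delta v) w * h t v w') +
       (\<Sum>v\<in>words b a (Suc (Suc t)). h (Suc t) w v * bd b a (Suc t) (delta w') v) +
       k w * top_functional b a (Suc t) (delta w') = delta w' w"
    "\<And>w w'. w \<in> words b a 0 \<Longrightarrow> w' \<in> pivots b a 0 \<Longrightarrow>
       (\<Sum>v\<in>words b a (Suc 0). h 0 w v * bd b a 0 (delta w') v) = delta w' w"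
    "\<And>w w'. w \<notin> pivots b a 0 \<Longrightarrow> h 0 w w' = 0"
  define hR where "hR t = mat_act (h t) (words b a (Suc t)) (words b a t)" for t
  have hR: "hR t \<in> mod_hom R (word_module (Suc t)) (word_module t)" for t unfolding hR_def by (intro mat_act_hom) simp_all
  define kR where "kR t u = (\<lambda>w. int_vec (words b a t) k w \<otimes> top_R t u)" for t u
  have kR: "kR t \<in> mod_hom R (word_module t) (word_module t)" for t
    using int_vec_closed[OF finite_words, of b a t k] mod_homD[OF top_R_hom, of _ t]
    by (intro mod_homI) (auto simp: kR_def free_module_carrier fun_eq_iff r_distr m_lcomm r_null elim: rev_finite_subset)
  show thesis
  proof (rule that[of hR])
    show "hR t \<in> mod_hom R (word_module (Suc t)) (word_module t)" for t by (rule hR)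
    show "u = bd_R t (hR t u)"
      if u: "u \<in> carrier (word_module (Suc t))" "bd_R (Suc t) u = (\<lambda>_. \<zero>)" "top_R (Suc t) u = \<zero>" for t u
    proof -
      let ?W = "words b a (Suc t)"
      let ?G = "\<lambda>u w. bd_R t (hR t u) w \<oplus> hR (Suc t) (bd_R (Suc t) u) w \<oplus> kR (Suc t) u w"
      note h1 = mod_hom_comp[OF hR bd_R_hom, of t] and h2 = mod_hom_comp[OF bd_R_hom hR, of "Suc t"]
      interpret F: module R "word_module (Suc t)" by (rule free_module_module)
      have G: "?G = (\<lambda>u. bd_R t (hR t u) \<oplus>\<^bsub>word_module (Suc t)\<^esub> hR (Suc t) (bd_R (Suc t) u) \<oplus>\<^bsub>word_module (Suc t)\<^esub> kR (Suc t) u)"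
        by simp
      \<comment> \<open>The homotopy identity is linear in the vector, so it is checked on basis vectors.\<close>
      have "?G \<in> mod_hom R (word_module (Suc t)) (word_module (Suc t))"
        unfolding G
        using mod_homD[OF h1] mod_homD[OF h2] mod_homD[OF kR, of _ "Suc t"]
        by (intro mod_homI) (simp_all add: F.a_ac F.smult_r_distr del: free_module_simps)
      moreover have "(\<lambda>u. u) \<in> mod_hom R (word_module (Suc t)) (word_module (Suc t))" by (intro mod_homI) auto
      moreover have "?G x = x" if x: "x \<in> basis_vec R ` ?W" for x
      proof -
        obtain w' where w': "w' \<in> ?W" "x = basis_vec R w'" using x by auto
        have e1: "bd_R t (hR t x) = int_vec ?W (\<lambda>w. \<Sum>v\<in>words b a t. bd b a t (delta v) w * h t v w')"
          unfolding w'(2) hR_def bd_R_def by (simp add: mat_act_basis_vec w' mat_act_int_vec)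
        have e2: "hR (Suc t) (bd_R (Suc t) x) = int_vec ?W (\<lambda>w. \<Sum>v\<in>words b a (Suc (Suc t)). h (Suc t) w v * bd b a (Suc t) (delta w') v)"
          unfolding w'(2) bd_R_basis_vec[OF w'(1)] hR_def by (simp add: mat_act_int_vec)
        have e3: "top_R (Suc t) x = of_integer (top_functional b a (Suc t) (delta w'))"
          unfolding w'(2) basis_vec_int_vec[OF w'(1)] by (simp add: top_R_int_vec supported_delta w')
        have "?G x w = int_vec ?W (delta w') w" for w
          unfolding e1 e2 kR_def e3 using H(1)[OF _ w'(1), of w]
          by (cases "w \<in> ?W") (simp_all add: int_vec_def flip: of_integer_add of_integer_mult)
        then show ?thesis using basis_vec_int_vec[OF w'(1)] w'(2) by auto
      qed
      ultimately have "?G u = u"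
        using hom_eq_on_generators[where h = ?G and h' = "\<lambda>u. u", OF free_module_module free_module_module _ _ free_module_generated _ u(1)] by blast
      moreover have "hR (Suc t) (bd_R (Suc t) u) = (\<lambda>_. \<zero>)"
        unfolding u(2) using hom_zero[OF free_module_module free_module_module hR] by simp
      moreover have "bd_R t (hR t u) w \<in> carrier R" "int_vec ?W k w \<in> carrier R" for w
        using mod_homD(1)[OF h1 u(1)] int_vec_closed[OF finite_words, of b a "Suc t" k] by (simp_all add: free_module_carrier)
      ultimately show ?thesis unfolding kR_def u(3) by (simp add: fun_eq_iff)
    qed
    show "hR 0 u w = \<zero>" if "u \<in> carrier (word_module (Suc 0))" "w \<notin> pivots b a 0" for u w
      using that(1) H(3)[OF that(2)] by (auto simp: hR_def mat_act_def free_module_carrier intro: add.finprod_one_eqI)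
    show "hR 0 (bd_R 0 u) = u" if u: "u \<in> carrier (free_module R (pivots b a 0))" for u
    proof (rule hom_eq_on_generators[OF free_module_module free_module_module _ _ free_module_generated _ u])
      show "(\<lambda>u. hR 0 (bd_R 0 u)) \<in> mod_hom R (free_module R (pivots b a 0)) (word_module 0)"
        by (rule mod_hom_free_module_mono[OF pivots_words mod_hom_comp[OF bd_R_hom hR]])
      show "(\<lambda>u. u) \<in> mod_hom R (free_module R (pivots b a 0)) (word_module 0)"
        by (rule mod_hom_free_module_mono[OF pivots_words]) (auto intro: mod_homI)
      show "hR 0 (bd_R 0 x) = x" if x: "x \<in> basis_vec R ` pivots b a 0" for x
      proof -
        obtain w' where w': "w' \<in> pivots b a 0" "x = basis_vec R w'" using x by auto
        then have w'': "w' \<in> words b a 0" using pivots_words[of b a 0] by auto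
        have "hR 0 (bd_R 0 x) = int_vec (words b a 0) (\<lambda>w. \<Sum>v\<in>words b a (Suc 0). h 0 w v * bd b a 0 (delta w') v)"
          unfolding w'(2) bd_R_basis_vec[OF w''] hR_def by (simp add: mat_act_int_vec)
        also have "\<dots> = int_vec (words b a 0) (delta w')"
          using H(2)[OF _ w'(1)] by (auto simp: int_vec_def fun_eq_iff)
        finally show ?thesis unfolding w'(2) basis_vec_int_vec[OF w''] .
      qed
    qed
  qed
qed

lemma bd_R_exact:
  assumes "u \<in> carrier (word_module (Suc t))" "bd_R (Suc t) u = (\<lambda>_. \<zero>)" "top_R (Suc t) u = \<zero>"
  shows "\<exists>v\<in>carrier (word_module t). u = bd_R t v"
proof (rule splitting_R)
  fix h assume h:
    "\<And>t. h t \<in> mod_hom R (word_module (Suc t)) (word_module t)"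
    "\<And>t u. u \<in> carrier (word_module (Suc t)) \<Longrightarrow> bd_R (Suc t) u = (\<lambda>_. \<zero>) \<Longrightarrow> top_R (Suc t) u = \<zero> \<Longrightarrow> u = bd_R t (h t u)"
    "\<And>u. u \<in> carrier (free_module R (pivots b a 0)) \<Longrightarrow> h 0 (bd_R 0 u) = u"
    "\<And>u w. u \<in> carrier (word_module (Suc 0)) \<Longrightarrow> w \<notin> pivots b a 0 \<Longrightarrow> h 0 u w = \<zero>"
  show ?thesis using h(2)[OF assms] mod_homD(1)[OF h(1) assms(1)] by blast
qed

lemma closed_R_zero:
  assumes "u \<in> carrier (word_module 0)" "bd_R 0 u = (\<lambda>_. \<zero>)" "\<And>w. w \<in> words b a 0 - pivots b a 0 \<Longrightarrow> u w = \<zero>"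
  shows "u = (\<lambda>_. \<zero>)"
proof (rule splitting_R)
  fix h assume h:
    "\<And>t. h t \<in> mod_hom R (word_module (Suc t)) (word_module t)"
    "\<And>t u. u \<in> carrier (word_module (Suc t)) \<Longrightarrow> bd_R (Suc t) u = (\<lambda>_. \<zero>) \<Longrightarrow> top_R (Suc t) u = \<zero> \<Longrightarrow> u = bd_R t (h t u)"
    "\<And>u. u \<in> carrier (free_module R (pivots b a 0)) \<Longrightarrow> h 0 (bd_R 0 u) = u"
    "\<And>u w. u \<in> carrier (word_module (Suc 0)) \<Longrightarrow> w \<notin> pivots b a 0 \<Longrightarrow> h 0 u w = \<zero>"
  have "u \<in> carrier (free_module R (pivots b a 0))" using assms(1,3) by (auto simp: free_module_carrier)
  then have "u = h 0 (\<lambda>_. \<zero>)" using h(3) assms(2) by metis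
  then show ?thesis using hom_zero[OF free_module_module free_module_module h(1)[of 0]] by simp
qed

text \<open>
  Subtracting \<open>h (d r)\<close> makes \<open>r\<close> closed and changes it only at pivots.
\<close>

lemma closed_R_extension:
  assumes r: "r \<in> carrier (word_module 0)"
  shows "\<exists>u\<in>carrier (word_module 0). bd_R 0 u = (\<lambda>_. \<zero>) \<and> (\<forall>w\<in>words b a 0 - pivots b a 0. u w = r w)"
proof (rule splitting_R)
  fix h assume h:
    "\<And>t. h t \<in> mod_hom R (word_module (Suc t)) (word_module t)"
    "\<And>t u. u \<in> carrier (word_module (Suc t)) \<Longrightarrow> bd_R (Suc t) u = (\<lambda>_. \<zero>) \<Longrightarrow> top_R (Suc t) u = \<zero> \<Longrightarrow> u = bd_R t (h t u)"
    "\<And>u. u \<in> carrier (free_module R (pivots b a 0)) \<Longrightarrow> h 0 (bd_R 0 u) = u"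
    "\<And>u w. u \<in> carrier (word_module (Suc 0)) \<Longrightarrow> w \<notin> pivots b a 0 \<Longrightarrow> h 0 u w = \<zero>"
  interpret F: module R "word_module 0" by (rule free_module_module)
  interpret F1: module R "word_module (Suc 0)" by (rule free_module_module)
  let ?d = "bd_R 0 r"
  let ?p = "h 0 ?d"
  have d: "?d \<in> carrier (word_module (Suc 0))" using mod_homD(1)[OF bd_R_hom r] .
  then have p: "?p \<in> carrier (word_module 0)" using mod_homD(1)[OF h(1)] by blast
  have "?d = bd_R 0 ?p" by (intro h(2) d bd_R_bd_R r top_R_bd_R)
  then have "bd_R 0 (r \<ominus>\<^bsub>word_module 0\<^esub> ?p) = \<zero>\<^bsub>word_module (Suc 0)\<^esub>"
    using hom_minus[OF free_module_module free_module_module bd_R_hom r p] d by (simp add: a_minus_def F1.r_neg del: free_module_simps)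
  moreover have "(r \<ominus>\<^bsub>word_module 0\<^esub> ?p) w = r w" if "w \<in> words b a 0 - pivots b a 0" for w
  proof -
    have "r = (r \<ominus>\<^bsub>word_module 0\<^esub> ?p) \<oplus>\<^bsub>word_module 0\<^esub> ?p" using r p by (simp add: a_minus_def F.a_assoc F.l_neg del: free_module_simps)
    then have "r w = (r \<ominus>\<^bsub>word_module 0\<^esub> ?p) w \<oplus> ?p w" by (metis free_module_simps(2))
    then show ?thesis using h(4)[OF d] that F.minus_closed[OF r p] by (simp add: free_module_carrier)
  qed
  ultimately show ?thesis using F.minus_closed[OF r p] by (intro bexI[of _ "r \<ominus>\<^bsub>word_module 0\<^esub> ?p"]) auto
qed

end

end

end

section \<open>Words and surjections\<close>

definition word_of :: "nat set \<Rightarrow> (nat \<Rightarrow> nat) \<Rightarrow> nat \<Rightarrow> nat" where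
  "word_of T f = (\<lambda>i. if i \<in> T then f i else 0)"

definition supp :: "(nat \<Rightarrow> nat) \<Rightarrow> nat set" where
  "supp w = {i. w i \<noteq> 0}"

lemma finite_layer [simp]: "finite (layer b t)"
  by (rule finite_subset[of _ "Pow {1..b}"]) (auto simp: layer_def)

lemma finite_surjs: "finite S \<Longrightarrow> finite A \<Longrightarrow> finite (surjs S A)"
  by (rule finite_subset[of _ "S \<rightarrow>\<^sub>E A"]) (auto simp: surjs_def intro: finite_PiE)

lemma word_of_supp_restrict: "word_of (supp w) (restrict w (supp w)) = w"
  by (auto simp: word_of_def supp_def)

lemma surjs_pos: "f \<in> surjs T {1..a} \<Longrightarrow> i \<in> T \<Longrightarrow> f i \<noteq> (0 :: nat)"
  by (auto simp: surjs_def dest!: PiE_mem)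

lemma supp_word_of: "f \<in> surjs T {1..a} \<Longrightarrow> supp (word_of T f) = T"
  using surjs_pos[of f T a] by (auto simp: supp_def word_of_def)

lemma restrict_word_of: "f \<in> surjs T A \<Longrightarrow> restrict (word_of T f) T = f"
  by (auto simp: word_of_def surjs_def fun_eq_iff PiE_iff extensional_def)

lemma layer_D: "T \<in> layer b t \<Longrightarrow> T \<subseteq> {1..b} \<and> finite T \<and> card T + t = b"
  by (auto simp: layer_def intro: finite_subset)

lemma zeros_word_of: "f \<in> surjs T {1..a} \<Longrightarrow> zeros b (word_of T f) = {1..b} - T"
  using surjs_pos[of f T a] by (force simp: zeros_def word_of_def)

lemma word_of_words:
  assumes T: "T \<in> layer b t" and f: "f \<in> surjs T {1..a}"
  shows "word_of T f \<in> words b a t"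
proof -
  have "card (zeros b (word_of T f)) = t"
    using layer_D[OF T] unfolding zeros_word_of[OF f] by (subst card_Diff_subset) auto
  moreover have "\<exists>i. word_of T f i = x" if "x \<in> {1..a}" for x
  proof -
    have "x \<in> f ` T" using f that by (simp add: surjs_def)
    then show ?thesis by (auto simp: word_of_def)
  qed
  moreover have "f i \<le> a" if "i \<in> T" for i using f that by (auto simp: surjs_def PiE_iff)
  ultimately show ?thesis using layer_D[OF T] by (auto simp: words_def word_of_def)
qed

lemma supp_words:
  assumes w: "w \<in> words b a t"
  shows "supp w \<in> layer b t" "restrict w (supp w) \<in> surjs (supp w) {1..a}" "zeros b w = {1..b} - supp w"
proof -
  have out: "w i = 0" if "i \<notin> {1..b}" for i using w that by (simp add: words_def)
  have le: "w i \<le> a" for i using w by (simp add: words_def)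
  have sub: "supp w \<subseteq> {1..b}" using out by (force simp: supp_def)
  show z: "zeros b w = {1..b} - supp w" by (auto simp: zeros_def supp_def)
  have "card (supp w) + card (zeros b w) = card {1..b}"
    unfolding z using sub by (metis card_Diff_subset finite_subset finite_atLeastAtMost card_mono le_add_diff_inverse)
  then show "supp w \<in> layer b t" using w sub by (simp add: layer_def words_def)
  have "w ` supp w = {1..a}"
  proof
    show "w ` supp w \<subseteq> {1..a}" using le by (auto simp: supp_def Suc_le_eq)
    show "{1..a} \<subseteq> w ` supp w"
    proof
      fix x assume x: "x \<in> {1..a}"
      then obtain i where "w i = x" using w unfolding words_def by blast
      then show "x \<in> w ` supp w" using x by (auto simp: supp_def)
    qed
  qed
  then show "restrict w (supp w) \<in> surjs (supp w) {1..a}" by (auto simp: surjs_def)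
qed

lemma word_of_eq_iff:
  assumes "f \<in> surjs T {1..a}"
  shows "w = word_of T f \<longleftrightarrow> supp w = T \<and> restrict w T = f"
proof
  assume "w = word_of T f"
  then show "supp w = T \<and> restrict w T = f" using supp_word_of[OF assms] restrict_word_of[OF assms] by simp
next
  assume "supp w = T \<and> restrict w T = f"
  then show "w = word_of T f" using word_of_supp_restrict[of w] by auto
qed

lemma bij_words_surjs:
  "bij_betw (\<lambda>(T, f). word_of T f) (SIGMA T:layer b t. surjs T {1..a}) (words b a t)"
proof (rule bij_betw_byWitness[where f' = "\<lambda>w. (supp w, restrict w (supp w))"])
  show "\<forall>p\<in>SIGMA T:layer b t. surjs T {1..a}. (\<lambda>w. (supp w, restrict w (supp w))) (case p of (T, f) \<Rightarrow> word_of T f) = p"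
  proof
    fix p assume "p \<in> (SIGMA T:layer b t. surjs T {1..a})"
    then obtain T f where "p = (T, f)" "f \<in> surjs T {1..a}" by blast
    then show "(\<lambda>w. (supp w, restrict w (supp w))) (case p of (T, f) \<Rightarrow> word_of T f) = p"
      using supp_word_of[of f T a] restrict_word_of[of f T "{1..a}"] by simp
  qed
  show "\<forall>w\<in>words b a t. (case (supp w, restrict w (supp w)) of (T, f) \<Rightarrow> word_of T f) = w"
    by (simp only: prod.case word_of_supp_restrict) simp
  show "(\<lambda>(T, f). word_of T f) ` (SIGMA T:layer b t. surjs T {1..a}) \<subseteq> words b a t"
    by (auto intro: word_of_words simp del: One_nat_def)
  show "(\<lambda>w. (supp w, restrict w (supp w))) ` words b a t \<subseteq> (SIGMA T:layer b t. surjs T {1..a})"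
    using supp_words by blast
qed

lemma card_surjs_eq:
  assumes "finite T" "card T = m"
  shows "card (surjs T {1..a}) = card (surjs {1..m} {1..a})"
proof -
  obtain h where h: "bij_betw h {1..m} T"
    using ex_bij_betw_nat_finite_1[OF assms(1)] assms(2) by auto
  define g where "g = inv_into {1..m} h"
  have g: "bij_betw g T {1..m}" unfolding g_def by (rule bij_betw_inv_into[OF h])
  have gh: "g (h i) = i" if "i \<in> {1..m}" for i using that h by (simp add: g_def bij_betw_inv_into_left)
  have hg: "h (g i) = i" if "i \<in> T" for i using that h by (simp add: g_def bij_betw_inv_into_right)
  have hT: "h i \<in> T" if "i \<in> {1..m}" for i using h that by (auto simp: bij_betw_def)
  have gT: "g i \<in> {1..m}" if "i \<in> T" for i using g that by (auto simp: bij_betw_def)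
  have move: "restrict (\<lambda>i. f (k i)) S \<in> surjs S {1..a}" if f: "f \<in> surjs S' {1..a}" and k: "bij_betw k S S'" for f k S S'
  proof -
    have kS: "k ` S = S'" using k by (simp add: bij_betw_def)
    have "restrict (\<lambda>i. f (k i)) S ` S = f ` (k ` S)" by (auto simp: image_iff)
    also have "\<dots> = {1..a}" using f kS by (simp add: surjs_def)
    finally show ?thesis by (auto simp: surjs_def)
  qed
  have "bij_betw (\<lambda>f. restrict (\<lambda>i. f (h i)) {1..m}) (surjs T {1..a}) (surjs {1..m} {1..a})"
  proof (rule bij_betw_byWitness[where f' = "\<lambda>f. restrict (\<lambda>i. f (g i)) T"])
    show "\<forall>f\<in>surjs T {1..a}. restrict (\<lambda>i. restrict (\<lambda>i. f (h i)) {1..m} (g i)) T = f"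
      using gT hg by (auto simp: surjs_def fun_eq_iff PiE_iff extensional_def restrict_def)
    show "\<forall>f\<in>surjs {1..m} {1..a}. restrict (\<lambda>i. restrict (\<lambda>i. f (g i)) T (h i)) {1..m} = f"
      using hT gh by (auto simp: surjs_def fun_eq_iff PiE_iff extensional_def restrict_def)
  qed (use move[OF _ h] move[OF _ g] in auto)
  then show ?thesis by (rule bij_betw_same_card)
qed

lemma card_layer: "t \<le> b \<Longrightarrow> card (layer b t) = b choose t"
proof -
  assume t: "t \<le> b"
  have "layer b t = {T. T \<subseteq> {1..b} \<and> card T = b - t}" using t by (auto simp: layer_def)
  then have "card (layer b t) = b choose (b - t)" using n_subsets[of "{1..b}" "b - t"] by simp
  then show ?thesis using t by (simp add: binomial_symmetric[of t b])
qed

text \<open>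
  Choose the complement of the domain, of size \<open>t\<close>; the number of surjections depends only on the
  size of the domain.
\<close>

lemma card_words:
  assumes "t \<le> b"
  shows "card (words b a t) = (b choose t) * card (surjs {1..b - t} {1..a})"
proof -
  have fin: "\<forall>T\<in>layer b t. finite (surjs T {1..a})" using layer_D finite_surjs by blast
  have "card (words b a t) = card (SIGMA T:layer b t. surjs T {1..a})"
    using bij_betw_same_card[OF bij_words_surjs] by simp
  also have "\<dots> = (\<Sum>T\<in>layer b t. card (surjs T {1..a}))" using fin by (simp add: card_SigmaI)
  also have "\<dots> = (\<Sum>T\<in>layer b t. card (surjs {1..b - t} {1..a}))"
    using layer_D by (intro sum.cong refl card_surjs_eq) (blast, fastforce)
  finally show ?thesis using card_layer[OF assms] by simp
qed

lemma euler_char_words: "a < b \<Longrightarrow> surj_euler_char b a = (\<Sum>t=0..b - a. (-1) ^ t * int (card (words b a t)))"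
  unfolding surj_euler_char_def by (intro sum.cong refl) (simp add: card_words)

text \<open>
  In the Euler characteristic the pivots of positive degree cancel; there are none in degree \<open>b - a\<close>, as
  there are no words of higher degree.
\<close>

lemma Rk_eq:
  assumes "a < b" shows "Rk b a = int (card (words b a 0 - pivots b a 0))"
proof -
  obtain s where s: "b - a = Suc s" using assms by (metis Suc_diff_Suc)
  have "words b a (Suc (b - a)) = {}" using assms by (intro words_high_degree) simp
  then have "card (pivots b a (b - a)) = 0" using card_words_pivots[of b a "b - a"] assms by simp
  then have "Rk b a = int (card (words b a 0)) - int (card (pivots b a 0))"
    using assms sum_card_words[of b a "b - a"] by (simp add: Rk_def euler_char_words)
  also have "\<dots> = int (card (words b a 0 - pivots b a 0))"
    using card_mono[OF finite_words pivots_words[of b a 0]] finite_pivots[of b a 0] pivots_words[of b a 0]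
    by (simp add: card_Diff_subset of_nat_diff)
  finally show ?thesis .
qed

section \<open>The complex of surjections in coordinates\<close>

lemma generates_mono: "generates R M A \<Longrightarrow> A \<subseteq> B \<Longrightarrow> B \<subseteq> carrier M \<Longrightarrow> generates R M B"
  by (auto simp: generates_def)

context cring begin

lemma inverse_mod_hom:
  assumes h: "h \<in> mod_hom R M N" and bij: "bij_betw h (carrier M) (carrier N)" and M: "module R M"
  shows "inv_into (carrier M) h \<in> mod_hom R N M"
proof -
  interpret M: module R M by (rule M)
  let ?g = "inv_into (carrier M) h"
  have g: "?g y \<in> carrier M" "h (?g y) = y" if "y \<in> carrier N" for y
    using that bij by (auto simp: bij_betw_def inv_into_into f_inv_into_f)
  have gh: "?g (h x) = x" if "x \<in> carrier M" for x using that bij by (simp add: bij_betw_inv_into_left)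
  show ?thesis
  proof (rule mod_homI)
    fix u assume u: "u \<in> carrier N"
    then show "?g u \<in> carrier M" by (rule g)
    show "?g (u \<oplus>\<^bsub>N\<^esub> v) = ?g u \<oplus>\<^bsub>M\<^esub> ?g v" if "v \<in> carrier N" for v
      using gh[of "?g u \<oplus>\<^bsub>M\<^esub> ?g v"] g u that mod_homD(2)[OF h] by simp
    show "?g (r \<odot>\<^bsub>N\<^esub> u) = r \<odot>\<^bsub>M\<^esub> ?g u" if "r \<in> carrier R" for r
      using gh[of "r \<odot>\<^bsub>M\<^esub> ?g u"] g u that mod_homD(3)[OF h] by simp
  qed
qed

lemma finsum_regular_module: "finsum (regular_module R) f I = finsum R f I"
  by (simp add: finsum_def regular_module_def finprod_def)

definition Or_coord :: "nat set \<Rightarrow> ((nat \<Rightarrow> 'a) list \<Rightarrow> 'a) set \<Rightarrow> 'a" where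
  "Or_coord S = (SOME l. l \<in> mod_hom R (Or R S) (regular_module R) \<and> l (top_wedge S) = \<one>)"

lemma Or_coord:
  assumes "finite S"
  shows "Or_coord S \<in> mod_hom R (Or R S) (regular_module R)" "Or_coord S (top_wedge S) = \<one>"
proof -
  have "\<exists>l. l \<in> mod_hom R (Or R S) (regular_module R) \<and> l (top_wedge S) = \<one>"
    using Or_functional[OF assms] by blast
  from someI_ex[OF this]
  show "Or_coord S \<in> mod_hom R (Or R S) (regular_module R)" "Or_coord S (top_wedge S) = \<one>"
    by (simp_all add: Or_coord_def)
qed

text \<open>
  Both sides are linear in \<open>\<alpha>\<close>, so it suffices to compare them at the generator of \<open>Or S\<close>.
\<close>

lemma Or_coord_wedge:
  assumes S: "finite S" "y \<notin> S" and \<alpha>: "\<alpha> \<in> carrier (Or R S)"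
  shows "Or_coord (insert y S) (Or_wedge R S y \<alpha>) = of_integer ((-1) ^ card {z\<in>S. z < y}) \<otimes> Or_coord S \<alpha>"
proof (rule hom_eq_on_generators[OF Or_module regular_module_module _ _ Or_generated[OF S(1)] _ \<alpha>])
  have S': "finite (insert y S)" using S by simp
  note W = Or_wedge_hom[OF S]
  note c = Or_coord[OF S'] and d = Or_coord[OF S(1)]
  show "(\<lambda>\<alpha>. Or_coord (insert y S) (Or_wedge R S y \<alpha>)) \<in> mod_hom R (Or R S) (regular_module R)"
    by (rule mod_hom_comp[OF W(1) c(1)])
  show "(\<lambda>\<alpha>. of_integer ((-1) ^ card {z\<in>S. z < y}) \<otimes> Or_coord S \<alpha>) \<in> mod_hom R (Or R S) (regular_module R)"
    using mod_homD[OF d(1)] by (intro mod_homI) (auto simp: r_distr m_lcomm)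
  show "Or_coord (insert y S) (Or_wedge R S y \<alpha>) = of_integer ((-1) ^ card {z\<in>S. z < y}) \<otimes> Or_coord S \<alpha>"
    if "\<alpha> \<in> {top_wedge S}" for \<alpha>
    using that W(2) mod_homD(3)[OF c(1) top_wedge_closed[OF S']] c(2) d(2) by simp
qed

context
  fixes a b :: nat
begin

abbreviation (input) "surj_module T \<equiv> free_module R (surjs T {1..a})"
abbreviation (input) "orientation T \<equiv> Or R ({1..b} - T)"
abbreviation (input) "cochains \<equiv> surj_cochains R b a"

lemma surj_summand_module: "module R (surj_summand R b a T)"
  unfolding surj_summand_def by (rule tensor_module_module[OF free_module_module Or_module])

lemma surj_cochains_module: "module R (cochains t)"
  unfolding surj_cochains_def by (rule direct_sum_module[OF finite_layer surj_summand_module])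

text \<open>
  The functional with value \<open>u f \<cdot> Or_coord \<alpha>\<close> at \<open>u \<otimes> \<alpha>\<close>; it reads off the coefficient of \<open>f\<close>. Its
  existence is \<open>tensor_functional\<close>.
\<close>

definition summand_coord :: "nat set \<Rightarrow> (nat \<Rightarrow> nat) \<Rightarrow> 'a summand \<Rightarrow> 'a" where
  "summand_coord T f = (SOME l. l \<in> mod_hom R (surj_summand R b a T) (regular_module R) \<and>
     (\<forall>u\<in>carrier (surj_module T). \<forall>\<alpha>\<in>carrier (orientation T). l (pure_tensor R (surj_module T) (orientation T) u \<alpha>) = u f \<otimes> Or_coord ({1..b} - T) \<alpha>))"

lemma summand_coord:
  shows "summand_coord T f \<in> mod_hom R (surj_summand R b a T) (regular_module R)"
    "u \<in> carrier (surj_module T) \<Longrightarrow> \<alpha> \<in> carrier (orientation T) \<Longrightarrow>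
      summand_coord T f (pure_tensor R (surj_module T) (orientation T) u \<alpha>) = u f \<otimes> Or_coord ({1..b} - T) \<alpha>"
proof -
  let ?c = "Or_coord ({1..b} - T)"
  have "finite ({1..b} - T)" by simp
  note c = mod_homD[OF Or_coord(1)[OF this]]
  have "\<exists>l. l \<in> mod_hom R (tensor_module R (surj_module T) (orientation T)) (regular_module R) \<and>
     (\<forall>u\<in>carrier (surj_module T). \<forall>\<alpha>\<in>carrier (orientation T). l (pure_tensor R (surj_module T) (orientation T) u \<alpha>) = u f \<otimes> ?c \<alpha>)"
  proof (rule tensor_functional[where g = "\<lambda>u \<alpha>. u f \<otimes> ?c \<alpha>", OF free_module_module[of "surjs T {1..a}"] Or_module[of "{1..b} - T"]])
    show "(\<lambda>u. u f \<otimes> ?c \<alpha>) \<in> mod_hom R (surj_module T) (regular_module R)" if "\<alpha> \<in> carrier (orientation T)" for \<alpha>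
      using c(1)[OF that] by (intro mod_homI) (auto simp: free_module_carrier l_distr m_assoc)
    show "(\<lambda>\<alpha>. u f \<otimes> ?c \<alpha>) \<in> mod_hom R (orientation T) (regular_module R)" if "u \<in> carrier (surj_module T)" for u
      using c that by (intro mod_homI) (auto simp: free_module_carrier r_distr m_lcomm)
  qed blast
  from someI_ex[OF this[folded surj_summand_def]]
  show "summand_coord T f \<in> mod_hom R (surj_summand R b a T) (regular_module R)"
    "u \<in> carrier (surj_module T) \<Longrightarrow> \<alpha> \<in> carrier (orientation T) \<Longrightarrow>
      summand_coord T f (pure_tensor R (surj_module T) (orientation T) u \<alpha>) = u f \<otimes> Or_coord ({1..b} - T) \<alpha>"
    unfolding summand_coord_def by blast+
qed

lemma surj_elem_hom:
  assumes "T \<in> layer b t" "f \<in> surjs T {1..a}"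
  shows "surj_elem R b a t T f \<in> mod_hom R (orientation T) (cochains t)"
proof -
  have "(\<lambda>\<alpha>. pure_tensor R (surj_module T) (orientation T) (basis_vec R f) \<alpha>) \<in> mod_hom R (orientation T) (surj_summand R b a T)"
    unfolding surj_summand_def by (rule pure_tensor_hom_right[OF free_module_module Or_module basis_vec_closed[OF assms(2)]])
  from mod_hom_comp[OF this summand_inj_hom[where M = "surj_summand R b a", OF finite_layer surj_summand_module assms(1)]]
  show ?thesis unfolding surj_elem_def surj_cochains_def .
qed

definition coord :: "(nat \<Rightarrow> nat) \<Rightarrow> (nat set \<Rightarrow> 'a summand) \<Rightarrow> 'a" where
  "coord w c = summand_coord (supp w) (restrict w (supp w)) (c (supp w))"

lemma coord_hom: "w \<in> words b a t \<Longrightarrow> coord w \<in> mod_hom R (cochains t) (regular_module R)"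
  unfolding coord_def surj_cochains_def
  by (rule mod_hom_comp[OF direct_sum_proj[OF finite_layer surj_summand_module] summand_coord(1)]) (rule supp_words)

lemma coord_surj_elem:
  assumes w: "w \<in> words b a t" and T: "T \<in> layer b t" and f: "f \<in> surjs T {1..a}" and \<alpha>: "\<alpha> \<in> carrier (orientation T)"
  shows "coord w (surj_elem R b a t T f \<alpha>) = (if w = word_of T f then Or_coord ({1..b} - T) \<alpha> else \<zero>)"
proof (cases "supp w = T")
  case True
  have c: "Or_coord ({1..b} - T) \<alpha> \<in> carrier R" using mod_homD(1)[OF Or_coord(1) \<alpha>] by simp
  have "coord w (surj_elem R b a t T f \<alpha>) = summand_coord T (restrict w T) (pure_tensor R (surj_module T) (orientation T) (basis_vec R f) \<alpha>)"
    using True T by (simp add: coord_def surj_elem_def summand_inj_def)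
  also have "\<dots> = basis_vec R f (restrict w T) \<otimes> Or_coord ({1..b} - T) \<alpha>"
    by (rule summand_coord(2)[OF basis_vec_closed[OF f] \<alpha>])
  finally show ?thesis using True c word_of_eq_iff[OF f, of w] by (simp add: basis_vec_def)
next
  case False
  then have "coord w (surj_elem R b a t T f \<alpha>) = summand_coord (supp w) (restrict w (supp w)) \<zero>\<^bsub>surj_summand R b a (supp w)\<^esub>"
    using supp_words(1)[OF w] by (simp add: coord_def surj_elem_def summand_inj_def)
  also have "\<dots> = \<zero>"
    using hom_zero[OF surj_summand_module regular_module_module summand_coord(1)] by simp
  finally show ?thesis using False word_of_eq_iff[OF f, of w] by simp
qed

definition surj_gen :: "nat \<Rightarrow> (nat \<Rightarrow> nat) \<Rightarrow> nat set \<Rightarrow> 'a summand" where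
  "surj_gen t w = surj_elem R b a t (supp w) (restrict w (supp w)) (top_wedge ({1..b} - supp w))"

lemma gen_closed:
  assumes "w \<in> words b a t" shows "surj_gen t w \<in> carrier (cochains t)"
  unfolding surj_gen_def by (intro mod_homD(1)[OF surj_elem_hom] supp_words[OF assms] top_wedge_closed) simp

lemma coord_gen:
  assumes "w \<in> words b a t" "v \<in> words b a t"
  shows "coord w (surj_gen t v) = (if w = v then \<one> else \<zero>)"
  unfolding surj_gen_def using assms supp_words[OF assms(2)]
  by (subst coord_surj_elem) (auto simp: word_of_supp_restrict Or_coord top_wedge_closed)

lemma surj_cochains_generated: "generates R (cochains t) (surj_gen t ` words b a t)"
proof -
  let ?A = "\<lambda>T. (\<lambda>(u, v). pure_tensor R (surj_module T) (orientation T) u v) ` (basis_vec R ` surjs T {1..a} \<times> {top_wedge ({1..b} - T)})"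
  have "generates R (surj_summand R b a T) (?A T)" for T
    unfolding surj_summand_def
    by (rule tensor_generated[OF free_module_module Or_module free_module_generated Or_generated]) simp
  then have *: "generates R (cochains t) (\<Union>T\<in>layer b t. summand_inj (layer b t) (surj_summand R b a) T ` ?A T)"
    unfolding surj_cochains_def by (rule direct_sum_generated[OF finite_layer surj_summand_module])
  show ?thesis
  proof (rule generates_mono[OF *])
    show "surj_gen t ` words b a t \<subseteq> carrier (cochains t)" using gen_closed by auto
    show "(\<Union>T\<in>layer b t. summand_inj (layer b t) (surj_summand R b a) T ` ?A T) \<subseteq> surj_gen t ` words b a t"
    proof
      fix x assume "x \<in> (\<Union>T\<in>layer b t. summand_inj (layer b t) (surj_summand R b a) T ` ?A T)"
      then obtain T f where T: "T \<in> layer b t" "f \<in> surjs T {1..a}" "x = surj_elem R b a t T f (top_wedge ({1..b} - T))"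
        by (auto simp: surj_elem_def)
      then have "x = surj_gen t (word_of T f)" by (simp add: surj_gen_def supp_word_of restrict_word_of del: One_nat_def)
      then show "x \<in> surj_gen t ` words b a t" using word_of_words[OF T(1,2)] by blast
    qed
  qed
qed

definition coords :: "nat \<Rightarrow> (nat set \<Rightarrow> 'a summand) \<Rightarrow> (nat \<Rightarrow> nat) \<Rightarrow> 'a" where
  "coords t c w = (if w \<in> words b a t then coord w c else \<zero>)"

text \<open>
  The elements \<open>surj_gen t w\<close> generate, and the functionals \<open>coord w\<close> are dual to them.
\<close>

lemma coords_iso:
  shows "coords t \<in> mod_hom R (cochains t) (free_module R (words b a t))"
    "bij_betw (coords t) (carrier (cochains t)) (carrier (free_module R (words b a t)))"
  using dual_basis_iso[where l = coord, OF surj_cochains_module finite_words surj_cochains_generated coord_hom coord_gen]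
  by (simp_all add: coords_def[abs_def])

lemma coords_eq_iff:
  assumes "c \<in> carrier (cochains t)" "e \<in> carrier (cochains t)"
  shows "coords t c = coords t e \<longleftrightarrow> c = e"
  using inj_on_eq_iff[OF bij_betw_imp_inj_on[OF coords_iso(2)] assms] .

lemma surj_cochains_free: "mod_isomorphic R (cochains t) (free_power R (card (words b a t)))"
proof -
  obtain k where k: "bij_betw k {..<card (words b a t)} (words b a t)"
    using ex_bij_betw_nat_finite[OF finite_words, of b a t] by (auto simp: atLeast0LessThan)
  have kw: "k i \<in> words b a t" if "i < card (words b a t)" for i using k that by (auto simp: bij_betw_def)
  have kinj: "k i = k j \<longleftrightarrow> i = j" if "i < card (words b a t)" "j < card (words b a t)" for i j
    using k that by (auto simp: bij_betw_def inj_on_eq_iff)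
  have g: "generates R (cochains t) ((\<lambda>i. surj_gen t (k i)) ` {..<card (words b a t)})"
    using surj_cochains_generated[of t] k by (simp add: bij_betw_def flip: image_image)
  have "\<exists>h\<in>mod_hom R (cochains t) (free_power R (card (words b a t))).
     bij_betw h (carrier (cochains t)) (carrier (free_power R (card (words b a t))))"
    using dual_basis_iso[where l = "\<lambda>i. coord (k i)", OF surj_cochains_module _ g] coord_hom[OF kw] coord_gen[OF kw kw] kinj
    by (intro bexI) auto
  then show ?thesis unfolding mod_isomorphic_def using surj_cochains_module free_module_module by blast
qed

section \<open>The differential in coordinates\<close>

definition diff_spec :: "nat \<Rightarrow> ((nat set \<Rightarrow> 'a summand) \<Rightarrow> (nat set \<Rightarrow> 'a summand)) \<Rightarrow> bool" where
  "diff_spec t d \<longleftrightarrow> d \<in> mod_hom R (cochains t) (cochains (Suc t)) \<and>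
       d \<in> extensional (carrier (cochains t)) \<and>
       (\<forall>T\<in>layer b t. \<forall>f\<in>surjs T {1..a}. \<forall>\<alpha>\<in>carrier (orientation T).
          d (surj_elem R b a t T f \<alpha>) =
            (\<Oplus>\<^bsub>cochains (Suc t)\<^esub>
              y\<in>{y \<in> T. restrict f (T - {y}) \<in> surjs (T - {y}) {1..a}}.
                surj_elem R b a (Suc t) (T - {y}) (restrict f (T - {y}))
                  (Or_wedge R ({1..b} - T) y \<alpha>)))"

lemma word_of_delete: "word_of (T - {y}) (restrict f (T - {y})) = (word_of T f)(y := 0)"
  by (auto simp: word_of_def fun_eq_iff)

text \<open>
  The value prescribed for the differential at \<open>[f] \<otimes> \<alpha>\<close> has the coordinates of the differential on
  words. A summand \<open>y\<close> contributes only at the word of \<open>f\<close> with the letter at \<open>y\<close> deleted, with the sign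
  of \<open>y \<and> \<alpha>\<close>; these words are distinct for distinct \<open>y\<close>, and that such a word still uses all letters is
  the condition that the restriction of \<open>f\<close> is surjective.
\<close>

lemma diff_spec_rhs:
  assumes T: "T \<in> layer b t" and f: "f \<in> surjs T {1..a}" and \<alpha>: "\<alpha> \<in> carrier (orientation T)"
  defines "Y \<equiv> {y \<in> T. restrict f (T - {y}) \<in> surjs (T - {y}) {1..a}}"
  defines "S \<equiv> (\<Oplus>\<^bsub>cochains (Suc t)\<^esub> y\<in>Y. surj_elem R b a (Suc t) (T - {y}) (restrict f (T - {y})) (Or_wedge R ({1..b} - T) y \<alpha>))"
  shows "S \<in> carrier (cochains (Suc t))"
    and "coords (Suc t) S = bd_R a b t (coords t (surj_elem R b a t T f \<alpha>))"
proof -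
  interpret C: module R "cochains (Suc t)" by (rule surj_cochains_module)
  let ?w = "word_of T f"
  let ?c = "Or_coord ({1..b} - T) \<alpha>"
  have cR: "?c \<in> carrier R" using mod_homD(1)[OF Or_coord(1) \<alpha>] by simp
  have w: "?w \<in> words b a t" by (rule word_of_words[OF T f])
  note TD = layer_D[OF T]
  have layer: "T - {y} \<in> layer b (Suc t)" if "y \<in> T" for y
    using TD that by (auto simp: layer_def card_Diff_singleton) (metis Suc_pred card_gt_0_iff empty_iff)
  have comp: "{1..b} - (T - {y}) = insert y ({1..b} - T)" if "y \<in> T" for y using TD that by auto
  have wedge: "Or_wedge R ({1..b} - T) y \<alpha> \<in> carrier (orientation (T - {y}))" if "y \<in> T" for y
    unfolding comp[OF that] using mod_homD(1)[OF Or_wedge_hom(1) \<alpha>] that by simp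
  let ?s = "\<lambda>y. surj_elem R b a (Suc t) (T - {y}) (restrict f (T - {y})) (Or_wedge R ({1..b} - T) y \<alpha>)"
  have s: "?s y \<in> carrier (cochains (Suc t))" if "y \<in> Y" for y
    using that layer wedge by (intro mod_homD(1)[OF surj_elem_hom]) (auto simp: Y_def)
  show SC: "S \<in> carrier (cochains (Suc t))" unfolding S_def using s by (intro C.finsum_closed) auto
  have Y: "y \<in> Y \<longleftrightarrow> ?w y \<noteq> 0 \<and> ?w(y := 0) \<in> words b a (Suc t)" for y
  proof
    assume y: "y \<in> Y"
    then have yT: "y \<in> T" by (simp add: Y_def)
    have "word_of (T - {y}) (restrict f (T - {y})) \<in> words b a (Suc t)"
      using y layer[OF yT] by (intro word_of_words) (auto simp: Y_def)
    then show "?w y \<noteq> 0 \<and> ?w(y := 0) \<in> words b a (Suc t)"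
      using yT surjs_pos[OF f yT] by (simp add: word_of_delete) (simp add: word_of_def)
  next
    assume y: "?w y \<noteq> 0 \<and> ?w(y := 0) \<in> words b a (Suc t)"
    then have yT: "y \<in> T" by (cases "y \<in> T") (simp_all add: word_of_def)
    have "supp (?w(y := 0)) = T - {y}" using supp_word_of[OF f] by (auto simp: supp_def)
    moreover have "restrict (?w(y := 0)) (T - {y}) = restrict f (T - {y})" by (auto simp: word_of_def)
    ultimately show "y \<in> Y" using supp_words(2)[of "?w(y := 0)" b a "Suc t"] y yT by (simp add: Y_def)
  qed
  have cs: "coord u (?s y) = (if u = ?w(y := 0) then of_integer (pos_sign b (?w(y := 0)) y) \<otimes> ?c else \<zero>)"
    if u: "u \<in> words b a (Suc t)" and y: "y \<in> Y" for u y
  proof -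
    have yT: "y \<in> T" using y by (simp add: Y_def)
    have yb: "y \<in> {1..b}" using yT TD by auto
    have f': "restrict f (T - {y}) \<in> surjs (T - {y}) {1..a}" using y by (simp add: Y_def)
    have "{z \<in> zeros b (?w(y := 0)). z < y} = {z \<in> {1..b} - T. z < y}"
      unfolding zeros_erase[OF yb] zeros_word_of[OF f] by auto
    then have sgn: "pos_sign b (?w(y := 0)) y = (-1) ^ card {z \<in> {1..b} - T. z < y}" by (simp only: pos_sign_def)
    have "Or_coord ({1..b} - (T - {y})) (Or_wedge R ({1..b} - T) y \<alpha>) = of_integer (pos_sign b (?w(y := 0)) y) \<otimes> ?c"
      unfolding comp[OF yT] sgn using yT by (intro Or_coord_wedge \<alpha>) auto
    then show ?thesis
      using coord_surj_elem[OF u layer[OF yT] f' wedge[OF yT]] by (simp only: word_of_delete)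
  qed
  have "coords t (surj_elem R b a t T f \<alpha>) = (\<lambda>u. ?c \<otimes> basis_vec R ?w u)"
    using coord_surj_elem[OF _ T f \<alpha>] w cR by (intro ext) (auto simp: coords_def basis_vec_def simp del: One_nat_def)
  then have "bd_R a b t (coords t (surj_elem R b a t T f \<alpha>)) = (\<lambda>u. ?c \<otimes> bd_R a b t (basis_vec R ?w) u)"
    using mod_homD(3)[OF bd_R_hom basis_vec_closed[OF w] cR] by simp
  then have rhs: "bd_R a b t (coords t (surj_elem R b a t T f \<alpha>)) u
      = (if u \<in> words b a (Suc t) then ?c \<otimes> of_integer (bd b a t (delta ?w) u) else \<zero>)" for u
    using cR by (simp add: bd_R_basis_vec[OF w] int_vec_def)
  show "coords (Suc t) S = bd_R a b t (coords t (surj_elem R b a t T f \<alpha>))"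
  proof
    fix u
    show "coords (Suc t) S u = bd_R a b t (coords t (surj_elem R b a t T f \<alpha>)) u"
    proof (cases "u \<in> words b a (Suc t)")
      case True
      have "coords (Suc t) S u = (\<Oplus>y\<in>Y. coord u (?s y))"
        using True hom_finsum[where f = ?s and I = Y, OF surj_cochains_module regular_module_module coord_hom[OF True] s]
        by (simp only: coords_def S_def finsum_regular_module if_True)
      also have "\<dots> = (\<Oplus>y\<in>Y. if u = ?w(y := 0) then of_integer (pos_sign b (?w(y := 0)) y) \<otimes> ?c else \<zero>)"
        using cs[OF True] cR by (intro finsum_cong') auto
      also have "\<dots> = ?c \<otimes> of_integer (bd b a t (delta ?w) u)"
      proof (cases "\<exists>y\<in>Y. u = ?w(y := 0)")
        case True
        then obtain y where y: "y \<in> Y" "u = ?w(y := 0)" by blast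
        have uniq: "u = ?w(x := 0) \<longleftrightarrow> y = x" if "x \<in> Y" for x
        proof
          assume eq: "u = ?w(x := 0)"
          show "y = x"
          proof (rule ccontr)
            assume "y \<noteq> x"
            then have "?w x = u x" using y(2) by simp
            then show False using eq Y that by simp
          qed
        qed (simp add: y)
        have fin: "finite Y" using TD by (simp add: Y_def)
        have "(\<Oplus>x\<in>Y. if u = ?w(x := 0) then of_integer (pos_sign b (?w(x := 0)) x) \<otimes> ?c else \<zero>)
          = (\<Oplus>x\<in>Y. if y = x then of_integer (pos_sign b (?w(x := 0)) x) \<otimes> ?c else \<zero>)"
          using uniq cR by (intro finsum_cong') auto
        also have "\<dots> = of_integer (pos_sign b (?w(y := 0)) y) \<otimes> ?c"
          using y(1) fin cR by (intro finsum_singleton) auto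
        also have "pos_sign b (?w(y := 0)) y = bd b a t (delta ?w) u"
          unfolding y(2) using Y y(1) w by (intro bd_delta_hit[symmetric]) auto
        finally show ?thesis by (simp only: m_comm[OF of_integer_closed cR])
      next
        case False
        have "bd b a t (delta ?w) u = 0"
          using False Y \<open>u \<in> words b a (Suc t)\<close> by (intro bd_delta_miss) blast
        moreover have "(\<Oplus>y\<in>Y. if u = ?w(y := 0) then of_integer (pos_sign b (?w(y := 0)) y) \<otimes> ?c else \<zero>) = \<zero>"
          using False by (intro add.finprod_one_eqI) auto
        ultimately show ?thesis using cR by simp
      qed
      finally show ?thesis using True rhs by simp
    next
      case False then show ?thesis using rhs by (simp add: coords_def)
    qed
  qed
qed

text \<open>
  Transporting \<open>bd_R\<close> back along the coordinate isomorphisms gives a map as required, by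
  \<open>diff_spec_rhs\<close>. It is the only one, as the elements \<open>[f] \<otimes> \<alpha>\<close> generate and the map is extensional;
  hence the definite description denotes it.
\<close>

lemma surj_diff_eq_bd_R:
  shows "surj_diff R b a t \<in> mod_hom R (cochains t) (cochains (Suc t))"
    and "\<And>c. c \<in> carrier (cochains t) \<Longrightarrow> coords (Suc t) (surj_diff R b a t c) = bd_R a b t (coords t c)"
proof -
  let ?inv = "inv_into (carrier (cochains (Suc t))) (coords (Suc t))"
  define d0 where "d0 = restrict (\<lambda>c. ?inv (bd_R a b t (coords t c))) (carrier (cochains t))"
  interpret C: module R "cochains t" by (rule surj_cochains_module)
  have inv_hom: "?inv \<in> mod_hom R (free_module R (words b a (Suc t))) (cochains (Suc t))"
    by (rule inverse_mod_hom[OF coords_iso surj_cochains_module])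
  have "(\<lambda>c. ?inv (bd_R a b t (coords t c))) \<in> mod_hom R (cochains t) (cochains (Suc t))"
    by (rule mod_hom_comp[OF mod_hom_comp[OF coords_iso(1) bd_R_hom] inv_hom])
  then have d0h: "d0 \<in> mod_hom R (cochains t) (cochains (Suc t))"
    by (rule mod_hom_cong[OF surj_cochains_module]) (simp add: d0_def)
  have d0c: "coords (Suc t) (d0 c) = bd_R a b t (coords t c)" if "c \<in> carrier (cochains t)" for c
  proof -
    have "bd_R a b t (coords t c) \<in> carrier (free_module R (words b a (Suc t)))"
      by (rule mod_homD(1)[OF mod_hom_comp[OF coords_iso(1) bd_R_hom] that])
    then show ?thesis using that coords_iso(2)[of "Suc t"] by (simp add: d0_def bij_betw_inv_into_right)
  qed
  have spec: "diff_spec t d0"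
    unfolding diff_spec_def
  proof (intro conjI ballI)
    fix T f \<alpha> assume *: "T \<in> layer b t" "f \<in> surjs T {1..a}" "\<alpha> \<in> carrier (orientation T)"
    have e: "surj_elem R b a t T f \<alpha> \<in> carrier (cochains t)" by (rule mod_homD(1)[OF surj_elem_hom[OF *(1,2)] *(3)])
    show "d0 (surj_elem R b a t T f \<alpha>) =
            (\<Oplus>\<^bsub>cochains (Suc t)\<^esub>
              y\<in>{y \<in> T. restrict f (T - {y}) \<in> surjs (T - {y}) {1..a}}.
                surj_elem R b a (Suc t) (T - {y}) (restrict f (T - {y}))
                  (Or_wedge R ({1..b} - T) y \<alpha>))"
      using diff_spec_rhs(2)[OF *]
      unfolding d0c[OF e, symmetric] coords_eq_iff[OF diff_spec_rhs(1)[OF *] mod_homD(1)[OF d0h e]] by (rule sym)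
  qed (use d0h in \<open>auto simp: d0_def\<close>)
  have uniq: "d = d0" if "diff_spec t d" for d
  proof (rule extensionalityI)
    show "d \<in> extensional (carrier (cochains t))" "d0 \<in> extensional (carrier (cochains t))"
      using that spec by (auto simp: diff_spec_def)
    fix c assume c: "c \<in> carrier (cochains t)"
    have dh: "d \<in> mod_hom R (cochains t) (cochains (Suc t))" using that by (simp add: diff_spec_def)
    show "d c = d0 c"
    proof (rule hom_eq_on_generators[OF surj_cochains_module surj_cochains_module dh d0h surj_cochains_generated _ c])
      fix x assume "x \<in> surj_gen t ` words b a t"
      then obtain w where w: "w \<in> words b a t" "x = surj_gen t w" by blast
      note sw = supp_words[OF w(1)]
      have "top_wedge ({1..b} - supp w) \<in> carrier (orientation (supp w))" by (intro top_wedge_closed) simp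
      then show "d x = d0 x" using that spec sw(1,2) unfolding diff_spec_def w(2) surj_gen_def by simp
    qed
  qed
  have "surj_diff R b a t = (THE d. diff_spec t d)" unfolding surj_diff_def diff_spec_def ..
  also have "\<dots> = d0" using spec uniq by (rule the_equality)
  finally have "surj_diff R b a t = d0" .
  then show "surj_diff R b a t \<in> mod_hom R (cochains t) (cochains (Suc t))"
    and "\<And>c. c \<in> carrier (cochains t) \<Longrightarrow> coords (Suc t) (surj_diff R b a t c) = bd_R a b t (coords t c)"
    using d0h d0c by simp_all
qed

section \<open>Cohomology and Euler characteristic\<close>

text \<open>
  The first isomorphism theorem for a map to \<open>R\<^sup>n\<close> given by \<open>n\<close> functionals. That \<open>N\<close> is a submodule
  follows from its being the common kernel.
\<close>

lemma quot_iso_free_power: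
  fixes M :: "('a, 'm) module"
  assumes M: "module R M" and l: "\<And>i. i < n \<Longrightarrow> l i \<in> mod_hom R M (regular_module R)"
    and surj: "\<And>r. (\<And>i. i < n \<Longrightarrow> r i \<in> carrier R) \<Longrightarrow> \<exists>z\<in>carrier M. \<forall>i<n. l i z = r i"
    and N: "N \<subseteq> carrier M" "\<And>z. z \<in> carrier M \<Longrightarrow> z \<in> N \<longleftrightarrow> (\<forall>i<n. l i z = \<zero>)"
  shows "mod_isomorphic R (quot_module M N) (free_power R n)"
proof -
  let ?h = "\<lambda>z i. if i < n then l i z else \<zero>"
  have lc: "l i z \<in> carrier R" if "i < n" "z \<in> carrier M" for i z using mod_homD(1)[OF l] that by auto
  have h: "?h \<in> mod_hom R M (free_power R n)"
  proof (rule mod_homI)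
    show "?h u \<in> carrier (free_power R n)" if "u \<in> carrier M" for u
      using that lc by (auto simp: free_module_carrier intro: finite_subset[of _ "{..<n}"])
  qed (use mod_homD(2,3)[OF l] in \<open>auto simp: fun_eq_iff\<close>)
  have ker: "z \<in> N \<longleftrightarrow> ?h z = \<zero>\<^bsub>free_power R n\<^esub>" if "z \<in> carrier M" for z
    using N(2)[OF that] by (auto simp: fun_eq_iff)
  have "N = {z \<in> carrier M. ?h z \<in> {\<zero>\<^bsub>free_power R n\<^esub>}}" using ker N(1) by blast
  then have sub: "submodule N R M"
    using preimage_submodule[OF M free_module_module h zero_submodule[OF free_module_module]] by simp
  show ?thesis
  proof (rule first_isomorphism[OF M sub free_module_module h _ ker])
    show "?h ` carrier M = carrier (free_power R n)"
    proof
      show "?h ` carrier M \<subseteq> carrier (free_power R n)" using mod_homD(1)[OF h] by auto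
      show "carrier (free_power R n) \<subseteq> ?h ` carrier M"
      proof
        fix r assume r: "r \<in> carrier (free_power R n)"
        then obtain z where z: "z \<in> carrier M" "\<forall>i<n. l i z = r i"
          using surj[of r] by (auto simp: free_module_carrier)
        have "r = ?h z" using z(2) r by (auto simp: free_module_carrier fun_eq_iff)
        then show "r \<in> ?h ` carrier M" using z(1) by blast
      qed
    qed
  qed
qed

context
  assumes ab: "a < b"
begin

abbreviation (input) "cocycles t \<equiv> {c \<in> carrier (cochains t). surj_diff R b a t c = \<zero>\<^bsub>cochains (Suc t)\<^esub>}"

lemma cocycles_module: "module R (cochains t\<lparr>carrier := cocycles t\<rparr>)"
proof (rule submodule.submodule_is_module[OF _ surj_cochains_module])
  have "submodule {c \<in> carrier (cochains t). surj_diff R b a t c \<in> {\<zero>\<^bsub>cochains (Suc t)\<^esub>}} R (cochains t)"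
    by (rule preimage_submodule[OF surj_cochains_module surj_cochains_module surj_diff_eq_bd_R(1) zero_submodule[OF surj_cochains_module]])
  then show "submodule (cocycles t) R (cochains t)" by simp
qed

lemma cocycle_iff:
  assumes "c \<in> carrier (cochains t)"
  shows "surj_diff R b a t c = \<zero>\<^bsub>cochains (Suc t)\<^esub> \<longleftrightarrow> bd_R a b t (coords t c) = (\<lambda>_. \<zero>)"
proof -
  interpret C: module R "cochains (Suc t)" by (rule surj_cochains_module)
  have z: "coords (Suc t) \<zero>\<^bsub>cochains (Suc t)\<^esub> = (\<lambda>_. \<zero>)"
    using hom_zero[OF surj_cochains_module free_module_module coords_iso(1)] by simp
  have "surj_diff R b a t c = \<zero>\<^bsub>cochains (Suc t)\<^esub> \<longleftrightarrow> coords (Suc t) (surj_diff R b a t c) = coords (Suc t) \<zero>\<^bsub>cochains (Suc t)\<^esub>"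
    by (rule coords_eq_iff[OF mod_homD(1)[OF surj_diff_eq_bd_R(1) assms] C.zero_closed, symmetric])
  then show ?thesis unfolding z surj_diff_eq_bd_R(2)[OF assms] .
qed

lemma coords_surj:
  assumes "u \<in> carrier (word_module a b t)" obtains c where "c \<in> carrier (cochains t)" "coords t c = u"
proof -
  have "u \<in> coords t ` carrier (cochains t)"
    using assms unfolding bij_betw_imp_surj_on[OF coords_iso(2)] .
  then show thesis using that by auto
qed

lemma coboundary_iff:
  assumes c: "c \<in> carrier (cochains (Suc t))"
  shows "c \<in> coboundaries cochains (surj_diff R b a) (Suc t) \<longleftrightarrow> (\<exists>v\<in>carrier (word_module a b t). coords (Suc t) c = bd_R a b t v)"
proof
  assume "c \<in> coboundaries cochains (surj_diff R b a) (Suc t)"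
  then obtain e where "e \<in> carrier (cochains t)" "c = surj_diff R b a t e" by (auto simp: coboundaries_def)
  then show "\<exists>v\<in>carrier (word_module a b t). coords (Suc t) c = bd_R a b t v"
    using surj_diff_eq_bd_R(2) mod_homD(1)[OF coords_iso(1)] by blast
next
  assume "\<exists>v\<in>carrier (word_module a b t). coords (Suc t) c = bd_R a b t v"
  then obtain v where v: "v \<in> carrier (word_module a b t)" "coords (Suc t) c = bd_R a b t v" by blast
  obtain e where e: "e \<in> carrier (cochains t)" "coords t e = v" by (rule coords_surj[OF v(1)])
  have "coords (Suc t) (surj_diff R b a t e) = coords (Suc t) c" using surj_diff_eq_bd_R(2) e v(2) by simp
  then have "surj_diff R b a t e = c"
    by (simp only: coords_eq_iff[OF mod_homD(1)[OF surj_diff_eq_bd_R(1) e(1)] c])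
  then show "c \<in> coboundaries cochains (surj_diff R b a) (Suc t)" using e(1) by (auto simp: coboundaries_def)
qed

lemma coboundaries_cocycles: "coboundaries cochains (surj_diff R b a) t \<subseteq> cocycles t"
proof (cases t)
  case 0
  interpret C: module R "cochains 0" by (rule surj_cochains_module)
  have "surj_diff R b a 0 \<zero>\<^bsub>cochains 0\<^esub> = \<zero>\<^bsub>cochains (Suc 0)\<^esub>"
    by (rule hom_zero[OF surj_cochains_module surj_cochains_module surj_diff_eq_bd_R(1)])
  then have "{\<zero>\<^bsub>cochains 0\<^esub>} \<subseteq> cocycles 0" using C.zero_closed by blast
  then show ?thesis unfolding 0 by (simp only: coboundaries_def nat.case)
next
  case (Suc s)
  show ?thesis
  proof
    fix c assume c: "c \<in> coboundaries cochains (surj_diff R b a) t"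
    then obtain e where "e \<in> carrier (cochains s)" "c = surj_diff R b a s e" by (auto simp: coboundaries_def Suc)
    then have cC: "c \<in> carrier (cochains (Suc s))" using mod_homD(1)[OF surj_diff_eq_bd_R(1)] by blast
    obtain v where v: "v \<in> carrier (word_module a b s)" "coords (Suc s) c = bd_R a b s v"
      using coboundary_iff[OF cC] c unfolding Suc by blast
    have "surj_diff R b a (Suc s) c = \<zero>\<^bsub>cochains (Suc (Suc s))\<^esub>"
      unfolding cocycle_iff[OF cC] v(2) by (rule bd_R_bd_R[OF v(1)])
    then show "c \<in> cocycles t" unfolding Suc using cC by blast
  qed
qed

lemma coords_restrict_hom:
  assumes "l \<in> mod_hom R (word_module a b t) (regular_module R)"
  shows "(\<lambda>c. l (coords t c)) \<in> mod_hom R (cochains t\<lparr>carrier := cocycles t\<rparr>) (regular_module R)"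
  using mod_homD[OF mod_hom_comp[OF coords_iso(1) assms]] by (intro mod_homI) auto

text \<open>
  A cocycle of degree \<open>0\<close> is determined by its coefficients at the words that are not pivots, and these
  can be prescribed arbitrarily.
\<close>

lemma cohomology_0:
  "mod_isomorphic R (surj_cohomology R b a 0) (free_power R (card (words b a 0 - pivots b a 0)))"
proof -
  let ?K = "words b a 0 - pivots b a 0"
  have "finite ?K" by simp
  then obtain k where k: "bij_betw k {..<card ?K} ?K"
    using ex_bij_betw_nat_finite[of ?K] by (auto simp: atLeast0LessThan)
  have kK: "k i \<in> ?K" if "i < card ?K" for i using k that by (auto simp: bij_betw_def)
  have ev: "(\<lambda>u. u w) \<in> mod_hom R (word_module a b 0) (regular_module R)" for w
    by (intro mod_homI) (auto simp: free_module_carrier)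
  show ?thesis unfolding surj_cohomology_def cohomology_def
  proof (rule quot_iso_free_power[where l = "\<lambda>i c. coords 0 c (k i)", OF cocycles_module coords_restrict_hom[OF ev]])
    fix r :: "nat \<Rightarrow> 'a" assume r: "\<And>i. i < card ?K \<Longrightarrow> r i \<in> carrier R"
    define s where "s w = (if w \<in> ?K then r (inv_into {..<card ?K} k w) else \<zero>)" for w
    have "inv_into {..<card ?K} k w < card ?K" if "w \<in> ?K" for w
      using that k by (metis bij_betw_def inv_into_into lessThan_iff)
    then have "s \<in> carrier (word_module a b 0)" using r by (auto simp: s_def free_module_carrier intro: finite_subset[of _ "?K"])
    from closed_R_extension[OF ab this]
    obtain u where u: "u \<in> carrier (word_module a b 0)" "bd_R a b 0 u = (\<lambda>_. \<zero>)" "\<And>w. w \<in> ?K \<Longrightarrow> u w = s w" by blast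
    obtain c where c: "c \<in> carrier (cochains 0)" "coords 0 c = u" by (rule coords_surj[OF u(1)])
    have "c \<in> cocycles 0" using c u(2) cocycle_iff[OF c(1)] by simp
    moreover have "coords 0 c (k i) = r i" if "i < card ?K" for i
      using u(3)[OF kK[OF that]] kK[OF that] k that c(2) by (simp add: s_def bij_betw_inv_into_left)
    ultimately show "\<exists>z\<in>carrier (cochains 0\<lparr>carrier := cocycles 0\<rparr>). \<forall>i<card ?K. coords 0 z (k i) = r i" by auto
  next
    show "coboundaries cochains (surj_diff R b a) 0 \<subseteq> carrier (cochains 0\<lparr>carrier := cocycles 0\<rparr>)" using coboundaries_cocycles by simp
    fix z assume "z \<in> carrier (cochains 0\<lparr>carrier := cocycles 0\<rparr>)"
    then have z: "z \<in> carrier (cochains 0)" "bd_R a b 0 (coords 0 z) = (\<lambda>_. \<zero>)" using cocycle_iff by auto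
    interpret C: module R "cochains 0" by (rule surj_cochains_module)
    have cz: "coords 0 \<zero>\<^bsub>cochains 0\<^esub> = (\<lambda>_. \<zero>)"
      using hom_zero[OF surj_cochains_module free_module_module coords_iso(1)] by simp
    have kimg: "\<exists>i<card ?K. w = k i" if "w \<in> ?K" for w
      using that bij_betw_imp_surj_on[OF k] by (metis imageE lessThan_iff)
    have "(\<forall>i<card ?K. coords 0 z (k i) = \<zero>) \<longleftrightarrow> (\<forall>w\<in>?K. coords 0 z w = \<zero>)"
      using kimg kK by metis
    also have "\<dots> \<longleftrightarrow> coords 0 z = (\<lambda>_. \<zero>)"
      using closed_R_zero[OF ab mod_homD(1)[OF coords_iso(1) z(1)] z(2)] by auto
    also have "\<dots> \<longleftrightarrow> z = \<zero>\<^bsub>cochains 0\<^esub>"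
      unfolding cz[symmetric] by (rule coords_eq_iff[OF z(1) C.zero_closed])
    finally show "z \<in> coboundaries cochains (surj_diff R b a) 0 \<longleftrightarrow> (\<forall>i<card ?K. coords 0 z (k i) = \<zero>)"
      by (simp add: coboundaries_def)
  qed
qed

lemma cohomology_middle:
  assumes t: "Suc t \<noteq> b - a"
  shows "mod_isomorphic R (surj_cohomology R b a (Suc t)) (free_power R 0)"
  unfolding surj_cohomology_def cohomology_def
proof (rule quot_iso_free_power[where l = "\<lambda>_ _. \<zero>", OF cocycles_module])
  interpret C: module R "cochains (Suc t)" by (rule surj_cochains_module)
  interpret Z: module R "cochains (Suc t)\<lparr>carrier := cocycles (Suc t)\<rparr>" by (rule cocycles_module)
  show "\<exists>z\<in>carrier (cochains (Suc t)\<lparr>carrier := cocycles (Suc t)\<rparr>). \<forall>i<0. \<zero> = r i" for r :: "nat \<Rightarrow> 'a"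
    using Z.zero_closed by blast
  show "coboundaries cochains (surj_diff R b a) (Suc t) \<subseteq> carrier (cochains (Suc t)\<lparr>carrier := cocycles (Suc t)\<rparr>)" using coboundaries_cocycles by simp
  fix z assume "z \<in> carrier (cochains (Suc t)\<lparr>carrier := cocycles (Suc t)\<rparr>)"
  then have z: "z \<in> carrier (cochains (Suc t))" "bd_R a b (Suc t) (coords (Suc t) z) = (\<lambda>_. \<zero>)" using cocycle_iff by auto
  note u = mod_homD(1)[OF coords_iso(1) z(1)]
  have "top_R a b (Suc t) (coords (Suc t) z) = \<zero>" using t ab by (intro top_R_other_degree[OF u]) simp
  from bd_R_exact[OF ab u z(2) this]
  show "z \<in> coboundaries cochains (surj_diff R b a) (Suc t) \<longleftrightarrow> (\<forall>i<0::nat. \<zero> = \<zero>)" using coboundary_iff[OF z(1)] by simp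
qed auto

text \<open>
  In the top degree every cochain is closed, as there are no words of higher degree, and the top
  functional induces the isomorphism.
\<close>

lemma cohomology_top: "mod_isomorphic R (surj_cohomology R b a (b - a)) (free_power R 1)"
proof -
  obtain t where t: "b - a = Suc t" using ab by (metis Suc_diff_Suc)
  let ?l = "\<lambda>c. top_R a b (Suc t) (coords (Suc t) c)"
  show ?thesis unfolding t surj_cohomology_def cohomology_def
  proof (rule quot_iso_free_power[where l = "\<lambda>_::nat. ?l", OF cocycles_module coords_restrict_hom[OF top_R_hom]])
    show "\<exists>z\<in>carrier (cochains (Suc t)\<lparr>carrier := cocycles (Suc t)\<rparr>). \<forall>i<1. ?l z = r i" if r: "\<And>i. i < 1 \<Longrightarrow> r i \<in> carrier R" for r :: "nat \<Rightarrow> 'a"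
    proof -
      interpret F: module R "word_module a b (Suc t)" by (rule free_module_module)
      obtain u where u: "u \<in> carrier (word_module a b (Suc t))" "top_R a b (Suc t) u = \<one>" using top_R_onto[OF ab] unfolding t by blast
      have r0: "r 0 \<in> carrier R" using r by simp
      let ?u = "r 0 \<odot>\<^bsub>word_module a b (Suc t)\<^esub> u"
      have u': "?u \<in> carrier (word_module a b (Suc t))" by (rule F.smult_closed[OF r0 u(1)])
      obtain c where c: "c \<in> carrier (cochains (Suc t))" "coords (Suc t) c = ?u" by (rule coords_surj[OF u'])
      have "words b a (Suc (Suc t)) = {}" using t ab by (intro words_high_degree) simp
      then have "bd_R a b (Suc t) ?u = (\<lambda>_. \<zero>)"
        using mod_homD(1)[OF bd_R_hom u'] by (auto simp: free_module_carrier)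
      then have "c \<in> cocycles (Suc t)" using cocycle_iff[OF c(1)] c by simp
      moreover have "?l c = r 0" unfolding c(2) mod_homD(3)[OF top_R_hom u(1) r0] using u(2) r0 by simp
      ultimately show ?thesis by auto
    qed
    show "coboundaries cochains (surj_diff R b a) (Suc t) \<subseteq> carrier (cochains (Suc t)\<lparr>carrier := cocycles (Suc t)\<rparr>)" using coboundaries_cocycles by simp
    fix z assume "z \<in> carrier (cochains (Suc t)\<lparr>carrier := cocycles (Suc t)\<rparr>)"
    then have z: "z \<in> carrier (cochains (Suc t))" "bd_R a b (Suc t) (coords (Suc t) z) = (\<lambda>_. \<zero>)" using cocycle_iff by auto
    note u = mod_homD(1)[OF coords_iso(1) z(1)]
    have "z \<in> coboundaries cochains (surj_diff R b a) (Suc t) \<longleftrightarrow> ?l z = \<zero>"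
      unfolding coboundary_iff[OF z(1)] using bd_R_exact[OF ab u z(2)] top_R_bd_R by metis
    then show "z \<in> coboundaries cochains (surj_diff R b a) (Suc t) \<longleftrightarrow> (\<forall>i<1::nat. ?l z = \<zero>)" by simp
  qed
qed

lemma euler_char: "has_euler_char R cochains (surj_euler_char b a)"
  unfolding has_euler_char_def
proof (intro exI[of _ "\<lambda>t. card (words b a t)"] conjI allI)
  show "mod_isomorphic R (cochains t) (free_power R (card (words b a t)))" for t by (rule surj_cochains_free)
  have sub: "{t. card (words b a t) \<noteq> 0} \<subseteq> {0..b - a}"
  proof
    fix t assume "t \<in> {t. card (words b a t) \<noteq> 0}"
    then have "words b a t \<noteq> {}" by auto
    then have "\<not> b < a + t" using words_high_degree by blast
    then show "t \<in> {0..b - a}" by simp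
  qed
  then show "finite {t. card (words b a t) \<noteq> 0}" by (rule finite_subset) simp
  show "surj_euler_char b a = (\<Sum>t | card (words b a t) \<noteq> 0. (-1) ^ t * int (card (words b a t)))"
    unfolding euler_char_words[OF ab] using sub by (intro sum.mono_neutral_right) auto
qed

end

end

end

theorem theorem6p15:
  fixes R (structure) and a b :: nat
  assumes "cring R" and "0 < a" and "a < b"
  shows "has_euler_char R (surj_cochains R b a) (surj_euler_char b a) \<and>
         0 \<le> Rk b a \<and>
         (\<forall>t. mod_isomorphic R (surj_cohomology R b a t)
                (free_power R (if t = b - a then 1 else if t = 0 then nat (Rk b a) else 0)))"
proof (intro conjI allI)
  interpret cring R by (rule assms(1))
  note ab = assms(3)
  show "has_euler_char R (surj_cochains R b a) (surj_euler_char b a)" by (rule euler_char[OF ab])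
  show "0 \<le> Rk b a" by (simp add: Rk_eq[OF ab])
  fix t
  show "mod_isomorphic R (surj_cohomology R b a t)
                (free_power R (if t = b - a then 1 else if t = 0 then nat (Rk b a) else 0))"
  proof (cases t)
    case 0
    then show ?thesis using cohomology_0[OF ab] ab by (simp add: Rk_eq[OF ab])
  next
    case (Suc s)
    then show ?thesis using cohomology_middle[OF ab, of s] cohomology_top[OF ab] by simp
  qed
qed

end
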